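(* Consider the W-cycle multigrid method with inherited sublevel bilinear forms. Let $C^{\mathrm R}_{\mathrm{2lvl}}>0$ be a constant, independent of the mesh size, the polynomial approximation degrees and the level, such that for all $k=2,\dots,K$, all numbers of smoothing steps $m_1,m_2$ and all $v\in V_k$ the two-level error propagation operator satisfies $\|\mathbb{E}^{\mathrm{2lvl}}_{k,m_1,m_2}v\|_{1,k}\le C^{\mathrm R}_{\mathrm{2lvl}}\Sigma^{\mathrm R}_k\|v\|_{1,k}$, where $$\Sigma^{\mathrm R}_k=2^{K-k}\frac{p_K^2\,p_k^{\mu}}{(1+m_1)^{1/2}(1+m_2)^{1/2}}.$$ Then there exist a constant $\mathsf C^{\mathrm R}>C^{\mathrm R}_{\mathrm{2lvl}}$ and, for each $k=2,\dots,K$, an integer $\mathsf m_k^{\mathrm R}$, independent of the mesh size but dependent on the polynomial approximation degree and the level $k$, with $$(\mathsf m_k^{\mathrm R})^{1/2}\ge 2^{K-k+2}\,p_K^2\,p_{k-1}^{\mu}\,\frac{(\mathsf C^{\mathrm R})^2}{\mathsf C^{\mathrm R}-C^{\mathrm R}_{\mathrm{2lvl}}},$$ such that the W-cycle error propagation operator satisfies $$\|\mathbb{E}_{k,m_1,m_2}v\|_{1,k}\le\mathsf C^{\mathrm R}\,\Sigma_k^{\mathrm R}\,\|v\|_{1,k}\qquad\forall v\in V_k,$$ provided $m_1+m_2\ge\mathsf m_k^{\mathrm R}$.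
   Context: **Constants.** Constants called independent of the mesh size, polynomial degree and level may depend only on $d$, $\Omega$, the shape-regularity and quasi-uniformity constants, $\boldsymbol\beta$, lower and upper bounds on the penalty parameters $\alpha_k$, the constant $C_p$ below, and the constants in the standing assumptions below. **Meshes and spaces.** $\Omega\subset\mathbb{R}^d$, $d\in\{2,3\}$, is a polygonal/polyhedral domain. $\mathcal{T}_1$ is a quasi-uniform partition of $\Omega$ into shape-regular elements $T=\mathsf{F}_T(\widehat T)$, affine images of a reference element $\widehat T$ (open unit simplex or unit hypercube), and $\mathcal{T}_k$, $k=2,\dots,K$, is obtained from $\mathcal{T}_{k-1}$ by uniform refinement (each element split into $2^d$ elements), so the mesh size is $h_k=h_12^{1-k}$; $h_T$ is the diameter of $T$. The degrees $p_k\ge1$ satisfy $p_{k-1}\le p_k\le C_p\,p_{k-1}$. $V_k=\{v\in L^2(\Omega): v\circ\mathsf F_T\in\mathbb{M}^{p_k}(\widehat T)\ \forall T\in\mathcal{T}_k\}$, where $\mathbb{M}^{p}(\widehat T)$ is the space of polynomials of total degree $\le p$ (simplex) or of degree $\le p$ in each variable (hypercube). Thus $V_1\subseteq\dots\subseteq V_K$. **Jumps, averages, liftings.** $\mathcal{F}_k$ is the set of all faces (edges if $d=2$) of $\mathcal{T}_k$, $\mathcal{F}^I_k$ the interior ones, $\mathcal F_k^B$ the boundary ones. On an interior face shared by $T^\pm$ with outward normals $\mathbf n_{T^\pm}$: $[\![v]\!]=v^+\mathbf n_{T^+}+v^-\mathbf n_{T^-}$, $[\![\boldsymbol\tau]\!]=\boldsymbol\tau^+\cdot\mathbf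 n_{T^+}+\boldsymbol\tau^-\cdot\mathbf n_{T^-}$, $\{\!\{\boldsymbol\tau\}\!\}=\tfrac12(\boldsymbol\tau^++\boldsymbol\tau^-)$. On a boundary face: $[\![v]\!]=v\,\mathbf n_T$, $\{\!\{\boldsymbol\tau\}\!\}=\boldsymbol\tau$. Define $\mathcal R_k(\boldsymbol\tau)=\sum_{F\in\mathcal F_k}r_F(\boldsymbol\tau)$, $\mathcal L_k(v)=\sum_{F\in\mathcal F^I_k}l_F(v)$ with $r_F(\boldsymbol\tau),l_F(v)\in[V_k]^d$ given by $\int_\Omega r_F(\boldsymbol\tau)\cdot\boldsymbol\eta\,dx=-\int_F\boldsymbol\tau\cdot\{\!\{\boldsymbol\eta\}\!\}\,ds$, $\int_\Omega l_F(v)\cdot\boldsymbol\eta\,dx=-\int_F v[\![\boldsymbol\eta]\!]\,ds$ for all $\boldsymbol\eta\in[V_k]^d$. **Bilinear forms.** With $\nabla$ taken elementwise and $\mathcal G_k(v):=\mathcal R_k([\![v]\!])+\mathcal L_k(\boldsymbol\beta\cdot[\![v]\!])$, $$\mathcal A_k(w,v)=\int_\Omega\big(\nabla w\cdot\nabla v+\nabla w\cdot\mathcal G_k(v)+\mathcal G_k(w)\cdot\nabla v+\theta\,\mathcal G_k(w)\cdot\mathcal G_k(v)\big)dx+\sum_{F\in\mathcal F_k}\int_F\sigma_k[\![w]\!]\cdot[\![v]\!]\,ds,$$ where $\sigma_k|_F=\alpha_kp_k^2/\min(h_{T^+},h_{T^-})$ on interior faces and $\alpha_kp_k^2/h_T$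 on boundary faces, $\alpha_k>0$. One of three choices is made: SIPG ($\theta=0$, $\boldsymbol\beta=\mathbf 0$); SIPG($\delta$) ($\theta=0$, $\boldsymbol\beta=(\delta-\tfrac12)\mathbf n_{T^+}$ on each interior face, $\delta\in[0,1]$); LDG ($\theta=1$, $\boldsymbol\beta\in\mathbb R^d$ uniformly bounded, possibly null). For SIPG and SIPG($\delta$), $\alpha_k$ is large enough that $\mathcal A_k$ is coercive on $V_k$, uniformly in $h_k$, $p_k$, $k$, with respect to the norm $\|v\|_{\mathrm{DG},k}^2=\sum_{T\in\mathcal T_k}\|\nabla v\|^2_{L^2(T)}+\sum_{F\in\mathcal F_k}\|\sigma_k^{1/2}[\![v]\!]\|^2_{L^2(F)}$. **Standing assumptions.** Elliptic regularity: the solution $u\in H^1_0(\Omega)$ of $\int_\Omega\nabla u\cdot\nabla v=\int_\Omega fv$ for all $v\in H^1_0(\Omega)$ satisfies $\|u\|_{H^2(\Omega)}\le C\|f\|_{L^2(\Omega)}$. Moreover $\mu\in\{0,1\}$ ($\mu=0$: $p$-optimal, $\mu=1$: $p$-suboptimal) is such that, if $u\in H^{s+1}(\mathcal T_k)$, $s\ge1$, and $u_k\in V_k$ solves $\mathcal A_k(u_k,v)=\int_\Omega fv\,dx$ for all $v\in V_k$, then $$\|u-u_k\|_{\mathrm{DG},k}\le C\frac{h_k^{\min(p_k,s)}}{p_k^{s-\mu/2}}\|u\|_{H^{s+1}(\mathcal T_k)},\qquad\|u-u_k\|_{L^2(\Omega)}\le C\frac{h_k^{\min(p_k,s)+1}}{p_k^{s+1-\mu}}\|u\|_{H^{s+1}(\mathcal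 T_k)}.$$ **Inherited forms, discrete operators and norms.** $R_{k-1}^k:V_{k-1}\to V_k$ is the natural injection and $R_k^K=R_{K-1}^K\cdots R_k^{k+1}$. The inherited forms are $\mathcal A_k^{\mathrm R}(v,w)=\mathcal A_K(R_k^Kv,R_k^Kw)$ for $v,w\in V_k$, $k=1,\dots,K-1$, and $\mathcal A_K^{\mathrm R}=\mathcal A_K$. $\{\phi_i^k\}_{i=1}^{n_k}$ is a basis of $V_k$, each function supported in a single element, obtained by mapping with $\mathsf F_T$ an $L^2(\widehat T)$-orthonormal basis of $\mathbb M^{p_k}(\widehat T)$. For $u=\sum u_i\phi^k_i$, $v=\sum v_i\phi_i^k$: $(u,v)_k=h_k^d\sum_i u_iv_i$. $A^{\mathrm R}_k:V_k\to V_k$ is defined by $(A^{\mathrm R}_ku,v)_k=\mathcal A^{\mathrm R}_k(u,v)$; it is symmetric positive definite for $(\cdot,\cdot)_k$. For $s\in\mathbb R$, $\|v\|_{s,k}:=\sqrt{((A^{\mathrm R}_k)^sv,v)_k}$. **Multigrid with inherited forms.** $P_k^{k-1}:V_k\to V_{k-1}$ is defined by $\mathcal A^{\mathrm R}_{k-1}(P_k^{k-1}v,w)=\mathcal A^{\mathrm R}_k(v,R_{k-1}^kw)$ for all $w\in V_{k-1}$. The smoother is Richardson's: $G_k=\mathrm I_k-(\Lambda^{\mathrm R}_k)^{-1}A^{\mathrm R}_k$, with $\lambda_{\max}(A^{\mathrm R}_k)\le\Lambda^{\mathrm R}_k\le C\,p_K^2p_k^2/(h_Kh_k)$. For $m_1,m_2$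 pre- and post-smoothing steps (nonnegative integers), the two-level operator is $\mathbb E^{\mathrm{2lvl}}_{k,m_1,m_2}=G_k^{m_2}(\mathrm I_k-R_{k-1}^kP_k^{k-1})G_k^{m_1}$, $k\ge2$. The error propagation operator of the W-cycle (exact solve on level 1, two recursive coarse-grid calls on each level) is $$\mathbb E_{1,m_1,m_2}=0,\qquad\mathbb E_{k,m_1,m_2}=G_k^{m_2}\big(\mathrm I_k-R_{k-1}^k(\mathrm I_{k-1}-\mathbb E_{k-1,m_1,m_2}^2)P_k^{k-1}\big)G_k^{m_1},\quad k>1.$$ *)

theory Defs
  imports "HOL-Analysis.Analysis"
begin

section \<open>Sobolev spaces\<close>

text \<open>
  Derivatives are indexed by lists of coordinate directions, so that Sobolev norms
  are taken with the full derivative tensors (Frobenius norm).  All functions are total; functions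
  on a set \<open>S\<close> are integrated with respect to \<open>lebesgue_on S\<close>.
\<close>

definition partial_deriv :: "'n::finite \<Rightarrow> (real^'n \<Rightarrow> real) \<Rightarrow> real^'n \<Rightarrow> real" where
  "partial_deriv i f x = frechet_derivative f (at x) (axis i 1)"

definition iter_deriv :: "'n::finite list \<Rightarrow> (real^'n \<Rightarrow> real) \<Rightarrow> real^'n \<Rightarrow> real" where
  "iter_deriv is f = foldr partial_deriv is f"

definition test_function :: "(real^'n::finite) set \<Rightarrow> (real^'n \<Rightarrow> real) \<Rightarrow> bool" where
  "test_function S \<phi> \<longleftrightarrow>
     (\<forall>is x. iter_deriv is \<phi> differentiable (at x)) \<and>
     compact (closure {x. \<phi> x \<noteq> 0}) \<and> closure {x. \<phi> x \<noteq> 0} \<subseteq> S"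

definition L2_fun :: "(real^'n::finite) set \<Rightarrow> (real^'n \<Rightarrow> real) \<Rightarrow> bool" where
  "L2_fun S u \<longleftrightarrow> u \<in> borel_measurable (lebesgue_on S) \<and> integrable (lebesgue_on S) (\<lambda>x. (u x)\<^sup>2)"

definition L2_nrm :: "(real^'n::finite) set \<Rightarrow> (real^'n \<Rightarrow> real) \<Rightarrow> real" where
  "L2_nrm S u = sqrt (\<integral>x. (u x)\<^sup>2 \<partial>lebesgue_on S)"

definition is_weak_deriv ::
  "(real^'n::finite) set \<Rightarrow> 'n list \<Rightarrow> (real^'n \<Rightarrow> real) \<Rightarrow> (real^'n \<Rightarrow> real) \<Rightarrow> bool" where
  "is_weak_deriv S is u g \<longleftrightarrow>
     (\<forall>\<phi>. test_function S \<phi> \<longrightarrow>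
        (\<integral>x. u x * iter_deriv is \<phi> x \<partial>lebesgue_on S)
          = (- 1) ^ length is * (\<integral>x. g x * \<phi> x \<partial>lebesgue_on S))"

text \<open>Determined almost everywhere on \<open>S\<close> whenever a square integrable weak derivative exists.\<close>

definition weak_deriv ::
  "(real^'n::finite) set \<Rightarrow> 'n list \<Rightarrow> (real^'n \<Rightarrow> real) \<Rightarrow> real^'n \<Rightarrow> real" where
  "weak_deriv S is u = (SOME g. L2_fun S g \<and> is_weak_deriv S is u g)"

text \<open>
  \<open>sobolev S t\<close> is the space $H^t(S)$ for real \<open>t \<ge> 0\<close>; for non-integer \<open>t\<close> the
  Sobolev-Slobodeckij norm is used.
\<close>

definition slobodeckij_kernel ::
  "real \<Rightarrow> (real^'n::finite \<Rightarrow> real) \<Rightarrow> (real^'n) \<times> (real^'n) \<Rightarrow> real" where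
  "slobodeckij_kernel \<sigma> g = (\<lambda>(x, y). (g x - g y)\<^sup>2 / norm (x - y) powr (real CARD('n) + 2 * \<sigma>))"

definition sobolev :: "(real^'n::finite) set \<Rightarrow> real \<Rightarrow> (real^'n \<Rightarrow> real) \<Rightarrow> bool" where
  "sobolev S t u \<longleftrightarrow>
     L2_fun S u \<and>
     (\<forall>is. length is \<le> nat \<lfloor>t\<rfloor> \<longrightarrow> (\<exists>g. L2_fun S g \<and> is_weak_deriv S is u g)) \<and>
     (frac t \<noteq> 0 \<longrightarrow> (\<forall>is. length is = nat \<lfloor>t\<rfloor> \<longrightarrow>
        integrable (lebesgue_on S \<Otimes>\<^sub>M lebesgue_on S)
          (slobodeckij_kernel (frac t) (weak_deriv S is u))))"

definition sobolev_nrm :: "(real^'n::finite) set \<Rightarrow> real \<Rightarrow> (real^'n \<Rightarrow> real) \<Rightarrow> real" where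
  "sobolev_nrm S t u = sqrt (
     (\<Sum>is\<in>{is. length is \<le> nat \<lfloor>t\<rfloor>}. (L2_nrm S (weak_deriv S is u))\<^sup>2) +
     (if frac t = 0 then 0
      else \<Sum>is\<in>{is. length is = nat \<lfloor>t\<rfloor>}.
             integral\<^sup>L (lebesgue_on S \<Otimes>\<^sub>M lebesgue_on S)
               (slobodeckij_kernel (frac t) (weak_deriv S is u))))"

definition broken_sobolev :: "(real^'n::finite) set set \<Rightarrow> real \<Rightarrow> (real^'n \<Rightarrow> real) \<Rightarrow> bool" where
  "broken_sobolev M t u \<longleftrightarrow> (\<forall>T\<in>M. sobolev T t u)"

definition broken_sobolev_nrm ::
  "(real^'n::finite) set set \<Rightarrow> real \<Rightarrow> (real^'n \<Rightarrow> real) \<Rightarrow> real" where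
  "broken_sobolev_nrm M t u = sqrt (\<Sum>T\<in>M. (sobolev_nrm T t u)\<^sup>2)"

definition H10 :: "(real^'n::finite) set \<Rightarrow> (real^'n \<Rightarrow> real) set" where
  "H10 \<Omega> = {u. sobolev \<Omega> 1 u \<and>
     (\<exists>\<phi>. (\<forall>j::nat. test_function \<Omega> (\<phi> j)) \<and>
          (\<lambda>j. sobolev_nrm \<Omega> 1 (\<lambda>x. u x - \<phi> j x)) \<longlonglongrightarrow> 0)}"

definition weak_grad :: "(real^'n::finite) set \<Rightarrow> (real^'n \<Rightarrow> real) \<Rightarrow> real^'n \<Rightarrow> real^'n" where
  "weak_grad \<Omega> u x = (\<chi> i. weak_deriv \<Omega> [i] u x)"

definition weak_solution ::
  "(real^'n::finite) set \<Rightarrow> (real^'n \<Rightarrow> real) \<Rightarrow> (real^'n \<Rightarrow> real) \<Rightarrow> bool" where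
  "weak_solution \<Omega> f u \<longleftrightarrow> u \<in> H10 \<Omega> \<and>
     (\<forall>v\<in>H10 \<Omega>. (\<integral>x. weak_grad \<Omega> u x \<bullet> weak_grad \<Omega> v x \<partial>lebesgue_on \<Omega>)
                   = (\<integral>x. f x * v x \<partial>lebesgue_on \<Omega>))"

definition elliptic_regularity :: "(real^'n::finite) set \<Rightarrow> real \<Rightarrow> bool" where
  "elliptic_regularity \<Omega> C \<longleftrightarrow>
     (\<forall>f u. L2_fun \<Omega> f \<and> weak_solution \<Omega> f u \<longrightarrow>
        sobolev \<Omega> 2 u \<and> sobolev_nrm \<Omega> 2 u \<le> C * L2_nrm \<Omega> f)"

section \<open>Meshes\<close>

definition polyhedral_domain :: "(real^'n::finite) set \<Rightarrow> bool" where
  "polyhedral_domain \<Omega> \<longleftrightarrow>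
     \<Omega> \<noteq> {} \<and> open \<Omega> \<and> connected \<Omega> \<and> bounded \<Omega> \<and> \<Omega> = interior (closure \<Omega>) \<and>
     (\<exists>P. finite P \<and> (\<forall>X\<in>P. polytope X) \<and> closure \<Omega> = \<Union>P)"

datatype ref_kind = Simplex | Cube

definition ref_elem :: "ref_kind \<Rightarrow> (real^'n::finite) set" where
  "ref_elem c = (case c of
      Simplex \<Rightarrow> {x. (\<forall>i. 0 < x $ i) \<and> (\<Sum>i\<in>UNIV. x $ i) < 1}
    | Cube \<Rightarrow> {x. \<forall>i. 0 < x $ i \<and> x $ i < 1})"

definition affine_iso :: "(real^'n::finite \<Rightarrow> real^'n) \<Rightarrow> bool" where
  "affine_iso F \<longleftrightarrow> (\<exists>(B::real^'n^'n) b. invertible B \<and> F = (\<lambda>x. B *v x + b))"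

definition partition_of_domain :: "(real^'n::finite) set \<Rightarrow> (real^'n) set set \<Rightarrow> bool" where
  "partition_of_domain \<Omega> M \<longleftrightarrow>
     finite M \<and> pairwise disjnt M \<and> (\<forall>T\<in>M. T \<subseteq> \<Omega>) \<and> closure \<Omega> = (\<Union>T\<in>M. closure T)"

definition open_simplex :: "(real^'n::finite) set \<Rightarrow> (real^'n) set" where
  "open_simplex X = interior (convex hull X)"

text \<open>
  \<open>uniform_split c T Cs\<close>: the uniform refinement of the single element \<open>T\<close> consists of the
  $2^d$ elements \<open>Cs\<close>.  Triangles are split by the edge midpoints.  Tetrahedra are split by the
  edge midpoints into four corners and an inner octahedron, which is cut along one of its
  diagonals (here the one from \<open>midpoint x0 x2\<close> to \<open>midpoint x1 x3\<close>; all choices arise by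
  renumbering the vertices).
\<close>

definition uniform_split ::
  "ref_kind \<Rightarrow> (real^'n::finite) set \<Rightarrow> (real^'n) set set \<Rightarrow> bool" where
  "uniform_split c T Cs \<longleftrightarrow> (case c of
     Cube \<Rightarrow>
       (\<exists>F. affine_iso F \<and> T = F ` ref_elem Cube \<and>
          Cs = {(\<lambda>x. F ((1/2) *\<^sub>R (x + a))) ` ref_elem Cube |a. \<forall>i. a $ i \<in> {0, 1}})
   | Simplex \<Rightarrow>
       (if CARD('n) = 2 then
          (\<exists>x0 x1 x2. T = open_simplex {x0, x1, x2} \<and>
             (let x01 = midpoint x0 x1; x02 = midpoint x0 x2; x12 = midpoint x1 x2 in
              Cs = {open_simplex {x0, x01, x02}, open_simplex {x01, x1, x12},
                    open_simplex {x02, x12, x2}, open_simplex {x01, x02, x12}}))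
        else CARD('n) = 3 \<and>
          (\<exists>x0 x1 x2 x3. T = open_simplex {x0, x1, x2, x3} \<and>
             (let x01 = midpoint x0 x1; x02 = midpoint x0 x2; x03 = midpoint x0 x3;
                  x12 = midpoint x1 x2; x13 = midpoint x1 x3; x23 = midpoint x2 x3 in
              Cs = {open_simplex {x0, x01, x02, x03}, open_simplex {x01, x1, x12, x13},
                    open_simplex {x02, x12, x2, x23}, open_simplex {x03, x13, x23, x3},
                    open_simplex {x01, x02, x03, x13}, open_simplex {x01, x02, x12, x13},
                    open_simplex {x02, x03, x13, x23}, open_simplex {x02, x12, x13, x23}}))))"

definition uniform_refinement ::
  "ref_kind \<Rightarrow> (real^'n::finite) set set \<Rightarrow> (real^'n) set set \<Rightarrow> bool" where
  "uniform_refinement c M M' \<longleftrightarrow>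
     (\<exists>ch. (\<forall>T\<in>M. uniform_split c T (ch T)) \<and> M' = (\<Union>T\<in>M. ch T))"

section \<open>Faces, traces, jumps and averages\<close>

text \<open>
  An interior face is given by its two neighbours in the order $(T^+, T^-)$; the face itself is
  the intersection of their closures.  A boundary face is given by its element and the face.
\<close>

datatype 'e face = Interior 'e 'e | Boundary 'e 'e

fun face_set :: "(real^'n::finite) set face \<Rightarrow> (real^'n) set" where
  "face_set (Interior T T') = closure T \<inter> closure T'"
| "face_set (Boundary T F) = F"

definition outer_normal :: "(real^'n::finite) set \<Rightarrow> (real^'n) set \<Rightarrow> real^'n" where
  "outer_normal T F =
     (THE n. norm n = 1 \<and> (\<exists>c. (\<forall>y\<in>F. n \<bullet> y = c) \<and> (\<forall>x\<in>T. n \<bullet> x < c)))"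

fun face_normal :: "(real^'n::finite) set face \<Rightarrow> real^'n" where
  "face_normal (Interior T T') = outer_normal T (closure T \<inter> closure T')"
| "face_normal (Boundary T F) = outer_normal T F"

text \<open>
  Surface integral over a planar face with unit normal \<open>n\<close>: by Fubini, the integral with respect to
  the \<open>(d-1)\<close>-dimensional measure is the volume integral over the prism of height 1 erected
  on the face, of the integrand extended constantly in the normal direction.
\<close>

definition face_integral :: "(real^'n::finite) set face \<Rightarrow> (real^'n \<Rightarrow> real) \<Rightarrow> real" where
  "face_integral f g =
     (let F = face_set f; n = face_normal f; a = (SOME a. a \<in> F) in
      (\<integral>x. g (x - (n \<bullet> (x - a)) *\<^sub>R n)
         \<partial>lebesgue_on {y + t *\<^sub>R n |y t. y \<in> F \<and> t \<in> {0..1}}))"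

definition trace :: "(real^'n::finite) set \<Rightarrow> (real^'n \<Rightarrow> 'b::t2_space) \<Rightarrow> real^'n \<Rightarrow> 'b" where
  "trace T v y = Lim (at y within T) v"

fun jump :: "(real^'n::finite) set face \<Rightarrow> (real^'n \<Rightarrow> real) \<Rightarrow> real^'n \<Rightarrow> real^'n" where
  "jump (Interior T T') v y =
     trace T v y *\<^sub>R outer_normal T (closure T \<inter> closure T') +
     trace T' v y *\<^sub>R outer_normal T' (closure T \<inter> closure T')"
| "jump (Boundary T F) v y = trace T v y *\<^sub>R outer_normal T F"

text \<open>The jump of a vector field is only defined on interior faces.\<close>

fun jump_vec :: "(real^'n::finite) set face \<Rightarrow> (real^'n \<Rightarrow> real^'n) \<Rightarrow> real^'n \<Rightarrow> real" where
  "jump_vec (Interior T T') \<tau> y =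
     trace T \<tau> y \<bullet> outer_normal T (closure T \<inter> closure T') +
     trace T' \<tau> y \<bullet> outer_normal T' (closure T \<inter> closure T')"
| "jump_vec (Boundary T F) \<tau> y = undefined"

fun average :: "(real^'n::finite) set face \<Rightarrow> (real^'n \<Rightarrow> real^'n) \<Rightarrow> real^'n \<Rightarrow> real^'n" where
  "average (Interior T T') \<tau> y = (1/2) *\<^sub>R (trace T \<tau> y + trace T' \<tau> y)"
| "average (Boundary T F) \<tau> y = trace T \<tau> y"

fun is_interior_face :: "'e face \<Rightarrow> bool" where
  "is_interior_face (Interior T T') = True"
| "is_interior_face (Boundary T F) = False"

section \<open>Data of a discretization and its multigrid method\<close>

datatype dg_method = SIPG | SIPG_delta real | LDG

text \<open>
  Level-dependent fields are only relevant for levels \<open>1, \<dots>, levels s\<close>.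
  \<open>elem_map s k T\<close> is the affine map $F_T$, \<open>orientation s k\<close> selects the ordering
  $(T^+, T^-)$ of neighbouring elements, \<open>ref_basis s k\<close> lists the orthonormal basis of the
  polynomial space on the reference element, \<open>beta s k F\<close> is the value of the LDG parameter
  on the face \<open>F\<close>, and \<open>Lam s k\<close> is the smoothing parameter.
\<close>

record 'v mg_setting =
  levels :: nat
  dom :: "'v set"
  kind :: ref_kind
  mesh :: "nat \<Rightarrow> 'v set set"
  elem_map :: "nat \<Rightarrow> 'v set \<Rightarrow> 'v \<Rightarrow> 'v"
  orientation :: "nat \<Rightarrow> ('v set \<times> 'v set) set"
  pdeg :: "nat \<Rightarrow> nat"
  ref_basis :: "nat \<Rightarrow> ('v \<Rightarrow> real) list"
  dgm :: dg_method
  beta :: "nat \<Rightarrow> 'v set face \<Rightarrow> 'v"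
  alpha :: "nat \<Rightarrow> real"
  Lam :: "nat \<Rightarrow> real"

definition mesh_size :: "(real^'n::finite) mg_setting \<Rightarrow> nat \<Rightarrow> real" where
  "mesh_size s k = Max (diameter ` mesh s 1) / 2 ^ (k - 1)"

section \<open>Discrete spaces\<close>

definition exponents :: "ref_kind \<Rightarrow> nat \<Rightarrow> ('n::finite \<Rightarrow> nat) set" where
  "exponents c p = (case c of
      Simplex \<Rightarrow> {a. (\<Sum>i\<in>UNIV. a i) \<le> p}
    | Cube \<Rightarrow> {a. \<forall>i. a i \<le> p})"

definition poly_space :: "ref_kind \<Rightarrow> nat \<Rightarrow> (real^'n::finite \<Rightarrow> real) set" where
  "poly_space c p =
     {q. \<exists>b. q = (\<lambda>x. \<Sum>a\<in>exponents c p. b a * (\<Prod>i\<in>UNIV. (x $ i) ^ a i))}"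

text \<open>
  Elements of $V_k \subseteq L^2(\Omega)$ are represented by the functions
  vanishing outside the (open) elements, i.e. on the mesh skeleton, which is a null set.  Hence the
  natural injection $V_{k-1} \to V_k$ resets the values on the finer skeleton to zero.
\<close>

definition dg_space :: "(real^'n::finite) mg_setting \<Rightarrow> nat \<Rightarrow> (real^'n \<Rightarrow> real) set" where
  "dg_space s k =
     {v. (\<forall>T\<in>mesh s k. \<exists>q\<in>poly_space (kind s) (pdeg s k).
            \<forall>x\<in>ref_elem (kind s). v (elem_map s k T x) = q x) \<and>
         (\<forall>x. x \<notin> \<Union>(mesh s k) \<longrightarrow> v x = 0)}"

definition injection ::
  "(real^'n::finite) mg_setting \<Rightarrow> nat \<Rightarrow> (real^'n \<Rightarrow> real) \<Rightarrow> real^'n \<Rightarrow> real" where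
  "injection s k v = (\<lambda>x. if x \<in> \<Union>(mesh s k) then v x else 0)"

text \<open>$R_k^K = R_{K-1}^K \cdots R_k^{k+1}$; here \<open>injection s j\<close> is $R_{j-1}^j$.\<close>

definition prolong_to_top ::
  "(real^'n::finite) mg_setting \<Rightarrow> nat \<Rightarrow> (real^'n \<Rightarrow> real) \<Rightarrow> real^'n \<Rightarrow> real" where
  "prolong_to_top s k v = fold (injection s) [Suc k..<Suc (levels s)] v"

definition dg_space_vec :: "(real^'n::finite) mg_setting \<Rightarrow> nat \<Rightarrow> (real^'n \<Rightarrow> real^'n) set" where
  "dg_space_vec s k = {\<eta>. \<forall>i. (\<lambda>x. \<eta> x $ i) \<in> dg_space s k}"

definition elementwise_grad ::
  "(real^'n::finite) mg_setting \<Rightarrow> nat \<Rightarrow> (real^'n \<Rightarrow> real) \<Rightarrow> real^'n \<Rightarrow> real^'n" where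
  "elementwise_grad s k v x =
     (if x \<in> \<Union>(mesh s k) then (\<chi> i. partial_deriv i v x) else 0)"

section \<open>Discontinuous Galerkin forms\<close>

text \<open>
  Faces are detected as \<open>(d-1)\<close>-dimensional intersections, so hanging nodes are not excluded.
  Nonempty relative interior discards sets such as the two endpoints of an interior edge.
\<close>

definition interior_faces :: "(real^'n::finite) mg_setting \<Rightarrow> nat \<Rightarrow> (real^'n) set face set" where
  "interior_faces s k =
     {Interior T T' |T T'. (T, T') \<in> orientation s k \<and> T \<in> mesh s k \<and> T' \<in> mesh s k \<and> T \<noteq> T' \<and>
        aff_dim (closure T \<inter> closure T') = int CARD('n) - 1}"

definition boundary_faces :: "(real^'n::finite) mg_setting \<Rightarrow> nat \<Rightarrow> (real^'n) set face set" where
  "boundary_faces s k =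
     {Boundary T F |T F. T \<in> mesh s k \<and> (\<exists>G. G facet_of closure T \<and> F = G \<inter> frontier (dom s)) \<and>
        aff_dim F = int CARD('n) - 1 \<and> rel_interior F \<noteq> {}}"

definition faces :: "(real^'n::finite) mg_setting \<Rightarrow> nat \<Rightarrow> (real^'n) set face set" where
  "faces s k = interior_faces s k \<union> boundary_faces s k"

definition dg_theta :: "(real^'n::finite) mg_setting \<Rightarrow> real" where
  "dg_theta s = (case dgm s of SIPG \<Rightarrow> 0 | SIPG_delta \<delta> \<Rightarrow> 0 | LDG \<Rightarrow> 1)"

definition dg_beta :: "(real^'n::finite) mg_setting \<Rightarrow> nat \<Rightarrow> (real^'n) set face \<Rightarrow> real^'n" where
  "dg_beta s k f = (case dgm s of
      SIPG \<Rightarrow> 0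
    | SIPG_delta \<delta> \<Rightarrow> (\<delta> - 1/2) *\<^sub>R face_normal f
    | LDG \<Rightarrow> beta s k f)"

fun penalty :: "(real^'n::finite) mg_setting \<Rightarrow> nat \<Rightarrow> (real^'n) set face \<Rightarrow> real" where
  "penalty s k (Interior T T') = alpha s k * real (pdeg s k) ^ 2 / min (diameter T) (diameter T')"
| "penalty s k (Boundary T F) = alpha s k * real (pdeg s k) ^ 2 / diameter T"

definition lift_r ::
  "(real^'n::finite) mg_setting \<Rightarrow> nat \<Rightarrow> (real^'n) set face \<Rightarrow> (real^'n \<Rightarrow> real^'n) \<Rightarrow>
   real^'n \<Rightarrow> real^'n" where
  "lift_r s k f \<tau> = (THE r. r \<in> dg_space_vec s k \<and>
     (\<forall>\<eta>\<in>dg_space_vec s k.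
        (\<integral>x. r x \<bullet> \<eta> x \<partial>lebesgue_on (dom s)) = - face_integral f (\<lambda>y. \<tau> y \<bullet> average f \<eta> y)))"

definition lift_l ::
  "(real^'n::finite) mg_setting \<Rightarrow> nat \<Rightarrow> (real^'n) set face \<Rightarrow> (real^'n \<Rightarrow> real) \<Rightarrow>
   real^'n \<Rightarrow> real^'n" where
  "lift_l s k f v = (THE r. r \<in> dg_space_vec s k \<and>
     (\<forall>\<eta>\<in>dg_space_vec s k.
        (\<integral>x. r x \<bullet> \<eta> x \<partial>lebesgue_on (dom s)) = - face_integral f (\<lambda>y. v y * jump_vec f \<eta> y)))"

definition lift_G ::
  "(real^'n::finite) mg_setting \<Rightarrow> nat \<Rightarrow> (real^'n \<Rightarrow> real) \<Rightarrow> real^'n \<Rightarrow> real^'n" where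
  "lift_G s k v x =
     (\<Sum>f\<in>faces s k. lift_r s k f (jump f v) x) +
     (\<Sum>f\<in>interior_faces s k. lift_l s k f (\<lambda>y. dg_beta s k f \<bullet> jump f v y) x)"

definition dg_form ::
  "(real^'n::finite) mg_setting \<Rightarrow> nat \<Rightarrow> (real^'n \<Rightarrow> real) \<Rightarrow> (real^'n \<Rightarrow> real) \<Rightarrow> real" where
  "dg_form s k w v =
     (\<integral>x. elementwise_grad s k w x \<bullet> elementwise_grad s k v x
         + elementwise_grad s k w x \<bullet> lift_G s k v x
         + lift_G s k w x \<bullet> elementwise_grad s k v x
         + dg_theta s * (lift_G s k w x \<bullet> lift_G s k v x) \<partial>lebesgue_on (dom s))
     + (\<Sum>f\<in>faces s k. face_integral f (\<lambda>y. penalty s k f * (jump f w y \<bullet> jump f v y)))"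

text \<open>
  DG norm of \<open>v\<close>, with the elementwise gradient \<open>g\<close> of \<open>v\<close> as a separate
  argument, since \<open>v\<close> may be a Sobolev function having only a weak gradient.
\<close>

definition dg_nrm ::
  "(real^'n::finite) mg_setting \<Rightarrow> nat \<Rightarrow> (real^'n \<Rightarrow> real) \<Rightarrow> (real^'n \<Rightarrow> real^'n) \<Rightarrow> real" where
  "dg_nrm s k v g = sqrt (
     (\<Sum>T\<in>mesh s k. \<integral>x. (norm (g x))\<^sup>2 \<partial>lebesgue_on T) +
     (\<Sum>f\<in>faces s k. face_integral f (\<lambda>y. penalty s k f * (norm (jump f v y))\<^sup>2)))"

definition inherited_form ::
  "(real^'n::finite) mg_setting \<Rightarrow> nat \<Rightarrow> (real^'n \<Rightarrow> real) \<Rightarrow> (real^'n \<Rightarrow> real) \<Rightarrow> real" where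
  "inherited_form s k v w =
     dg_form s (levels s) (prolong_to_top s k v) (prolong_to_top s k w)"

section \<open>Discrete inner products, operators and norms\<close>

text \<open>Basis functions are indexed by an element and the number of a reference basis function.\<close>

definition basis_index :: "(real^'n::finite) mg_setting \<Rightarrow> nat \<Rightarrow> ((real^'n) set \<times> nat) set" where
  "basis_index s k = mesh s k \<times> {..<length (ref_basis s k)}"

definition basis_fun ::
  "(real^'n::finite) mg_setting \<Rightarrow> nat \<Rightarrow> (real^'n) set \<times> nat \<Rightarrow> real^'n \<Rightarrow> real" where
  "basis_fun s k = (\<lambda>(T, j) x. if x \<in> T then (ref_basis s k ! j) (inv (elem_map s k T) x) else 0)"

definition coeffs ::
  "(real^'n::finite) mg_setting \<Rightarrow> nat \<Rightarrow> (real^'n \<Rightarrow> real) \<Rightarrow> (real^'n) set \<times> nat \<Rightarrow> real" where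
  "coeffs s k v = (THE c. (\<forall>i. i \<notin> basis_index s k \<longrightarrow> c i = 0) \<and>
     v = (\<lambda>x. \<Sum>i\<in>basis_index s k. c i * basis_fun s k i x))"

definition level_inner ::
  "(real^'n::finite) mg_setting \<Rightarrow> nat \<Rightarrow> (real^'n \<Rightarrow> real) \<Rightarrow> (real^'n \<Rightarrow> real) \<Rightarrow> real" where
  "level_inner s k u v =
     mesh_size s k ^ CARD('n) * (\<Sum>i\<in>basis_index s k. coeffs s k u i * coeffs s k v i)"

definition level_op ::
  "(real^'n::finite) mg_setting \<Rightarrow> nat \<Rightarrow> (real^'n \<Rightarrow> real) \<Rightarrow> real^'n \<Rightarrow> real" where
  "level_op s k u = (THE z. z \<in> dg_space s k \<and>
     (\<forall>v\<in>dg_space s k. level_inner s k z v = inherited_form s k u v))"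

text \<open>$\|v\|_{1,k}$\<close>

definition energy_nrm :: "(real^'n::finite) mg_setting \<Rightarrow> nat \<Rightarrow> (real^'n \<Rightarrow> real) \<Rightarrow> real" where
  "energy_nrm s k v = sqrt (level_inner s k (level_op s k v) v)"

definition lambda_max :: "(real^'n::finite) mg_setting \<Rightarrow> nat \<Rightarrow> real" where
  "lambda_max s k =
     Sup {l. \<exists>v\<in>dg_space s k. v \<noteq> (\<lambda>x. 0) \<and> level_op s k v = (\<lambda>x. l * v x)}"

section \<open>Multigrid operators\<close>

text \<open>\<open>coarse_proj s k\<close> is $P_k^{k-1}$; it is unique since the inherited forms are definite.\<close>

definition coarse_proj ::
  "(real^'n::finite) mg_setting \<Rightarrow> nat \<Rightarrow> (real^'n \<Rightarrow> real) \<Rightarrow> real^'n \<Rightarrow> real" where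
  "coarse_proj s k v = (SOME z. z \<in> dg_space s (k - 1) \<and>
     (\<forall>w\<in>dg_space s (k - 1).
        inherited_form s (k - 1) z w = inherited_form s k v (injection s k w)))"

definition smoother ::
  "(real^'n::finite) mg_setting \<Rightarrow> nat \<Rightarrow> (real^'n \<Rightarrow> real) \<Rightarrow> real^'n \<Rightarrow> real" where
  "smoother s k v = (\<lambda>x. v x - inverse (Lam s k) * level_op s k v x)"

definition two_level ::
  "(real^'n::finite) mg_setting \<Rightarrow> nat \<Rightarrow> nat \<Rightarrow> nat \<Rightarrow> (real^'n \<Rightarrow> real) \<Rightarrow> real^'n \<Rightarrow> real" where
  "two_level s m1 m2 k v =
     (smoother s k ^^ m2)
       ((\<lambda>w x. w x - injection s k (coarse_proj s k w) x) ((smoother s k ^^ m1) v))"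

fun w_cycle ::
  "(real^'n::finite) mg_setting \<Rightarrow> nat \<Rightarrow> nat \<Rightarrow> nat \<Rightarrow> (real^'n \<Rightarrow> real) \<Rightarrow> real^'n \<Rightarrow> real" where
  "w_cycle s m1 m2 0 v = (\<lambda>x. 0)"
| "w_cycle s m1 m2 (Suc 0) v = (\<lambda>x. 0)"
| "w_cycle s m1 m2 (Suc (Suc k)) v =
     (let K2 = Suc (Suc k) in
      (smoother s K2 ^^ m2)
        ((\<lambda>w. let z = coarse_proj s K2 w;
                  e = w_cycle s m1 m2 (Suc k) (w_cycle s m1 m2 (Suc k) z)
              in (\<lambda>x. w x - injection s K2 (\<lambda>y. z y - e y) x))
           ((smoother s K2 ^^ m1) v)))"

definition Sigma_R :: "(real^'n::finite) mg_setting \<Rightarrow> nat \<Rightarrow> nat \<Rightarrow> nat \<Rightarrow> nat \<Rightarrow> real" where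
  "Sigma_R s \<mu> m1 m2 k =
     2 ^ (levels s - k) * (real (pdeg s (levels s)) ^ 2 * real (pdeg s k) ^ \<mu>
       / (sqrt (1 + real m1) * sqrt (1 + real m2)))"

text \<open>$(p_1, \dots, p_K)$\<close>

definition degree_list :: "(real^'n::finite) mg_setting \<Rightarrow> nat list" where
  "degree_list s = map (pdeg s) [1..<Suc (levels s)]"

section \<open>Standing assumptions\<close>

definition mesh_hierarchy ::
  "(real^'n::finite) set \<Rightarrow> real \<Rightarrow> real \<Rightarrow> (real^'n) mg_setting \<Rightarrow> bool" where
  "mesh_hierarchy \<Omega> csr cqu s \<longleftrightarrow>
     dom s = \<Omega> \<and> 1 \<le> levels s \<and>
     (\<forall>k\<in>{1..levels s}.
        partition_of_domain \<Omega> (mesh s k) \<and>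
        (\<forall>T\<in>mesh s k. affine_iso (elem_map s k T) \<and> T = elem_map s k T ` ref_elem (kind s)) \<and>
        (\<forall>T\<in>mesh s k. \<forall>T'\<in>mesh s k. T \<noteq> T' \<longrightarrow>
           ((T, T') \<in> orientation s k \<longleftrightarrow> (T', T) \<notin> orientation s k))) \<and>
     (\<forall>k\<in>{2..levels s}. uniform_refinement (kind s) (mesh s (k - 1)) (mesh s k)) \<and>
     (\<forall>T\<in>mesh s 1. \<exists>x r. 0 < r \<and> ball x r \<subseteq> T \<and> diameter T \<le> csr * r) \<and>
     (\<forall>T\<in>mesh s 1. mesh_size s 1 \<le> cqu * diameter T)"

definition admissible_degrees :: "real \<Rightarrow> (real^'n::finite) mg_setting \<Rightarrow> bool" where
  "admissible_degrees Cp s \<longleftrightarrow>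
     (\<forall>k\<in>{1..levels s}. 1 \<le> pdeg s k) \<and>
     (\<forall>k\<in>{2..levels s}. pdeg s (k - 1) \<le> pdeg s k \<and> real (pdeg s k) \<le> Cp * real (pdeg s (k - 1)))"

definition orthonormal_ref_basis :: "(real^'n::finite) mg_setting \<Rightarrow> bool" where
  "orthonormal_ref_basis s \<longleftrightarrow>
     (\<forall>k\<in>{1..levels s}.
        (let B = ref_basis s k in
         poly_space (kind s) (pdeg s k)
           = {q. \<exists>c. q = (\<lambda>x. \<Sum>j<length B. c j * (B ! j) x)} \<and>
         (\<forall>i<length B. \<forall>j<length B.
            (\<integral>x. (B ! i) x * (B ! j) x \<partial>lebesgue_on (ref_elem (kind s))) = (if i = j then 1 else 0))))"

definition dg_parameters ::
  "real \<Rightarrow> real \<Rightarrow> real \<Rightarrow> real \<Rightarrow> (real^'n::finite) mg_setting \<Rightarrow> bool" where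
  "dg_parameters \<alpha>lo \<alpha>hi \<beta>max ccoer s \<longleftrightarrow>
     (\<forall>k\<in>{1..levels s}. \<alpha>lo \<le> alpha s k \<and> alpha s k \<le> \<alpha>hi) \<and>
     (case dgm s of
        SIPG \<Rightarrow> True
      | SIPG_delta \<delta> \<Rightarrow> 0 \<le> \<delta> \<and> \<delta> \<le> 1
      | LDG \<Rightarrow> (\<forall>k\<in>{1..levels s}. \<forall>f\<in>interior_faces s k. norm (beta s k f) \<le> \<beta>max)) \<and>
     (dgm s \<noteq> LDG \<longrightarrow>
        (\<forall>k\<in>{1..levels s}. \<forall>v\<in>dg_space s k.
           ccoer * (dg_nrm s k v (elementwise_grad s k v))\<^sup>2 \<le> dg_form s k v v))"

text \<open>
  The Sobolev function \<open>u\<close>, of broken regularity $H^{s+1}$ with $s \ge 1$ and hence in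
  $H^2(\Omega)$ by elliptic regularity, is taken as its continuous representative ($d \le 3$), so that
  its traces on faces are given by limits.  The constant may depend on the regularity index.
\<close>

definition dg_error_estimates ::
  "nat \<Rightarrow> (real \<Rightarrow> real) \<Rightarrow> (real^'n::finite) mg_setting \<Rightarrow> bool" where
  "dg_error_estimates \<mu> Cerr s \<longleftrightarrow>
     (\<forall>k\<in>{1..levels s}. \<forall>t\<ge>1. \<forall>f u uk.
        L2_fun (dom s) f \<and> weak_solution (dom s) f u \<and> continuous_on (closure (dom s)) u \<and>
        broken_sobolev (mesh s k) (t + 1) u \<and>
        uk \<in> dg_space s k \<and>
        (\<forall>v\<in>dg_space s k. dg_form s k uk v = (\<integral>x. f x * v x \<partial>lebesgue_on (dom s)))
        \<longrightarrow>
        dg_nrm s k (\<lambda>x. u x - uk x) (\<lambda>x. weak_grad (dom s) u x - elementwise_grad s k uk x)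
          \<le> Cerr t * (mesh_size s k powr min (real (pdeg s k)) t
                        / real (pdeg s k) powr (t - real \<mu> / 2))
              * broken_sobolev_nrm (mesh s k) (t + 1) u \<and>
        L2_nrm (dom s) (\<lambda>x. u x - uk x)
          \<le> Cerr t * (mesh_size s k powr (min (real (pdeg s k)) t + 1)
                        / real (pdeg s k) powr (t + 1 - real \<mu>))
              * broken_sobolev_nrm (mesh s k) (t + 1) u)"

definition smoothing_parameters :: "real \<Rightarrow> (real^'n::finite) mg_setting \<Rightarrow> bool" where
  "smoothing_parameters C\<Lambda> s \<longleftrightarrow>
     (\<forall>k\<in>{2..levels s}.
        lambda_max s k \<le> Lam s k \<and>
        Lam s k \<le> C\<Lambda> * (real (pdeg s (levels s)) ^ 2 * real (pdeg s k) ^ 2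
                       / (mesh_size s (levels s) * mesh_size s k)))"

end

theory Submission
  imports Defs
begin

text \<open>
  The convergence argument is a perturbation of the two-level estimate.  The smoother
  \<open>G\<close> is linear, so replacing the exact coarse solve by two recursive calls adds exactly one term,
  $\mathbb E_k = \mathbb E^{2lvl}_k + G^{m_2} R\,\mathbb E_{k-1}^2 P\, G^{m_1}$.  In the energy
  norms none of the outer factors increases the norm: \<open>G\<close> is a Richardson step with a
  parameter above the spectrum, the injection \<open>R\<close> is an isometry because the forms are inherited from
  the finest level, and \<open>P\<close>, being its adjoint, is a contraction by the Cauchy-Schwarz inequality.
  Hence $\|\mathbb E_k\| \le C_2\Sigma_k + (C\Sigma_{k-1})^2$ by induction on the level, and the
  second term is at most $(C-C_2)\Sigma_k$ because $\Sigma_{k-1}^2$ carries the additional factor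
  $((1+m_1)(1+m_2))^{-1/2} \le (1+m_1+m_2)^{-1/2}$
  (\<open>w_cycle_energy_recursion\<close>, \<open>Sigma_R_square_le\<close>, \<open>w_cycle_estimate\<close>).
  A lower bound on \<open>m1 + m2\<close> has to survive the descent to coarser levels, whereas the stated lower
  bound for \<open>m_k\<close> grows like $2^{K-k}$ there; so $2^K$ is put in place of $2^{K-k+2}$.
  
  The forms enter only through four facts: they are bilinear, symmetric and positive semidefinite
  on the discrete spaces, and the injection maps each space into the next.  The finite-dimensional
  linear algebra is carried out for semidefinite forms: Riesz representation for functionals
  vanishing on null vectors (\<open>Riesz\<close>), and the attainment of the largest Rayleigh quotient at an
  eigenvector (\<open>Rayleigh_le_largest_eigenvalue\<close>).  All solutions of a coarse problem differ by null
  vectors, so the estimates hold for whichever of them is chosen as the value of \<open>P\<close>.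
  
  Bilinearity of the discontinuous Galerkin forms (\<open>dg_form_linear_left\<close>) is a matter of
  integrability.  On each element a discrete function extends to a continuously differentiable
  function on the whole space, so volume integrands are piecewise continuous, traces are continuous on
  faces, and the liftings are Riesz representatives of linear functionals.  That a coarse
  function is a fine one (\<open>injection_mem\<close>) rests on a fact about reference maps: for simplices,
  affine maps preserve the total degree; for cubes, the map from a child to its parent consists of a
  dilation and of automorphisms of the cube, which only permute and reflect the coordinates.
\<close>

section \<open>Semidefinite forms on finite-dimensional function spaces\<close>

text \<open>
  Subspaces are taken with explicit pointwise operations, the form in which sums and multiples of
  functions occur in the discrete operators.
\<close>

locale function_space =
  fixes V :: "('a \<Rightarrow> 'b::real_vector) set"
  assumes zero: "(\<lambda>x. 0) \<in> V"
    and add: "u \<in> V \<Longrightarrow> v \<in> V \<Longrightarrow> (\<lambda>x. u x + v x) \<in> V"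
    and scale: "v \<in> V \<Longrightarrow> (\<lambda>x. c *\<^sub>R v x) \<in> V"
begin

lemma minus: "v \<in> V \<Longrightarrow> (\<lambda>x. - v x) \<in> V"
  using scale[of v "-1"] by simp

lemma diff: "u \<in> V \<Longrightarrow> v \<in> V \<Longrightarrow> (\<lambda>x. u x - v x) \<in> V"
  using add[OF _ minus, of u v] by simp

lemma sum: "(\<And>i. i \<in> I \<Longrightarrow> e i \<in> V) \<Longrightarrow> (\<lambda>x. \<Sum>i\<in>I. e i x) \<in> V"
  by (induction I rule: infinite_finite_induct) (auto intro: zero add)

end

definition linear_functional :: "('a \<Rightarrow> 'b::real_vector) set \<Rightarrow> (('a \<Rightarrow> 'b) \<Rightarrow> real) \<Rightarrow> bool" where
  "linear_functional V f \<longleftrightarrow>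
     (\<forall>u\<in>V. \<forall>v\<in>V. f (\<lambda>x. u x + v x) = f u + f v) \<and>
     (\<forall>c. \<forall>v\<in>V. f (\<lambda>x. c *\<^sub>R v x) = c * f v)"

definition combinations :: "'i set \<Rightarrow> ('i \<Rightarrow> 'a \<Rightarrow> 'b::real_vector) \<Rightarrow> ('a \<Rightarrow> 'b) set" where
  "combinations I e = {v. \<exists>c. v = (\<lambda>x. \<Sum>i\<in>I. c i *\<^sub>R e i x)}"

lemma function_space_combinations: "function_space (combinations I e)"
proof
  show "(\<lambda>x. 0) \<in> combinations I e"
    unfolding combinations_def by (auto intro!: exI[of _ "\<lambda>_. 0"])
next
  fix u v assume "u \<in> combinations I e" "v \<in> combinations I e"
  then obtain c d where "u = (\<lambda>x. \<Sum>i\<in>I. c i *\<^sub>R e i x)" "v = (\<lambda>x. \<Sum>i\<in>I. d i *\<^sub>R e i x)"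
    unfolding combinations_def by auto
  then show "(\<lambda>x. u x + v x) \<in> combinations I e"
    unfolding combinations_def
    by (auto intro!: exI[of _ "\<lambda>i. c i + d i"] simp: scaleR_left_distrib sum.distrib)
next
  fix v and a :: real assume "v \<in> combinations I e"
  then obtain c where "v = (\<lambda>x. \<Sum>i\<in>I. c i *\<^sub>R e i x)" 
    unfolding combinations_def by auto
  then show "(\<lambda>x. a *\<^sub>R v x) \<in> combinations I e"
    unfolding combinations_def
    by (auto intro!: exI[of _ "\<lambda>i. a * c i"] simp: scaleR_sum_right)
qed

lemma generator_in_combinations:
  assumes "finite I" "i \<in> I" shows "e i \<in> combinations I e"
proof -
  have "e i = (\<lambda>x. \<Sum>j\<in>I. (if j = i then 1 else 0) *\<^sub>R e j x)"
    using assms by (simp add: if_distrib[of "\<lambda>a. a *\<^sub>R _"] cong: if_cong)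
  then show ?thesis
    unfolding combinations_def mem_Collect_eq by (rule exI[of _ "\<lambda>j. if j = i then 1 else 0"])
qed

locale psd_form = function_space V for V :: "('a \<Rightarrow> 'b::real_vector) set" +
  fixes b :: "('a \<Rightarrow> 'b) \<Rightarrow> ('a \<Rightarrow> 'b) \<Rightarrow> real"
  assumes sym: "u \<in> V \<Longrightarrow> v \<in> V \<Longrightarrow> b u v = b v u"
    and add_left: "u \<in> V \<Longrightarrow> v \<in> V \<Longrightarrow> w \<in> V \<Longrightarrow> b (\<lambda>x. u x + v x) w = b u w + b v w"
    and scale_left: "u \<in> V \<Longrightarrow> w \<in> V \<Longrightarrow> b (\<lambda>x. c *\<^sub>R u x) w = c * b u w"
    and nonneg: "v \<in> V \<Longrightarrow> 0 \<le> b v v"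
begin

lemma add_right: "u \<in> V \<Longrightarrow> v \<in> V \<Longrightarrow> w \<in> V \<Longrightarrow> b w (\<lambda>x. u x + v x) = b w u + b w v"
  by (simp add: sym[of w] add_left add)

lemma scale_right: "u \<in> V \<Longrightarrow> w \<in> V \<Longrightarrow> b w (\<lambda>x. c *\<^sub>R u x) = c * b w u"
  by (simp add: sym[of w] scale_left scale)

lemma diff_left: "u \<in> V \<Longrightarrow> v \<in> V \<Longrightarrow> w \<in> V \<Longrightarrow> b (\<lambda>x. u x - v x) w = b u w - b v w"
  using add_left[OF _ minus, of u v w] scale_left[of v w "-1"] by simp

lemma linear_functional_right: "w \<in> V \<Longrightarrow> linear_functional V (b w)"
  by (simp add: linear_functional_def add_right scale_right)

lemma expand: 
  assumes "u \<in> V" "v \<in> V"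
  shows "b (\<lambda>x. u x + t *\<^sub>R v x) (\<lambda>x. u x + t *\<^sub>R v x) = b u u + 2 * t * b u v + t\<^sup>2 * b v v"
proof -
  have tv: "(\<lambda>x. t *\<^sub>R v x) \<in> V" using assms scale by blast
  show ?thesis
    using assms tv sym[OF assms(2,1)]
    by (simp add: add_left add_right add scale_left scale_right power2_eq_square)
qed

lemma Cauchy_Schwarz:
  assumes "u \<in> V" "v \<in> V" shows "(b u v)\<^sup>2 \<le> b u u * b v v"
proof -
  have quad: "0 \<le> b u u + 2 * t * b u v + t\<^sup>2 * b v v" for t
    using nonneg[OF add[OF assms(1) scale[OF assms(2), of t]]] expand[OF assms, of t] by simp
  show ?thesis
  proof (cases "b v v = 0")
    case True
    have "b u v = 0"
    proof (rule ccontr)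
      assume "b u v \<noteq> 0"
      then show False
        using quad[of "- (b u u + 1) / (2 * b u v)"] True by (simp add: field_simps)
    qed
    then show ?thesis using True by simp
  next
    case False
    then have pos: "0 < b v v" using nonneg[OF assms(2)] by simp
    have "0 \<le> b u u - (b u v)\<^sup>2 / b v v"
      using quad[of "- b u v / b v v"] pos by (simp add: power2_eq_square field_simps)
    then show ?thesis using pos by (simp add: field_simps)
  qed
qed

lemma null_imp_zero: "u \<in> V \<Longrightarrow> v \<in> V \<Longrightarrow> b v v = 0 \<Longrightarrow> b u v = 0"
  using Cauchy_Schwarz[of u v] by simp

lemma triangle:
  assumes "u \<in> V" "v \<in> V"
  shows "sqrt (b (\<lambda>x. u x + v x) (\<lambda>x. u x + v x)) \<le> sqrt (b u u) + sqrt (b v v)"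
proof (rule real_le_lsqrt)
  have "b u v \<le> sqrt (b u u) * sqrt (b v v)"
    using real_le_rsqrt[OF Cauchy_Schwarz[OF assms]] by (simp add: real_sqrt_mult)
  then show "b (\<lambda>x. u x + v x) (\<lambda>x. u x + v x) \<le> (sqrt (b u u) + sqrt (b v v))\<^sup>2"
    using expand[OF assms, of 1] nonneg assms by (simp add: power2_sum)
qed (use nonneg assms in auto)

lemma zero_left: "v \<in> V \<Longrightarrow> b (\<lambda>x. 0) v = 0"
  using scale_left[OF zero, of v 0] by simp

end

lemma combinations_subset:
  assumes "function_space V" and "\<And>i. i \<in> I \<Longrightarrow> e i \<in> V"
  shows "combinations I e \<subseteq> V"
proof
  interpret function_space V by fact
  fix v assume "v \<in> combinations I e"
  then obtain c where "v = (\<lambda>x. \<Sum>i\<in>I. c i *\<^sub>R e i x)" unfolding combinations_def by blast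
  then show "v \<in> V" using assms(2) by (auto intro!: sum scale)
qed

lemma combinations_insert:
  assumes "finite I" and "j \<notin> I"
  shows "v \<in> combinations (insert j I) e \<longleftrightarrow>
           (\<exists>w\<in>combinations I e. \<exists>c. v = (\<lambda>x. w x + c *\<^sub>R e j x))"
proof
  assume "v \<in> combinations (insert j I) e"
  then obtain c where c: "v = (\<lambda>x. \<Sum>i\<in>insert j I. c i *\<^sub>R e i x)"
    unfolding combinations_def by blast
  have "v = (\<lambda>x. (\<Sum>i\<in>I. c i *\<^sub>R e i x) + c j *\<^sub>R e j x)"
    using c assms by (simp add: add.commute)
  moreover have "(\<lambda>x. \<Sum>i\<in>I. c i *\<^sub>R e i x) \<in> combinations I e"
    unfolding combinations_def by blast
  ultimately show "\<exists>w\<in>combinations I e. \<exists>c. v = (\<lambda>x. w x + c *\<^sub>R e j x)"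
    by (intro bexI exI)
next
  assume "\<exists>w\<in>combinations I e. \<exists>c. v = (\<lambda>x. w x + c *\<^sub>R e j x)"
  then obtain d c where v: "v = (\<lambda>x. (\<Sum>i\<in>I. d i *\<^sub>R e i x) + c *\<^sub>R e j x)"
    unfolding combinations_def by blast
  have "v = (\<lambda>x. \<Sum>i\<in>insert j I. (d(j := c)) i *\<^sub>R e i x)"
  proof
    fix x
    have "(\<Sum>i\<in>I. (d(j := c)) i *\<^sub>R e i x) = (\<Sum>i\<in>I. d i *\<^sub>R e i x)"
      using assms by (intro sum.cong) auto
    then show "v x = (\<Sum>i\<in>insert j I. (d(j := c)) i *\<^sub>R e i x)"
      using assms v by (simp add: add.commute)
  qed
  then show "v \<in> combinations (insert j I) e"
    unfolding combinations_def mem_Collect_eq by (rule exI[of _ "d(j := c)"])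
qed

context psd_form
begin

text \<open>
  One step of the Gram-Schmidt process for a semidefinite form, given the orthogonal projection
  \<open>z\<close> of the new generator.  The new direction \<open>u\<close> may be a null vector.
\<close>

lemma orthogonal_step:
  assumes I: "finite I" "j \<notin> I" and e: "\<And>i. i \<in> insert j I \<Longrightarrow> e i \<in> V"
    and z: "z \<in> combinations I e" "\<And>w. w \<in> combinations I e \<Longrightarrow> b z w = b (e j) w"
  obtains u where "u \<in> V" and "\<And>w. w \<in> combinations I e \<Longrightarrow> b u w = 0"
    and "\<And>v. v \<in> combinations (insert j I) e \<longleftrightarrow>
           (\<exists>w\<in>combinations I e. \<exists>c. v = (\<lambda>x. w x + c *\<^sub>R u x))"
proof
  let ?W = "combinations I e" and ?u = "\<lambda>x. e j x - z x"
  interpret W: function_space ?W by (rule function_space_combinations)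
  have sub: "?W \<subseteq> V" by (rule combinations_subset[OF function_space_axioms]) (simp add: e)
  have ej: "e j \<in> V" using e by simp
  show "?u \<in> V" using diff[OF ej] z(1) sub by blast
  show "b ?u w = 0" if "w \<in> ?W" for w
    using diff_left[OF ej, of z w] z that sub by auto
  show "v \<in> combinations (insert j I) e \<longleftrightarrow> (\<exists>w\<in>?W. \<exists>c. v = (\<lambda>x. w x + c *\<^sub>R ?u x))" for v
    unfolding combinations_insert[OF I]
  proof safe
    fix w c assume w: "w \<in> ?W" and v: "v = (\<lambda>x. w x + c *\<^sub>R e j x)"
    have "(\<lambda>x. w x + c *\<^sub>R e j x) = (\<lambda>x. (w x + c *\<^sub>R z x) + c *\<^sub>R (e j x - z x))"
      by (simp add: scaleR_right_diff_distrib)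
    then show "\<exists>w'\<in>?W. \<exists>c'. (\<lambda>x. w x + c *\<^sub>R e j x) = (\<lambda>x. w' x + c' *\<^sub>R (e j x - z x))"
      by (intro bexI[OF _ W.add[OF w W.scale[OF z(1), of c]]] exI)
  next
    fix w c assume w: "w \<in> ?W" and v: "v = (\<lambda>x. w x + c *\<^sub>R (e j x - z x))"
    have "(\<lambda>x. w x + c *\<^sub>R (e j x - z x)) = (\<lambda>x. (w x - c *\<^sub>R z x) + c *\<^sub>R e j x)"
      by (simp add: algebra_simps)
    then show "\<exists>w'\<in>?W. \<exists>c'. (\<lambda>x. w x + c *\<^sub>R (e j x - z x)) = (\<lambda>x. w' x + c' *\<^sub>R e j x)"
      by (intro bexI[OF _ W.diff[OF w W.scale[OF z(1), of c]]] exI)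
  qed
qed

text \<open>
  The projection required by the Gram-Schmidt step represents the functional \<open>b (e j)\<close>, so that
  the induction hypothesis, applied to another functional, supplies it.  Functionals that
  vanish on null vectors are the only ones that a semidefinite form can represent.
\<close>

lemma Riesz:
  assumes "finite I" and "\<And>i. i \<in> I \<Longrightarrow> e i \<in> V"
    and "linear_functional V f" and "\<And>v. v \<in> V \<Longrightarrow> b v v = 0 \<Longrightarrow> f v = 0"
  shows "\<exists>z\<in>combinations I e. \<forall>v\<in>combinations I e. b z v = f v"
  using assms
proof (induction I arbitrary: f rule: finite_induct)
  case empty
  have "f (\<lambda>x. 0) = 0" using empty.prems(3) zero zero_left by simp
  then show ?case by (simp add: combinations_def zero_left[OF zero])
next
  case (insert j I)
  let ?W = "combinations I e"
  have sub: "?W \<subseteq> V" by (rule combinations_subset[OF function_space_axioms]) (simp add: insert.prems(1))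
  have ej: "e j \<in> V" and eI: "\<And>i. i \<in> I \<Longrightarrow> e i \<in> V" using insert.prems(1) by auto
  have "\<exists>z\<in>?W. \<forall>v\<in>?W. b z v = b (e j) v"
    by (rule insert.IH[OF eI linear_functional_right[OF ej] null_imp_zero[OF ej]])
  then obtain z0 where z0: "z0 \<in> ?W" "\<And>v. v \<in> ?W \<Longrightarrow> b z0 v = b (e j) v" by blast
  obtain u where u: "u \<in> V" "\<And>w. w \<in> ?W \<Longrightarrow> b u w = 0"
      "\<And>v. v \<in> combinations (insert j I) e \<longleftrightarrow> (\<exists>w\<in>?W. \<exists>c. v = (\<lambda>x. w x + c *\<^sub>R u x))"
    using orthogonal_step[OF insert.hyps insert.prems(1) z0] by blast
  have "\<exists>z\<in>?W. \<forall>v\<in>?W. b z v = f v"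
    by (rule insert.IH[OF eI insert.prems(2,3)])
  then obtain z1 where z1: "z1 \<in> ?W" "\<And>v. v \<in> ?W \<Longrightarrow> b z1 v = f v" by blast
  \<comment> \<open>If \<open>b u u = 0\<close>, then also \<open>f u = 0\<close>, and the value 0 of the quotient is a valid coefficient.\<close>
  define a where "a = f u / b u u"
  have au: "a * b u u = f u" using insert.prems(3)[OF u(1)] by (cases "b u u = 0") (auto simp: a_def)
  define z where "z = (\<lambda>x. z1 x + a *\<^sub>R u x)"
  have "z \<in> combinations (insert j I) e"
    unfolding u(3) z_def using z1(1) by blast
  moreover have "b z v = f v" if "v \<in> combinations (insert j I) e" for v
  proof -
    obtain w c where w: "w \<in> ?W" and v: "v = (\<lambda>x. w x + c *\<^sub>R u x)" using \<open>v \<in> _\<close> u(3) by blast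
    have V: "w \<in> V" "z1 \<in> V" "(\<lambda>x. c *\<^sub>R u x) \<in> V" "(\<lambda>x. a *\<^sub>R u x) \<in> V"
      using w z1 sub scale[OF u(1)] by auto
    have "b z v = b z1 w + c * b z1 u + a * b u w + a * c * b u u"
      unfolding z_def v using V u(1)
      by (simp add: add_left add_right add scale_left scale_right algebra_simps)
    also have "\<dots> = f w + c * f u"
      using au u(2)[OF w] u(2)[OF z1(1)] sym[OF u(1) V(2)] z1(2)[OF w] by (simp add: algebra_simps)
    also have "\<dots> = f v"
      using insert.prems(2) V u(1) unfolding v linear_functional_def by simp
    finally show ?thesis .
  qed
  ultimately show ?case by blast
qed

lemma sum_bound:
  assumes "u \<in> V" "v \<in> V"
  shows "b (\<lambda>x. u x + c *\<^sub>R v x) (\<lambda>x. u x + c *\<^sub>R v x) \<le> 2 * b u u + 2 * (c\<^sup>2 * b v v)"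
proof -
  have "0 \<le> b u u - 2 * c * b u v + c\<^sup>2 * b v v"
    using expand[OF assms, of "-c"] nonneg[OF add[OF assms(1) scale[OF assms(2), of "-c"]]] by simp
  then show ?thesis using expand[OF assms, of c] by linarith
qed

end

text \<open>
  Along a Gram-Schmidt basis of the definite form, each new direction \<open>u\<close> contributes the ratio
  \<open>a u u / b u u\<close> to the constant, and the mixed terms of \<open>a\<close> cost a factor 2.
\<close>

lemma psd_form_le_definite_form:
  assumes "psd_form V a" and "psd_form V b"
    and "\<And>v. v \<in> V \<Longrightarrow> b v v = 0 \<Longrightarrow> v = (\<lambda>x. 0)"
    and "finite I" and "\<And>i. i \<in> I \<Longrightarrow> e i \<in> V"
  shows "\<exists>C>0. \<forall>v\<in>combinations I e. a v v \<le> C * b v v"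
  using assms(4,5)
proof (induction I rule: finite_induct)
  interpret a: psd_form V a by fact
  interpret b: psd_form V b by fact
  {
    case empty
    show ?case
      by (auto simp: combinations_def a.zero_left[OF a.zero] b.zero_left[OF a.zero] intro: exI[of _ 1])
  next
    case (insert j I)
    let ?W = "combinations I e"
    have sub: "?W \<subseteq> V"
      by (rule combinations_subset[OF a.function_space_axioms]) (simp add: insert.prems)
    have ej: "e j \<in> V" and eI: "\<And>i. i \<in> I \<Longrightarrow> e i \<in> V" using insert.prems by auto
    obtain C where C: "C > 0" "\<And>v. v \<in> ?W \<Longrightarrow> a v v \<le> C * b v v" using insert by auto
    have "\<exists>z\<in>?W. \<forall>v\<in>?W. b z v = b (e j) v"
      by (rule b.Riesz[OF insert.hyps(1) eI b.linear_functional_right[OF ej] b.null_imp_zero[OF ej]])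
    then obtain z where z: "z \<in> ?W" "\<And>v. v \<in> ?W \<Longrightarrow> b z v = b (e j) v" by blast
    obtain u where u: "u \<in> V" "\<And>w. w \<in> ?W \<Longrightarrow> b u w = 0"
      "\<And>v. v \<in> combinations (insert j I) e \<longleftrightarrow> (\<exists>w\<in>?W. \<exists>c. v = (\<lambda>x. w x + c *\<^sub>R u x))"
      using b.orthogonal_step[OF insert.hyps insert.prems z] by blast
    define D where "D = max C (a u u / b u u)"
    have D: "a u u \<le> D * b u u"
    proof (cases "b u u = 0")
      case True
      then show ?thesis using assms(3)[OF u(1)] a.zero_left[OF a.zero] by simp
    next
      case False
      then have "0 < b u u" using b.nonneg[OF u(1)] by simp
      then have "a u u = a u u / b u u * b u u" by simp
      also have "\<dots> \<le> D * b u u"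
        using \<open>0 < b u u\<close> unfolding D_def by (intro mult_right_mono) auto
      finally show ?thesis .
    qed
    have "a v v \<le> (2 * D) * b v v" if "v \<in> combinations (insert j I) e" for v
    proof -
      obtain w c where w: "w \<in> ?W" and v: "v = (\<lambda>x. w x + c *\<^sub>R u x)" using \<open>v \<in> _\<close> u(3) by blast
      have wV: "w \<in> V" using w sub by blast
      have "b u w = 0" using u(2)[OF w] .
      then have bv: "b v v = b w w + c\<^sup>2 * b u u"
        unfolding v b.expand[OF wV u(1)] using b.sym[OF u(1) wV] by simp
      have "a v v \<le> 2 * a w w + 2 * (c\<^sup>2 * a u u)" unfolding v by (rule a.sum_bound[OF wV u(1)])
      also have "\<dots> \<le> 2 * (D * b w w) + 2 * (c\<^sup>2 * (D * b u u))"
      proof -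
        have "a w w \<le> D * b w w"
          using C(2)[OF w] mult_right_mono[OF _ b.nonneg[OF wV], of C D] by (simp add: D_def)
        then show ?thesis using D by (intro add_mono mult_left_mono) auto
      qed
      finally show ?thesis using bv by (simp add: algebra_simps)
    qed
    moreover have "2 * D > 0" using C(1) by (simp add: D_def)
    ultimately show ?case by blast
  }
qed

locale operator_of_form = a: psd_form V a + ip: psd_form V ip
  for V :: "('a \<Rightarrow> real) set" and a ip +
  fixes A :: "('a \<Rightarrow> real) \<Rightarrow> 'a \<Rightarrow> real" and I :: "'i set" and e :: "'i \<Rightarrow> 'a \<Rightarrow> real"
  assumes definite: "v \<in> V \<Longrightarrow> ip v v = 0 \<Longrightarrow> v = (\<lambda>x. 0)"
    and A_mem: "v \<in> V \<Longrightarrow> A v \<in> V"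
    and A_form: "v \<in> V \<Longrightarrow> w \<in> V \<Longrightarrow> ip (A v) w = a v w"
    and finite_I: "finite I"
    and V_eq: "V = combinations I e"
begin

lemma e_mem: "i \<in> I \<Longrightarrow> e i \<in> V"
  unfolding V_eq by (rule generator_in_combinations[OF finite_I])

lemma ip_pos: "v \<in> V \<Longrightarrow> v \<noteq> (\<lambda>x. 0) \<Longrightarrow> 0 < ip v v"
  using ip.nonneg[of v] definite[of v] by (auto simp: order_le_less)

lemma ext:
  assumes "u \<in> V" "v \<in> V" "\<And>w. w \<in> V \<Longrightarrow> ip u w = ip v w"
  shows "u = v"
proof -
  have d: "(\<lambda>x. u x - v x) \<in> V" using assms a.diff by blast
  have "(\<lambda>x. u x - v x) = (\<lambda>x. 0)"
    by (rule definite[OF d]) (use ip.diff_left[OF assms(1,2) d] assms(3)[OF d] in simp)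
  then show ?thesis by (simp add: fun_eq_iff)
qed

lemma A_add: "u \<in> V \<Longrightarrow> v \<in> V \<Longrightarrow> A (\<lambda>x. u x + v x) = (\<lambda>x. A u x + A v x)"
  by (rule ext) (simp_all add: A_mem A_form a.add a.add_left ip.add_left)

text \<open>
  The supremum \<open>q\<close> of the Rayleigh quotient is an eigenvalue: the form \<open>q ip - a\<close> is positive
  semidefinite, and if it were definite it would dominate a positive multiple of \<open>ip\<close>, so that
  \<open>q\<close> could be lowered.  A null vector of \<open>q ip - a\<close> is an eigenvector by the Cauchy-Schwarz inequality.
\<close>

lemma Rayleigh_le_largest_eigenvalue:
  assumes w: "w \<in> V"
  shows "a w w \<le> Sup {l. \<exists>v\<in>V. v \<noteq> (\<lambda>x. 0) \<and> A v = (\<lambda>x. l * v x)} * ip w w"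
proof (cases "w = (\<lambda>x. 0)")
  case True
  then show ?thesis using a.zero_left[OF a.zero] ip.zero_left[OF a.zero] by simp
next
  case False
  define E where "E = {l. \<exists>v\<in>V. v \<noteq> (\<lambda>x. 0) \<and> A v = (\<lambda>x. l * v x)}"
  define Q where "Q = {a v v / ip v v |v. v \<in> V \<and> v \<noteq> (\<lambda>x. 0)}"
  define q where "q = Sup Q"
  have "\<exists>C>0. \<forall>v\<in>combinations I e. a v v \<le> C * ip v v"
    by (rule psd_form_le_definite_form[OF a.psd_form_axioms ip.psd_form_axioms])
      (simp_all add: definite finite_I e_mem)
  then obtain C where C: "C > 0" "\<And>v. v \<in> V \<Longrightarrow> a v v \<le> C * ip v v"
    unfolding V_eq[symmetric] by blast
  have bdd: "bdd_above Q"
    by (rule bdd_aboveI[of _ C]) (auto simp: Q_def C(2) ip_pos divide_le_eq)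
  have Q_le: "a v v \<le> q * ip v v" if "v \<in> V" for v
  proof (cases "v = (\<lambda>x. 0)")
    case True
    then show ?thesis using a.zero_left[OF a.zero] ip.zero_left[OF a.zero] by simp
  next
    case False
    then have "a v v / ip v v \<le> q" unfolding q_def using that by (intro cSup_upper bdd) (auto simp: Q_def)
    then show ?thesis using ip_pos[OF that False] by (simp add: divide_le_eq)
  qed
  define b where "b = (\<lambda>u v. q * ip u v - a u v)"
  interpret b: psd_form V b
  proof
    show "b u v = b v u" if "u \<in> V" "v \<in> V" for u v
      using a.sym[OF that] ip.sym[OF that] by (simp add: b_def)
    show "b (\<lambda>x. u x + v x) w = b u w + b v w" if "u \<in> V" "v \<in> V" "w \<in> V" for u v w
      using a.add_left[OF that] ip.add_left[OF that] by (simp add: b_def distrib_left)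
    show "b (\<lambda>x. c *\<^sub>R u x) w = c * b u w" if "u \<in> V" "w \<in> V" for u w c
      using a.scale_left[OF that] ip.scale_left[OF that] by (simp add: b_def right_diff_distrib)
    show "0 \<le> b v v" if "v \<in> V" for v
      using Q_le[OF that] by (simp add: b_def)
  qed
  have "\<exists>v\<in>V. v \<noteq> (\<lambda>x. 0) \<and> b v v = 0"
  proof (rule ccontr)
    assume "\<not> ?thesis"
    then have def: "\<And>v. v \<in> V \<Longrightarrow> b v v = 0 \<Longrightarrow> v = (\<lambda>x. 0)" by blast
    have "\<exists>D>0. \<forall>v\<in>combinations I e. ip v v \<le> D * b v v"
      by (rule psd_form_le_definite_form[OF ip.psd_form_axioms b.psd_form_axioms])
        (simp_all add: def finite_I e_mem)
    then obtain D where D: "D > 0" "\<And>v. v \<in> V \<Longrightarrow> ip v v \<le> D * b v v"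
      unfolding V_eq[symmetric] by blast
    have "q \<le> q - 1 / D"
      unfolding q_def
    proof (rule cSup_least)
      show "Q \<noteq> {}" using w False by (auto simp: Q_def)
    next
      fix t assume "t \<in> Q"
      then obtain v where v: "v \<in> V" "v \<noteq> (\<lambda>x. 0)" "t = a v v / ip v v" by (auto simp: Q_def)
      have "ip v v / D \<le> q * ip v v - a v v"
        using D(2)[OF v(1)] D(1) by (simp add: b_def field_simps)
      then have "a v v \<le> (q - 1 / D) * ip v v" by (simp add: algebra_simps)
      then show "t \<le> Sup Q - 1 / D"
        using ip_pos[OF v(1,2)] v(3) by (simp add: q_def divide_le_eq)
    qed
    then show False using D(1) by simp
  qed
  then obtain v where v: "v \<in> V" "v \<noteq> (\<lambda>x. 0)" "b v v = 0" by blast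
  have qv: "(\<lambda>x. q * v x) \<in> V" using a.scale[OF v(1), of q] by simp
  have "A v = (\<lambda>x. q * v x)"
  proof (rule ext[OF A_mem[OF v(1)] qv])
    fix u assume u: "u \<in> V"
    have "b v u = 0" using b.null_imp_zero[OF u v(1,3)] b.sym[OF u v(1)] by simp
    then show "ip (A v) u = ip (\<lambda>x. q * v x) u"
      using A_form[OF v(1) u] ip.scale_left[OF v(1) u, of q] by (simp add: b_def)
  qed
  then have "q \<in> E" using v by (auto simp: E_def)
  moreover have "bdd_above E"
  proof (rule bdd_aboveI[of _ q])
    fix l assume "l \<in> E"
    then obtain u where u: "u \<in> V" "u \<noteq> (\<lambda>x. 0)" "A u = (\<lambda>x. l * u x)" by (auto simp: E_def)
    have "l * ip u u \<le> q * ip u u"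
      using A_form[OF u(1,1)] ip.scale_left[OF u(1,1), of l] Q_le[OF u(1)] u(3) by simp
    then show "l \<le> q" using ip_pos[OF u(1,2)] by simp
  qed
  ultimately have "q \<le> Sup E" by (rule cSup_upper)
  then have "q * ip w w \<le> Sup E * ip w w" using ip.nonneg[OF w] by (rule mult_right_mono)
  then show ?thesis using Q_le[OF w] unfolding E_def by linarith
qed

text \<open>
  With $r = A v$ and $(\cdot,\cdot)$ the inner product \<open>ip\<close>, the energy of
  $v - L^{-1} r$ is $a(v,v) - 2 L^{-1} (r,r) + L^{-2} a(r,r)$, and $a(r,r) \le L\,(r,r)$.
  For $L \le 0$ the assumption forces the energy of every vector to vanish.
\<close>

lemma Richardson_energy_le:
  assumes L: "\<And>w. w \<in> V \<Longrightarrow> a w w \<le> L * ip w w" and v: "v \<in> V"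
  defines "g \<equiv> \<lambda>x. v x - inverse L * A v x"
  shows "a g g \<le> a v v"
proof (cases "L > 0")
  case True
  let ?r = "A v" and ?t = "- inverse L"
  have r: "?r \<in> V" using v A_mem by blast
  have g: "g = (\<lambda>x. v x + ?t *\<^sub>R ?r x)" by (simp add: g_def)
  have vr: "a v ?r = ip ?r ?r" using A_form[OF v r] by simp
  have "inverse L * a ?r ?r \<le> inverse L * (L * ip ?r ?r)"
    using L[OF r] True by (intro mult_left_mono) auto
  then have "inverse L * a ?r ?r \<le> ip ?r ?r" using True by (simp add: mult.assoc[symmetric])
  then have "(inverse L)\<^sup>2 * a ?r ?r \<le> inverse L * ip ?r ?r"
    using True by (simp add: power2_eq_square mult.assoc)
  moreover have "0 \<le> inverse L * ip ?r ?r" using True ip.nonneg[OF r] by simp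
  moreover have "a g g = a v v + 2 * ?t * a v ?r + ?t\<^sup>2 * a ?r ?r"
    unfolding g by (rule a.expand[OF v r])
  ultimately show ?thesis using vr by simp
next
  case False
  have g: "g \<in> V" using a.diff[OF v a.scale[OF A_mem[OF v], of "inverse L"]] by (simp add: g_def)
  have "L * ip g g \<le> 0" using False ip.nonneg[OF g] by (simp add: mult_nonpos_nonneg)
  then show ?thesis using L[OF g] a.nonneg[OF v] by linarith
qed

end

section \<open>Polynomial spaces\<close>

definition monomial :: "('n::finite \<Rightarrow> nat) \<Rightarrow> real^'n \<Rightarrow> real" where
  "monomial a x = (\<Prod>i\<in>UNIV. (x $ i) ^ a i)"

lemma poly_space_eq_combinations: "poly_space c p = combinations (exponents c p) monomial"
  by (simp add: poly_space_def combinations_def monomial_def[abs_def])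

lemma finite_exponents: "finite (exponents c p :: ('n::finite \<Rightarrow> nat) set)"
proof (rule finite_subset)
  show "exponents c p \<subseteq> (UNIV :: 'n set) \<rightarrow>\<^sub>E {..p}"
  proof
    fix a :: "'n \<Rightarrow> nat" assume a: "a \<in> exponents c p"
    have "a i \<le> p" for i
    proof (cases c)
      case Simplex
      have "a i \<le> (\<Sum>i\<in>UNIV. a i)" by (rule member_le_sum) auto
      then show ?thesis using a Simplex by (simp add: exponents_def)
    qed (use a in \<open>simp add: exponents_def\<close>)
    then show "a \<in> UNIV \<rightarrow>\<^sub>E {..p}" by (auto simp: PiE_def)
  qed
qed (simp add: finite_PiE)

lemma combinations_mono:
  assumes "finite J" "I \<subseteq> J"
  shows "combinations I e \<subseteq> combinations J e"
proof (rule combinations_subset[OF function_space_combinations])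
  show "e i \<in> combinations J e" if "i \<in> I" for i
    by (rule generator_in_combinations) (use assms that in auto)
qed

lemma poly_space_mono: "p \<le> q \<Longrightarrow> poly_space c p \<subseteq> poly_space c q"
  unfolding poly_space_eq_combinations
  by (rule combinations_mono[OF finite_exponents])
    (auto simp: exponents_def split: ref_kind.splits intro: order_trans)

text \<open>
  Total and coordinatewise degree are treated together: \<open>\<omega>\<close> is a family of additive degrees of
  exponents, and \<open>polys_below \<omega> d\<close> bounds each of them.
\<close>

definition polys_below ::
  "('t \<Rightarrow> ('n::finite \<Rightarrow> nat) \<Rightarrow> nat) \<Rightarrow> ('t \<Rightarrow> nat) \<Rightarrow> (real^'n \<Rightarrow> real) set" where
  "polys_below \<omega> d = combinations {a. \<forall>t. \<omega> t a \<le> d t} monomial"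

locale additive_degrees =
  fixes \<omega> :: "'t \<Rightarrow> ('n::finite \<Rightarrow> nat) \<Rightarrow> nat"
  assumes degree_add: "\<omega> t (\<lambda>i. a i + b i) = \<omega> t a + \<omega> t b"
    and finite_below: "finite {a. \<forall>t. \<omega> t a \<le> d t}"
begin

lemma monomial_below: "(\<And>t. \<omega> t a \<le> d t) \<Longrightarrow> monomial a \<in> polys_below \<omega> d"
  unfolding polys_below_def by (rule generator_in_combinations[OF finite_below]) simp

lemma polys_below_mono: "(\<And>t. d t \<le> d' t) \<Longrightarrow> polys_below \<omega> d \<subseteq> polys_below \<omega> d'"
  unfolding polys_below_def
  by (rule combinations_mono[OF finite_below]) (auto intro: order_trans)

lemma degree_zero: "\<omega> t (\<lambda>i. 0) = 0"
  using degree_add[of t "\<lambda>i. 0" "\<lambda>i. 0"] by simp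

lemma mult_below:
  assumes "u \<in> polys_below \<omega> d" "v \<in> polys_below \<omega> d'"
  shows "(\<lambda>x. u x * v x) \<in> polys_below \<omega> (\<lambda>t. d t + d' t)"
proof -
  let ?P = "polys_below \<omega> (\<lambda>t. d t + d' t)"
  interpret P: function_space ?P unfolding polys_below_def by (rule function_space_combinations)
  obtain c where u: "u = (\<lambda>x. \<Sum>a | \<forall>t. \<omega> t a \<le> d t. c a *\<^sub>R monomial a x)"
    using assms(1) unfolding polys_below_def combinations_def by blast
  obtain c' where v: "v = (\<lambda>x. \<Sum>a | \<forall>t. \<omega> t a \<le> d' t. c' a *\<^sub>R monomial a x)"
    using assms(2) unfolding polys_below_def combinations_def by blast
  have "(\<lambda>x. u x * v x) = (\<lambda>x. \<Sum>a | \<forall>t. \<omega> t a \<le> d t. \<Sum>b | \<forall>t. \<omega> t b \<le> d' t.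
          (c a * c' b) *\<^sub>R monomial (\<lambda>i. a i + b i) x)"
    unfolding u v sum_product by (simp add: monomial_def power_add prod.distrib mult_ac)
  also have "\<dots> \<in> ?P"
    by (intro P.sum P.scale monomial_below) (auto simp: degree_add intro: add_mono)
  finally show ?thesis .
qed

lemma one_below: "(\<lambda>x. 1) \<in> polys_below \<omega> (\<lambda>t. 0)"
  using monomial_below[of "\<lambda>i. 0" "\<lambda>t. 0"] by (simp add: monomial_def[abs_def] degree_zero)

lemma power_below: 
  assumes "u \<in> polys_below \<omega> d"
  shows "(\<lambda>x. u x ^ m) \<in> polys_below \<omega> (\<lambda>t. m * d t)"
proof (induction m)
  case (Suc m)
  then show ?case using mult_below[OF assms Suc] by simp
qed (simp add: one_below)

lemma prod_below:
  assumes "finite I" and "\<And>i. i \<in> I \<Longrightarrow> u i \<in> polys_below \<omega> (d i)"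
  shows "(\<lambda>x. \<Prod>i\<in>I. u i x) \<in> polys_below \<omega> (\<lambda>t. \<Sum>i\<in>I. d i t)"
  using assms
proof (induction I rule: finite_induct)
  case (insert j I)
  then show ?case using mult_below[of "u j" "d j" "\<lambda>x. \<Prod>i\<in>I. u i x" "\<lambda>t. \<Sum>i\<in>I. d i t"] by simp
qed (simp add: one_below)

lemma substitution_below:
  assumes F: "\<And>i. (\<lambda>x. F x $ i) \<in> polys_below \<omega> (\<delta> i)"
    and q: "q \<in> combinations E monomial"
    and E: "\<And>a t. a \<in> E \<Longrightarrow> (\<Sum>i\<in>UNIV. a i * \<delta> i t) \<le> d t"
  shows "(\<lambda>x. q (F x)) \<in> polys_below \<omega> d"
proof -
  interpret P: function_space "polys_below \<omega> d"
    unfolding polys_below_def by (rule function_space_combinations)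
  obtain c where q: "q = (\<lambda>x. \<Sum>a\<in>E. c a *\<^sub>R monomial a x)"
    using q unfolding combinations_def by blast
  have "(\<lambda>x. monomial a (F x)) \<in> polys_below \<omega> d" if "a \<in> E" for a
    unfolding monomial_def
    by (rule subsetD[OF polys_below_mono prod_below[OF finite power_below[OF F]]])
      (rule E[OF that])
  then show ?thesis unfolding q by (intro P.sum P.scale)
qed

end

lemma monomial_unit: "monomial (\<lambda>i. if i = j then 1 else 0) x = x $ j"
  by (simp add: monomial_def if_distrib[of "\<lambda>m. _ ^ m"] cong: if_cong)

lemma monomial_0: "monomial (\<lambda>i. 0) x = 1"
  by (simp add: monomial_def)

interpretation total_degree: additive_degrees "\<lambda>(_::unit) (a :: 'n::finite \<Rightarrow> nat). \<Sum>i\<in>UNIV. a i"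
proof
  fix d :: "unit \<Rightarrow> nat"
  show "finite {a. \<forall>t. (\<Sum>i\<in>(UNIV :: 'n set). a i) \<le> d t}"
    using finite_exponents[of Simplex "d ()"] by (simp add: exponents_def)
qed (simp add: sum.distrib)

interpretation coordinate_degrees: additive_degrees "\<lambda>(t::'n::finite) a. a t"
proof
  fix d :: "'n \<Rightarrow> nat"
  show "finite {a. \<forall>t. a t \<le> d t}"
  proof (rule finite_subset[OF subsetI finite_exponents[of Cube "Max (range d)"]])
    fix a assume "a \<in> {a. \<forall>t. a t \<le> d t}"
    then have "a t \<le> Max (range d)" for t using order_trans[OF _ Max_ge[of "range d" "d t"]] by simp
    then show "a \<in> exponents Cube (Max (range d))" by (simp add: exponents_def)
  qed
qed simp

lemma poly_space_Simplex:
  "poly_space Simplex p = polys_below (\<lambda>(_::unit) a. \<Sum>i\<in>UNIV. a i) (\<lambda>_. p)"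
  by (simp add: poly_space_eq_combinations polys_below_def exponents_def)

lemma poly_space_Cube: "poly_space Cube p = polys_below (\<lambda>t a. a t) (\<lambda>_. p)"
  by (simp add: poly_space_eq_combinations polys_below_def exponents_def)

lemma poly_space_Simplex_affine:
  fixes B :: "real^'n::finite^'n"
  assumes q: "q \<in> poly_space Simplex p"
  shows "(\<lambda>x. q (B *v x + b)) \<in> poly_space Simplex p"
  unfolding poly_space_Simplex
proof (rule total_degree.substitution_below[where \<delta> = "\<lambda>_ _. 1"])
  fix i :: 'n
  let ?P = "polys_below (\<lambda>(_::unit) a. \<Sum>i\<in>(UNIV :: 'n set). a i) (\<lambda>_. 1)"
  interpret P: function_space ?P unfolding polys_below_def by (rule function_space_combinations)
  have "(\<lambda>x::real^'n. x $ j) \<in> ?P" for j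
    using total_degree.monomial_below[of "\<lambda>i. if i = j then 1 else 0" "\<lambda>_. 1"]
    by (simp add: monomial_unit[abs_def])
  moreover have one: "(\<lambda>x. 1) \<in> ?P"
    using total_degree.monomial_below[of "\<lambda>i. 0" "\<lambda>_. 1"] by (simp add: monomial_0[abs_def])
  ultimately have "(\<lambda>x. (\<Sum>j\<in>UNIV. B $ i $ j *\<^sub>R (x $ j)) + b $ i *\<^sub>R 1) \<in> ?P"
    by (intro P.add P.sum P.scale)
  then show "(\<lambda>x. (B *v x + b) $ i) \<in> ?P" by (simp add: matrix_vector_mult_def)
next
  show "q \<in> combinations (exponents Simplex p) monomial" using q by (simp add: poly_space_eq_combinations)
qed (simp add: exponents_def)

definition axis_parallel :: "(real^'n \<Rightarrow> real^'n) \<Rightarrow> bool" where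
  "axis_parallel F \<longleftrightarrow> (\<exists>\<pi> \<alpha> c. bij \<pi> \<and> (\<forall>x i. F x $ i = \<alpha> i * x $ \<pi> i + c i))"

lemma poly_space_Cube_axis_parallel:
  fixes F :: "real^'n::finite \<Rightarrow> real^'n"
  assumes q: "q \<in> poly_space Cube p" and F: "axis_parallel F"
  shows "(\<lambda>x. q (F x)) \<in> poly_space Cube p"
proof -
  obtain \<pi> :: "'n \<Rightarrow> 'n" and \<alpha> c where \<pi>: "bij \<pi>" and F: "\<And>x i. F x $ i = \<alpha> i * x $ \<pi> i + c i"
    using F unfolding axis_parallel_def by blast
  let ?\<delta> = "\<lambda>i t. if t = \<pi> i then 1 else 0 :: nat"
  show ?thesis
    unfolding poly_space_Cube
  proof (rule coordinate_degrees.substitution_below[where \<delta> = ?\<delta>])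
    fix i :: 'n
    let ?P = "polys_below (\<lambda>(t::'n) a. a t) (?\<delta> i)"
    interpret P: function_space ?P unfolding polys_below_def by (rule function_space_combinations)
    have "(\<lambda>x::real^'n. x $ \<pi> i) \<in> ?P"
      using coordinate_degrees.monomial_below[of "?\<delta> i" "?\<delta> i"]
      by (simp add: monomial_unit[abs_def])
    moreover have "(\<lambda>x. 1) \<in> ?P"
      using coordinate_degrees.monomial_below[of "\<lambda>i. 0" "?\<delta> i"] by (simp add: monomial_0[abs_def])
    ultimately have "(\<lambda>x. \<alpha> i *\<^sub>R (x $ \<pi> i) + c i *\<^sub>R 1) \<in> ?P" by (intro P.add P.scale)
    then show "(\<lambda>x. F x $ i) \<in> ?P" by (simp add: F)
  next
    show "q \<in> combinations (exponents Cube p) monomial" using q by (simp add: poly_space_eq_combinations)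
  next
    fix a :: "'n \<Rightarrow> nat" and t assume a: "a \<in> exponents Cube p"
    have "(\<Sum>i\<in>UNIV. a i * ?\<delta> i t) = (\<Sum>i\<in>UNIV. if i = inv \<pi> t then a i else 0)"
      using \<pi> by (intro sum.cong) (auto simp: bij_is_inj bij_is_surj surj_f_inv_f)
    also have "\<dots> \<le> p" using a by (simp add: exponents_def)
    finally show "(\<Sum>i\<in>UNIV. a i * ?\<delta> i t) \<le> p" .
  qed
qed

section \<open>Affine maps\<close>

lemma affine_isoE:
  assumes "affine_iso F"
  obtains B b C where "B ** C = mat 1" "C ** B = mat 1" "F = (\<lambda>x. B *v x + b)"
  using assms unfolding affine_iso_def invertible_def by blast

lemma affine_iso_inv:
  assumes "affine_iso F"
  shows "affine_iso (inv F)" and "inv F (F x) = x" and "F (inv F x) = x"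
proof -
  obtain B b C where BC: "B ** C = mat 1" "C ** B = mat 1" and F: "F = (\<lambda>x. B *v x + b)"
    by (rule affine_isoE[OF assms])
  let ?G = "\<lambda>x. C *v x + C *v (- b)"
  have GF: "?G (F x) = x" and FG: "F (?G x) = x" for x
    by (simp_all add: F BC matrix_vector_mul_assoc matrix_vector_right_distrib
        flip: matrix_vector_mult_diff_distrib matrix_vector_right_distrib)
  have inv: "inv F = ?G" using GF FG by (intro inv_unique_comp) (auto simp: fun_eq_iff)
  show "affine_iso (inv F)" unfolding inv affine_iso_def invertible_def using BC by blast
  show "inv F (F x) = x" "F (inv F x) = x" unfolding inv by (rule GF, rule FG)
qed

lemma affine_iso_compose:
  assumes "affine_iso F" "affine_iso G"
  shows "affine_iso (\<lambda>x. F (G x))"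
proof -
  obtain B b where B: "invertible B" "F = (\<lambda>x. B *v x + b)" using assms(1) by (auto simp: affine_iso_def)
  obtain C c where C: "invertible C" "G = (\<lambda>x. C *v x + c)" using assms(2) by (auto simp: affine_iso_def)
  have "(\<lambda>x. F (G x)) = (\<lambda>x. (B ** C) *v x + (B *v c + b))"
    by (simp add: B C matrix_vector_right_distrib matrix_vector_mul_assoc add.assoc)
  then show ?thesis unfolding affine_iso_def using invertible_mult[OF B(1) C(1)] by blast
qed

text \<open>
  The difference of the values of the \<open>i\<close>-th coordinate at two nearly opposite corners, chosen according to
  the signs in row \<open>i\<close>, is almost the absolute row sum, and it is below the side length 1.
\<close>

lemma row_sum_le_1:
  fixes B :: "real^'n::finite^'n"
  assumes "(\<lambda>x. B *v x + b) ` ref_elem Cube \<subseteq> ref_elem Cube"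
  shows "(\<Sum>j\<in>UNIV. \<bar>B $ i $ j\<bar>) \<le> 1"
proof (rule field_le_mult_one_interval)
  fix t :: real assume t: "0 < t" "t < 1"
  \<comment> \<open>The factor \<open>t < 1\<close> keeps both points inside the open cube.\<close>
  define x :: "real^'n" where "x = (\<chi> j. 1/2 + t/2 * sgn (B $ i $ j))"
  define y :: "real^'n" where "y = (\<chi> j. 1/2 - t/2 * sgn (B $ i $ j))"
  have "x \<in> ref_elem Cube" "y \<in> ref_elem Cube"
    using t by (auto simp: x_def y_def ref_elem_def sgn_if)
  then have "(B *v x + b) $ i < 1" "(B *v y + b) $ i > 0"
    using assms by (auto simp: ref_elem_def image_subset_iff)
  then have "(B *v x) $ i - (B *v y) $ i < 1" by simp
  moreover have "(B *v x) $ i - (B *v y) $ i = t * (\<Sum>j\<in>UNIV. \<bar>B $ i $ j\<bar>)"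
    unfolding matrix_vector_mult_def
    by (simp add: x_def y_def sum_distrib_left abs_sgn algebra_simps flip: sum_subtractf)
  ultimately show "t * (\<Sum>j\<in>UNIV. \<bar>B $ i $ j\<bar>) \<le> 1" by simp
qed

text \<open>
  The matrix and its inverse both have absolute row sums at most 1.  Since the diagonal entries of the
  product are 1, every column of the matrix has an entry of absolute value 1, and this entry
  exhausts its row.
\<close>

lemma cube_automorphism_axis_parallel:
  fixes F :: "real^'n::finite \<Rightarrow> real^'n"
  assumes "affine_iso F" and img: "F ` ref_elem Cube = ref_elem Cube"
  shows "axis_parallel F"
proof -
  obtain B b C where BC: "B ** C = mat 1" "C ** B = mat 1" and F: "F = (\<lambda>x. B *v x + b)"
    by (rule affine_isoE[OF assms(1)])
  have "(\<lambda>x. C *v x + C *v (- b)) (F x) = x" for x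
    by (simp add: F BC matrix_vector_mul_assoc matrix_vector_right_distrib
        flip: matrix_vector_mult_diff_distrib matrix_vector_right_distrib)
  then have img': "(\<lambda>x. C *v x + C *v (- b)) ` ref_elem Cube = ref_elem Cube"
    by (subst img[symmetric], unfold image_image) simp
  have rowB: "(\<Sum>j\<in>UNIV. \<bar>B $ i $ j\<bar>) \<le> 1" for i
    by (rule row_sum_le_1[of B b]) (use img F in simp)
  have rowC: "(\<Sum>j\<in>UNIV. \<bar>C $ i $ j\<bar>) \<le> 1" for i
    by (rule row_sum_le_1[of C "C *v (- b)"]) (use img' in simp)
  have entry: "\<bar>B $ j $ i\<bar> \<le> 1" for i j
    using member_le_sum[of i UNIV "\<lambda>i. \<bar>B $ j $ i\<bar>"] rowB[of j] by simp
  have "\<exists>j. \<bar>B $ j $ i\<bar> = 1" for i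
  proof (rule ccontr)
    assume "\<not> ?thesis"
    then have lt: "\<bar>B $ j $ i\<bar> < 1" for j using entry[of j i] by (auto simp: less_le)
    have "(\<Sum>j\<in>UNIV. C $ i $ j * B $ j $ i) = (C ** B) $ i $ i" by (simp add: matrix_matrix_mult_def)
    then have one: "(\<Sum>j\<in>UNIV. C $ i $ j * B $ j $ i) = 1" by (simp add: BC mat_def)
    then obtain j0 where j0: "C $ i $ j0 \<noteq> 0" by (metis (no_types, lifting) mult_zero_left sum.neutral zero_neq_one)
    have "(\<Sum>j\<in>UNIV. C $ i $ j * B $ j $ i) < (\<Sum>j\<in>UNIV. \<bar>C $ i $ j\<bar>)"
    proof (rule sum_strict_mono_ex1)
      have le: "C $ i $ j * B $ j $ i \<le> \<bar>C $ i $ j\<bar> * \<bar>B $ j $ i\<bar>" for j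
        by (simp flip: abs_mult)
      show "\<forall>j\<in>UNIV. C $ i $ j * B $ j $ i \<le> \<bar>C $ i $ j\<bar>"
        using order_trans[OF le mult_left_le] lt by (simp add: less_imp_le)
      have "\<bar>C $ i $ j0\<bar> * \<bar>B $ j0 $ i\<bar> < \<bar>C $ i $ j0\<bar>" using j0 lt[of j0] by simp
      then show "\<exists>j\<in>UNIV. C $ i $ j * B $ j $ i < \<bar>C $ i $ j\<bar>" using le[of j0]
        by (intro bexI[of _ j0] order_le_less_trans[OF le]) auto
    qed simp
    then show False using one rowC[of i] by simp
  qed
  then obtain \<rho> where \<rho>: "\<And>i. \<bar>B $ \<rho> i $ i\<bar> = 1" by metis
  have other: "B $ \<rho> i $ k = 0" if "k \<noteq> i" for i k
  proof -
    have "\<bar>B $ \<rho> i $ i\<bar> + \<bar>B $ \<rho> i $ k\<bar> = (\<Sum>j\<in>{i, k}. \<bar>B $ \<rho> i $ j\<bar>)" using that by simp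
    also have "\<dots> \<le> (\<Sum>j\<in>UNIV. \<bar>B $ \<rho> i $ j\<bar>)" by (rule sum_mono2) auto
    finally show ?thesis using rowB[of "\<rho> i"] \<rho>[of i] by simp
  qed
  \<comment> \<open>Each row carries at most one such entry, so there is exactly one in each row and each column.\<close>
  have "inj \<rho>"
  proof (rule injI, rule ccontr)
    fix i k assume "\<rho> i = \<rho> k" "i \<noteq> k"
    then show False using other[of k i] \<rho>[of k] by simp
  qed
  then have \<rho>_bij: "bij \<rho>" by (simp add: finite_UNIV_inj_surj bij_def)
  have "F x $ l = B $ l $ inv \<rho> l * x $ inv \<rho> l + b $ l" for x l
  proof -
    have l: "\<rho> (inv \<rho> l) = l" using \<rho>_bij by (simp add: bij_is_surj surj_f_inv_f)
    have "(\<Sum>j\<in>UNIV. B $ l $ j * x $ j) = (\<Sum>j\<in>{inv \<rho> l}. B $ l $ j * x $ j)"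
      using other[of _ "inv \<rho> l"] l by (intro sum.mono_neutral_right) auto
    then show ?thesis by (simp add: F matrix_vector_mult_def)
  qed
  then show ?thesis unfolding axis_parallel_def using bij_imp_bij_inv[OF \<rho>_bij]
    by (intro exI[of _ "inv \<rho>"] exI[of _ "\<lambda>l. B $ l $ inv \<rho> l"] exI[of _ "\<lambda>l. b $ l"]) auto
qed

section \<open>Meshes\<close>

lemma ref_elem_Cube_eq_box: "ref_elem Cube = box 0 (1 :: real^'n::finite)"
  by (auto simp: ref_elem_def mem_box_cart)

lemma ref_elem_Simplex_eq:
  "ref_elem Simplex = box 0 (1 :: real^'n::finite) \<inter> {x. (1 :: real^'n) \<bullet> x < 1}"
proof -
  have "x $ i < 1" if "\<And>i. 0 < x $ i" "(\<Sum>i\<in>UNIV. x $ i) < 1" for x :: "real^'n" and i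
    using member_le_sum[of i UNIV "\<lambda>i. x $ i"] that by (simp add: less_imp_le order_le_less_trans)
  then show ?thesis by (auto simp: ref_elem_def mem_box_cart inner_vec_def)
qed

lemma ref_elem_properties:
  shows "open (ref_elem c :: (real^'n::finite) set)" and "convex (ref_elem c :: (real^'n) set)"
    and "bounded (ref_elem c :: (real^'n) set)" and "(ref_elem c :: (real^'n) set) \<noteq> {}"
proof -
  show "open (ref_elem c :: (real^'n) set)"
    by (cases c) (simp_all add: ref_elem_Cube_eq_box ref_elem_Simplex_eq open_Int open_halfspace_lt open_box)
  show "convex (ref_elem c :: (real^'n) set)"
    by (cases c) (simp_all only: ref_elem_Cube_eq_box ref_elem_Simplex_eq convex_Int convex_box
        convex_halfspace_lt ref_kind.simps)
  show "bounded (ref_elem c :: (real^'n) set)"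
    by (cases c) (simp_all add: ref_elem_Cube_eq_box ref_elem_Simplex_eq bounded_Int bounded_box)
  have "(\<chi> i. 1 / (2 * real CARD('n))) \<in> (ref_elem c :: (real^'n) set)"
  proof -
    have "1 \<le> real CARD('n)" by (simp add: Suc_le_eq)
    then have "1 < 2 * real CARD('n)" by linarith
    then show ?thesis by (cases c) (simp_all add: ref_elem_def)
  qed
  then show "(ref_elem c :: (real^'n) set) \<noteq> {}" by blast
qed

lemma affine_iso_image:
  fixes F :: "real^'n::finite \<Rightarrow> real^'n"
  assumes "affine_iso F"
  shows "open S \<Longrightarrow> open (F ` S)" and "convex S \<Longrightarrow> convex (F ` S)" and "bounded S \<Longrightarrow> bounded (F ` S)"
proof -
  obtain B b C where BC: "B ** C = mat 1" "C ** B = mat 1" and F: "F = (\<lambda>x. B *v x + b)"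
    by (rule affine_isoE[OF assms])
  have img: "F ` S = (+) b ` ((*v) B ` S)" by (auto simp: F image_image add.commute)
  have lin: "linear ((*v) B)" by simp
  have surj: "surj ((*v) B)"
    by (rule surjI[of _ "(*v) C"]) (simp add: matrix_vector_mul_assoc BC)
  show "open S \<Longrightarrow> open (F ` S)"
    unfolding img by (intro open_translation open_surjective_linear_image lin surj)
  show "convex S \<Longrightarrow> convex (F ` S)"
    unfolding img by (intro convex_translation convex_linear_image lin)
  show "bounded S \<Longrightarrow> bounded (F ` S)"
    unfolding img by (intro bounded_translation bounded_linear_image matrix_vector_mul_bounded_linear)
qed

lemma open_simplex_mono: "X \<subseteq> convex hull Y \<Longrightarrow> open_simplex X \<subseteq> open_simplex Y"
  unfolding open_simplex_def by (intro interior_mono hull_minimal convex_convex_hull)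

lemma midpoint_in_convex_hull:
  assumes "x \<in> Y" "y \<in> Y" shows "midpoint x y \<in> convex hull Y"
proof -
  have "midpoint x y \<in> closed_segment x y" by simp
  also have "\<dots> \<subseteq> convex hull Y"
    using assms by (intro closed_segment_subset convex_convex_hull hull_inc)
  finally show ?thesis .
qed

lemma uniform_split_subset:
  fixes T :: "(real^'n::finite) set"
  assumes "uniform_split c T Cs" "T' \<in> Cs"
  shows "T' \<subseteq> T"
proof (cases c)
  case Cube
  then obtain F and a :: "real^'n" where F: "T = F ` ref_elem Cube" "\<forall>i. a $ i \<in> {0, 1}"
    "T' = (\<lambda>x. F ((1/2) *\<^sub>R (x + a))) ` ref_elem Cube"
    using assms by (auto simp: uniform_split_def)
  have "(1/2) *\<^sub>R (x + a) \<in> ref_elem Cube" if x: "x \<in> ref_elem Cube" for x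
  proof -
    have "0 < x $ i + a $ i \<and> x $ i + a $ i < 2" for i
      using x F(2)[rule_format, of i] by (auto simp: ref_elem_def) (smt (verit) x)+
    then show ?thesis by (simp add: ref_elem_def)
  qed
  then show ?thesis using F by auto
next
  case Simplex
  show ?thesis
  proof (cases "CARD('n) = 2")
    case True
    then obtain x0 x1 x2 where T: "T = open_simplex {x0, x1, x2}"
      and T': "T' \<in> {open_simplex {x0, midpoint x0 x1, midpoint x0 x2},
        open_simplex {midpoint x0 x1, x1, midpoint x1 x2},
        open_simplex {midpoint x0 x2, midpoint x1 x2, x2},
        open_simplex {midpoint x0 x1, midpoint x0 x2, midpoint x1 x2}}"
      using assms Simplex by (auto simp: uniform_split_def Let_def)
    show ?thesis
      using T' unfolding T
      by (elim insertE emptyE; hypsubst; intro open_simplex_mono; simp add: midpoint_in_convex_hull hull_inc)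
  next
    case False
    then obtain x0 x1 x2 x3 where T: "T = open_simplex {x0, x1, x2, x3}"
      and T': "let x01 = midpoint x0 x1; x02 = midpoint x0 x2; x03 = midpoint x0 x3;
                  x12 = midpoint x1 x2; x13 = midpoint x1 x3; x23 = midpoint x2 x3 in
              T' \<in> {open_simplex {x0, x01, x02, x03}, open_simplex {x01, x1, x12, x13},
                    open_simplex {x02, x12, x2, x23}, open_simplex {x03, x13, x23, x3},
                    open_simplex {x01, x02, x03, x13}, open_simplex {x01, x02, x12, x13},
                    open_simplex {x02, x03, x13, x23}, open_simplex {x02, x12, x13, x23}}"
      using assms Simplex by (auto simp: uniform_split_def Let_def)
    show ?thesis
      using T' unfolding T Let_def
      by (elim insertE emptyE; hypsubst; intro open_simplex_mono; simp add: midpoint_in_convex_hull hull_inc)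
  qed
qed

text \<open>
  Polynomials of degree at most \<open>p\<close> in each variable are not invariant under all affine maps.  The
  transition map from a child to its parent is, however, a dilation composed with automorphisms of
  the cube, and these only permute and reflect the coordinates.
\<close>

lemma uniform_split_poly_space:
  fixes F G :: "real^'n::finite \<Rightarrow> real^'n"
  assumes split: "uniform_split c (F ` ref_elem c) Cs" "G ` ref_elem c \<in> Cs"
    and F: "affine_iso F" and G: "affine_iso G" and q: "q \<in> poly_space c p"
  shows "(\<lambda>x. q (inv F (G x))) \<in> poly_space c p"
proof (cases c)
  case Simplex
  obtain B b where "(\<lambda>x. inv F (G x)) = (\<lambda>x. B *v x + b)"
    using affine_iso_compose[OF affine_iso_inv(1)[OF F] G] by (auto simp: affine_iso_def)
  then have "(\<lambda>x. q (inv F (G x))) = (\<lambda>x. q (B *v x + b))" by (simp add: fun_eq_iff)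
  then show ?thesis using poly_space_Simplex_affine q Simplex by simp
next
  case Cube
  then obtain H and a :: "real^'n" where H: "affine_iso H" "F ` ref_elem Cube = H ` ref_elem Cube"
    "G ` ref_elem Cube = (\<lambda>x. H ((1/2) *\<^sub>R (x + a))) ` ref_elem Cube"
    using split by (auto simp: uniform_split_def)
  define D where "D = (\<lambda>x. (1/2) *\<^sub>R (x + a))"
  have D: "affine_iso D"
    unfolding affine_iso_def invertible_def
    by (intro exI[of _ "mat (1/2)"] exI[of _ "(1/2) *\<^sub>R a"] conjI exI[of _ "mat 2"])
       (auto simp: D_def fun_eq_iff vec_eq_iff matrix_vector_mult_def matrix_matrix_mult_def mat_def
         if_distrib[of "\<lambda>r. r * _"] if_distrib[of "\<lambda>r. _ * r"] algebra_simps cong: if_cong)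
  let ?HD = "\<lambda>x. H (D x)"
  have HD: "affine_iso ?HD" by (rule affine_iso_compose[OF H(1) D])
  define A1 where "A1 = (\<lambda>x. inv F (H x))"
  define A2 where "A2 = (\<lambda>x. inv ?HD (G x))"
  have 1: "axis_parallel A1" unfolding A1_def
  proof (rule cube_automorphism_axis_parallel[OF affine_iso_compose[OF affine_iso_inv(1)[OF F] H(1)]])
    have "(\<lambda>x. inv F (H x)) ` ref_elem Cube = inv F ` H ` ref_elem Cube" by (simp add: image_image)
    also have "\<dots> = ref_elem Cube" unfolding H(2)[symmetric] by (simp add: image_image affine_iso_inv[OF F])
    finally show "(\<lambda>x. inv F (H x)) ` ref_elem Cube = ref_elem Cube" .
  qed
  have 2: "axis_parallel A2" unfolding A2_def
  proof (rule cube_automorphism_axis_parallel[OF affine_iso_compose[OF affine_iso_inv(1)[OF HD] G]])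
    have "(\<lambda>x. inv ?HD (G x)) ` ref_elem Cube = inv ?HD ` G ` ref_elem Cube" by (simp add: image_image)
    also have "\<dots> = ref_elem Cube"
      unfolding H(3) D_def[symmetric] using affine_iso_inv(2)[OF HD] by (simp add: image_image D_def)
    finally show "(\<lambda>x. inv ?HD (G x)) ` ref_elem Cube = ref_elem Cube" .
  qed
  have 3: "axis_parallel D"
    unfolding axis_parallel_def
    by (intro exI[of _ id] exI[of _ "\<lambda>_. 1/2"] exI[of _ "\<lambda>i. a $ i / 2"]) (simp add: D_def field_simps)
  have "inv F (G x) = A1 (D (A2 x))" for x
    unfolding A1_def A2_def using affine_iso_inv(3)[OF HD] by simp
  then show ?thesis
    using poly_space_Cube_axis_parallel[OF poly_space_Cube_axis_parallel[OF
        poly_space_Cube_axis_parallel[OF q[unfolded Cube] 1] 3] 2] Cube by simp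
qed

locale dg_hierarchy =
  fixes s :: "(real^'n::finite) mg_setting" and \<Omega> csr cqu Cp
  assumes domain: "polyhedral_domain \<Omega>"
    and hierarchy: "mesh_hierarchy \<Omega> csr cqu s"
    and degrees: "admissible_degrees Cp s"
    and basis: "orthonormal_ref_basis s"
begin

lemma dom_eq: "dom s = \<Omega>" and levels_ge_1: "1 \<le> levels s"
  using hierarchy unfolding mesh_hierarchy_def by blast+

lemma partition: "k \<in> {1..levels s} \<Longrightarrow> partition_of_domain \<Omega> (mesh s k)"
  using hierarchy by (simp add: mesh_hierarchy_def)

lemma finite_mesh: "k \<in> {1..levels s} \<Longrightarrow> finite (mesh s k)"
  using partition by (simp add: partition_of_domain_def)

lemma element_unique:
  "k \<in> {1..levels s} \<Longrightarrow> T \<in> mesh s k \<Longrightarrow> T' \<in> mesh s k \<Longrightarrow> x \<in> T \<Longrightarrow> x \<in> T' \<Longrightarrow> T = T'"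
  using partition[of k] pairwiseD[of disjnt "mesh s k" T T'] by (auto simp: partition_of_domain_def disjnt_iff)

lemma mesh_nonempty:
  assumes "k \<in> {1..levels s}" shows "mesh s k \<noteq> {}"
  using partition[OF assms] domain
  by (auto simp: partition_of_domain_def polyhedral_domain_def)

context
  fixes k T assumes k: "k \<in> {1..levels s}" and T: "T \<in> mesh s k"
begin

lemma elem_map_affine: "affine_iso (elem_map s k T)"
  and elem_map_image: "elem_map s k T ` ref_elem (kind s) = T"
  using hierarchy k T by (auto simp: mesh_hierarchy_def)

lemma element_open: "open T" and element_convex: "convex T" and element_bounded: "bounded T"
  and element_nonempty: "T \<noteq> {}"
  using affine_iso_image(1)[OF elem_map_affine ref_elem_properties(1), of "kind s"]
    affine_iso_image(2)[OF elem_map_affine ref_elem_properties(2), of "kind s"]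
    affine_iso_image(3)[OF elem_map_affine ref_elem_properties(3), of "kind s"]
    elem_map_image ref_elem_properties(4)[of "kind s"]
  by auto

lemma inv_elem_map: "inv (elem_map s k T) (elem_map s k T x) = x"
  "elem_map s k T (inv (elem_map s k T) x) = x"
  using affine_iso_inv[OF elem_map_affine] by auto

lemma inv_elem_map_mem: "x \<in> T \<Longrightarrow> inv (elem_map s k T) x \<in> ref_elem (kind s)"
  using elem_map_image inv_elem_map(1) by (metis imageE)

lemma elem_map_mem: "x \<in> ref_elem (kind s) \<Longrightarrow> elem_map s k T x \<in> T"
  using elem_map_image by blast

end

lemma parent_element:
  assumes k: "k \<in> {2..levels s}" and T': "T' \<in> mesh s k"
  obtains T where "T \<in> mesh s (k - 1)" "T' \<subseteq> T"
    "\<And>p q. q \<in> poly_space (kind s) p \<Longrightarrow>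
       (\<lambda>x. q (inv (elem_map s (k - 1) T) (elem_map s k T' x))) \<in> poly_space (kind s) p"
proof -
  have k': "k \<in> {1..levels s}" "k - 1 \<in> {1..levels s}" using k by auto
  obtain ch where ch: "\<And>T. T \<in> mesh s (k - 1) \<Longrightarrow> uniform_split (kind s) T (ch T)"
    "mesh s k = (\<Union>T\<in>mesh s (k - 1). ch T)"
    proof -
    have "uniform_refinement (kind s) (mesh s (k - 1)) (mesh s k)"
      using hierarchy k unfolding mesh_hierarchy_def by (elim conjE) (rule bspec)
    then show thesis unfolding uniform_refinement_def by (elim exE conjE, intro that) auto
  qed
  then obtain T where T: "T \<in> mesh s (k - 1)" "T' \<in> ch T" using T' by blast
  show thesis
  proof
    show "T' \<subseteq> T" by (rule uniform_split_subset[OF ch(1)[OF T(1)] T(2)])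
    show "(\<lambda>x. q (inv (elem_map s (k - 1) T) (elem_map s k T' x))) \<in> poly_space (kind s) p"
      if "q \<in> poly_space (kind s) p" for p q
    proof (rule uniform_split_poly_space[OF _ _ elem_map_affine[OF k'(2) T(1)]
          elem_map_affine[OF k'(1) T'] that])
      show "uniform_split (kind s) (elem_map s (k - 1) T ` ref_elem (kind s)) (ch T)"
        unfolding elem_map_image[OF k'(2) T(1)] by (rule ch(1)[OF T(1)])
      show "elem_map s k T' ` ref_elem (kind s) \<in> ch T"
        unfolding elem_map_image[OF k'(1) T'] by (rule T(2))
    qed
  qed fact
qed

section \<open>Discrete spaces\<close>

lemma function_space_poly_space: "function_space (poly_space c p)"
  unfolding poly_space_eq_combinations by (rule function_space_combinations)

lemma function_space_dg_space: "function_space (dg_space s k)"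
proof -
  interpret P: function_space "poly_space (kind s) (pdeg s k)" by (rule function_space_poly_space)
  show ?thesis
  proof
    show "(\<lambda>x. 0) \<in> dg_space s k" using P.zero by (auto simp: dg_space_def)
  next
    fix u v assume u: "u \<in> dg_space s k" and v: "v \<in> dg_space s k"
    have "\<exists>q\<in>poly_space (kind s) (pdeg s k). \<forall>x\<in>ref_elem (kind s).
        u (elem_map s k T x) + v (elem_map s k T x) = q x" if "T \<in> mesh s k" for T
    proof -
      obtain q r where "q \<in> poly_space (kind s) (pdeg s k)" "r \<in> poly_space (kind s) (pdeg s k)"
        "\<forall>x\<in>ref_elem (kind s). u (elem_map s k T x) = q x"
        "\<forall>x\<in>ref_elem (kind s). v (elem_map s k T x) = r x"
        using u v \<open>T \<in> mesh s k\<close> unfolding dg_space_def by blast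
      then show ?thesis by (intro bexI[OF _ P.add[of q r]]) auto
    qed
    then show "(\<lambda>x. u x + v x) \<in> dg_space s k" using u v by (auto simp: dg_space_def)
  next
    fix v and c :: real assume v: "v \<in> dg_space s k"
    have "\<exists>q\<in>poly_space (kind s) (pdeg s k). \<forall>x\<in>ref_elem (kind s).
        c *\<^sub>R v (elem_map s k T x) = q x" if "T \<in> mesh s k" for T
    proof -
      obtain q where "q \<in> poly_space (kind s) (pdeg s k)"
        "\<forall>x\<in>ref_elem (kind s). v (elem_map s k T x) = q x"
        using v \<open>T \<in> mesh s k\<close> unfolding dg_space_def by blast
      then show ?thesis by (intro bexI[OF _ P.scale[of q c]]) auto
    qed
    then show "(\<lambda>x. c *\<^sub>R v x) \<in> dg_space s k" using v by (auto simp: dg_space_def)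
  qed
qed

lemma injection_mem:
  assumes k: "k \<in> {2..levels s}" and v: "v \<in> dg_space s (k - 1)"
  shows "injection s k v \<in> dg_space s k"
proof -
  have k': "k \<in> {1..levels s}" "k - 1 \<in> {1..levels s}" using k by auto
  have le: "pdeg s (k - 1) \<le> pdeg s k" using degrees k by (simp add: admissible_degrees_def)
  have "\<exists>q\<in>poly_space (kind s) (pdeg s k). \<forall>x\<in>ref_elem (kind s).
      injection s k v (elem_map s k T' x) = q x" if T': "T' \<in> mesh s k" for T'
  proof -
    obtain T where T: "T \<in> mesh s (k - 1)" "T' \<subseteq> T"
      "\<And>p q. q \<in> poly_space (kind s) p \<Longrightarrow>
       (\<lambda>x. q (inv (elem_map s (k - 1) T) (elem_map s k T' x))) \<in> poly_space (kind s) p"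
      using parent_element[OF k T'] by blast
    obtain q where q: "q \<in> poly_space (kind s) (pdeg s (k - 1))"
      "\<And>x. x \<in> ref_elem (kind s) \<Longrightarrow> v (elem_map s (k - 1) T x) = q x"
      using v T(1) unfolding dg_space_def by blast
    show ?thesis
    proof (rule bexI)
      show "\<forall>x\<in>ref_elem (kind s). injection s k v (elem_map s k T' x)
              = q (inv (elem_map s (k - 1) T) (elem_map s k T' x))"
      proof
        fix x :: "real^'n" assume x: "x \<in> ref_elem (kind s)"
        have y: "elem_map s k T' x \<in> T'" by (rule elem_map_mem[OF k'(1) T' x])
        then show "injection s k v (elem_map s k T' x)
              = q (inv (elem_map s (k - 1) T) (elem_map s k T' x))"
          using T' T(2) q(2)[OF inv_elem_map_mem[OF k'(2) T(1), of "elem_map s k T' x"]]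
          unfolding inv_elem_map(2)[OF k'(2) T(1)] by (auto simp: injection_def)
      qed
      show "(\<lambda>x. q (inv (elem_map s (k - 1) T) (elem_map s k T' x))) \<in> poly_space (kind s) (pdeg s k)"
        using T(3)[OF q(1)] poly_space_mono[OF le] by blast
    qed
  qed
  then show ?thesis by (auto simp: dg_space_def injection_def)
qed

lemma injection_add: "injection s k (\<lambda>x. u x + v x) = (\<lambda>x. injection s k u x + injection s k v x)"
  and injection_scale: "injection s k (\<lambda>x. c *\<^sub>R v x) = (\<lambda>x. c *\<^sub>R injection s k v x)"
  and injection_diff: "injection s k (\<lambda>x. u x - v x) = (\<lambda>x. injection s k u x - injection s k v x)"
  by (auto simp: injection_def)

lemma prolong_to_top_injection:
  assumes k: "k \<in> {2..levels s}"
  shows "prolong_to_top s (k - 1) v = prolong_to_top s k (injection s k v)"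
proof -
  have "[Suc (k - 1)..<Suc (levels s)] = k # [Suc k..<Suc (levels s)]"
    using k by (subst upt_conv_Cons) auto
  then show ?thesis by (simp add: prolong_to_top_def)
qed

lemma prolong_to_top_mem:
  assumes "k \<in> {1..levels s}" "v \<in> dg_space s k"
  shows "prolong_to_top s k v \<in> dg_space s (levels s)"
proof -
  have "1 \<le> k" "k \<le> levels s" using assms by auto
  from this(2,1) show ?thesis
    using assms(2)
  proof (induction k arbitrary: v rule: inc_induct)
    case (step m)
    then show ?case
      using prolong_to_top_injection[of "Suc m" v] injection_mem[of "Suc m" v] by simp
  qed (simp add: prolong_to_top_def)
qed

lemma prolong_to_top_linear:
  "prolong_to_top s k (\<lambda>x. u x + v x) = (\<lambda>x. prolong_to_top s k u x + prolong_to_top s k v x)"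
  "prolong_to_top s k (\<lambda>x. c *\<^sub>R v x) = (\<lambda>x. c *\<^sub>R prolong_to_top s k v x)"
proof -
  have "fold (injection s) js (\<lambda>x. u x + v x)
      = (\<lambda>x. fold (injection s) js u x + fold (injection s) js v x)" for js
    by (induction js arbitrary: u v) (simp_all add: injection_add)
  then show "prolong_to_top s k (\<lambda>x. u x + v x)
      = (\<lambda>x. prolong_to_top s k u x + prolong_to_top s k v x)" by (simp add: prolong_to_top_def)
  have "fold (injection s) js (\<lambda>x. c *\<^sub>R v x) = (\<lambda>x. c *\<^sub>R fold (injection s) js v x)" for js
    by (induction js arbitrary: v) (simp_all del: real_scaleR_def add: injection_scale)
  then show "prolong_to_top s k (\<lambda>x. c *\<^sub>R v x) = (\<lambda>x. c *\<^sub>R prolong_to_top s k v x)"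
    by (simp add: prolong_to_top_def)
qed

end

section \<open>Piecewise continuous integrands\<close>

lemma integrable_lborel_imp_lebesgue_on:
  fixes f :: "'a::euclidean_space \<Rightarrow> 'b::{banach, second_countable_topology}"
  assumes "S \<in> sets lebesgue" "integrable lborel (\<lambda>x. indicator S x *\<^sub>R f x)"
  shows "integrable (lebesgue_on S) f"
  using assms by (subst integrable_restrict_space) (auto simp: integrable_completion)

lemma integrable_on_compact:
  fixes f :: "'a::euclidean_space \<Rightarrow> 'b::{banach, second_countable_topology}"
  assumes "compact S" "continuous_on S f"
  shows "integrable (lebesgue_on S) f"
  using assms borel_compact[OF assms(1)]
  by (intro integrable_lborel_imp_lebesgue_on borel_integrable_compact) auto

text \<open>
  Extensibility beyond the cell provides the traces on its boundary; vanishing off the cells makes the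
  integral over the domain the sum of the integrals over the cells.
\<close>

definition piecewise_continuous :: "'a::topological_space set set \<Rightarrow> ('a \<Rightarrow> 'b::real_normed_vector) \<Rightarrow> bool" where
  "piecewise_continuous M f \<longleftrightarrow>
     (\<forall>T\<in>M. \<exists>g. continuous_on UNIV g \<and> (\<forall>x\<in>T. f x = g x)) \<and> (\<forall>x. x \<notin> \<Union>M \<longrightarrow> f x = 0)"

lemma piecewise_continuous_binop:
  fixes f :: "'a::topological_space \<Rightarrow> 'b::real_normed_vector" and g :: "'a \<Rightarrow> 'c::real_normed_vector"
    and h :: "'b \<Rightarrow> 'c \<Rightarrow> 'd::real_normed_vector"
  assumes f: "piecewise_continuous M f" and g: "piecewise_continuous M g"
    and h: "\<And>(u :: 'a \<Rightarrow> 'b) (v :: 'a \<Rightarrow> 'c). continuous_on UNIV u \<Longrightarrow> continuous_on UNIV v \<Longrightarrow> continuous_on UNIV (\<lambda>x. h (u x) (v x))"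
    and h0: "h 0 0 = 0"
  shows "piecewise_continuous M (\<lambda>x. h (f x) (g x))"
  unfolding piecewise_continuous_def
proof (intro conjI ballI allI impI)
  fix T assume "T \<in> M"
  then obtain u v where "continuous_on UNIV u" "\<forall>x\<in>T. f x = u x" "continuous_on UNIV v" "\<forall>x\<in>T. g x = v x"
    using f g unfolding piecewise_continuous_def by blast
  then show "\<exists>w. continuous_on UNIV w \<and> (\<forall>x\<in>T. h (f x) (g x) = w x)"
    by (intro exI[of _ "\<lambda>x. h (u x) (v x)"] conjI h) simp_all
next
  fix x assume "x \<notin> \<Union>M"
  then show "h (f x) (g x) = 0" using f g h0 by (simp add: piecewise_continuous_def)
qed

lemma piecewise_continuous_inner:
  "piecewise_continuous M f \<Longrightarrow> piecewise_continuous M g \<Longrightarrow> piecewise_continuous M (\<lambda>x. f x \<bullet> g x)"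
  by (rule piecewise_continuous_binop) (auto intro: continuous_intros)

definition cells :: "'a::euclidean_space set \<Rightarrow> 'a set set \<Rightarrow> bool" where
  "cells S M \<longleftrightarrow> open S \<and> finite M \<and> pairwise disjnt M \<and> (\<forall>T\<in>M. open T \<and> bounded T \<and> T \<subseteq> S)"

lemma piecewise_continuous_integrable:
  fixes f :: "'a::euclidean_space \<Rightarrow> 'b::{banach, second_countable_topology}"
  assumes M: "cells S M" and f: "piecewise_continuous M f"
  shows "integrable (lebesgue_on S) f"
proof (rule integrable_lborel_imp_lebesgue_on)
  show "S \<in> sets lebesgue" using M by (auto simp: cells_def)
  obtain g where g: "\<And>T. T \<in> M \<Longrightarrow> continuous_on UNIV (g T)" "\<And>T x. T \<in> M \<Longrightarrow> x \<in> T \<Longrightarrow> f x = g T x"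
    using f unfolding piecewise_continuous_def by metis
  have "indicator S x *\<^sub>R f x = (\<Sum>T\<in>M. indicator T x *\<^sub>R (indicator (closure T) x *\<^sub>R g T x))" for x
  proof (cases "x \<in> \<Union>M")
    case True
    then obtain U where U: "U \<in> M" "x \<in> U" by blast
    have "x \<notin> T" if "T \<in> M" "T \<noteq> U" for T
      using M that U pairwiseD[of disjnt M T U] by (auto simp: cells_def disjnt_iff)
    then have "indicator T x *\<^sub>R (indicator (closure T) x *\<^sub>R g T x) = (if T = U then f x else 0)"
      if "T \<in> M" for T
      using that U g(2) closure_subset[of U] by (auto simp: indicator_def)
    then have "(\<Sum>T\<in>M. indicator T x *\<^sub>R (indicator (closure T) x *\<^sub>R g T x))
        = (\<Sum>T\<in>M. if T = U then f x else 0)" by (intro sum.cong) auto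
    also have "\<dots> = f x" using M U by (simp add: cells_def)
    also have "\<dots> = indicator S x *\<^sub>R f x" using M U by (auto simp: cells_def indicator_def)
    finally show ?thesis by simp
  next
    case False
    then have "f x = 0" using f by (simp add: piecewise_continuous_def)
    have "indicator T x *\<^sub>R (indicator (closure T) x *\<^sub>R g T x) = 0" if "T \<in> M" for T
      using that False by (auto simp: indicator_def)
    then have "(\<Sum>T\<in>M. indicator T x *\<^sub>R (indicator (closure T) x *\<^sub>R g T x)) = 0"
      by (intro sum.neutral) blast
    then show ?thesis using \<open>f x = 0\<close> by simp
  qed
  moreover have "integrable lborel (\<lambda>x. indicator T x *\<^sub>R (indicator (closure T) x *\<^sub>R g T x))" if T: "T \<in> M" for T
  proof (rule integrable_mult_indicator)
    show "T \<in> sets lborel" using M T by (simp add: cells_def)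
    show "integrable lborel (\<lambda>x. indicator (closure T) x *\<^sub>R g T x)"
      using M T continuous_on_subset[OF g(1)[OF T]]
      by (intro borel_integrable_compact) (auto simp: cells_def)
  qed
  ultimately show "integrable lborel (\<lambda>x. indicator S x *\<^sub>R f x)" by simp
qed

text \<open>
  The set of points of a cell where the function is nonzero is open and negligible, hence empty.
\<close>

lemma piecewise_continuous_integral_eq_0:
  fixes f :: "'a::euclidean_space \<Rightarrow> real"
  assumes M: "cells S M" and f: "piecewise_continuous M f"
    and nonneg: "\<And>x. 0 \<le> f x" and int: "(\<integral>x. f x \<partial>lebesgue_on S) = 0"
  shows "f x = 0"
proof (cases "x \<in> \<Union>M")
  case True
  then obtain T where T: "T \<in> M" "x \<in> T" by blast
  obtain g where g: "continuous_on UNIV g" "\<And>x. x \<in> T \<Longrightarrow> f x = g x"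
    using f T unfolding piecewise_continuous_def by blast
  have S: "S \<in> sets lebesgue" "T \<subseteq> S" "open T" using M T by (auto simp: cells_def)
  have "AE x in lebesgue_on S. f x = 0"
    using int nonneg
    by (subst (asm) integral_nonneg_eq_0_iff_AE[OF piecewise_continuous_integrable[OF M f]]) auto
  then have "AE x in lebesgue. x \<in> S \<longrightarrow> f x = 0" using S by (simp add: AE_restrict_space_iff)
  then obtain N where N: "negligible N" "{x. \<not> (x \<in> S \<longrightarrow> f x = 0)} \<subseteq> N"
    unfolding eventually_ae_filter_negligible by blast
  let ?U = "T \<inter> g -` (- {0})"
  have "open ?U" using g(1) S(3) by (intro open_Int open_vimage) auto
  moreover have "?U \<subseteq> N" using N(2) S(2) g(2) by auto
  ultimately have "?U = {}" using N(1) open_not_negligible negligible_subset by metis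
  then show ?thesis using T(2) g(2)[OF T(2)] by auto
next
  case False
  then show ?thesis using f by (simp add: piecewise_continuous_def)
qed

section \<open>Regularity of discrete functions\<close>

definition C1_function :: "('a::real_inner \<Rightarrow> real) \<Rightarrow> bool" where
  "C1_function q \<longleftrightarrow> (\<exists>g. continuous_on UNIV g \<and> (\<forall>x. GDERIV q x :> g x))"

lemma C1_function_continuous: "C1_function q \<Longrightarrow> continuous_on UNIV q"
  unfolding C1_function_def gderiv_def
  by (intro continuous_at_imp_continuous_on ballI) (blast intro: has_derivative_continuous)

lemma C1_function_const: "C1_function (\<lambda>x. c)"
  unfolding C1_function_def by (intro exI[of _ "\<lambda>_. 0"]) (auto intro: GDERIV_const)

lemma C1_function_add: "C1_function p \<Longrightarrow> C1_function q \<Longrightarrow> C1_function (\<lambda>x. p x + q x)"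
  unfolding C1_function_def
proof (elim exE conjE)
  fix g h assume "continuous_on UNIV g" "\<forall>x. GDERIV p x :> g x" "continuous_on UNIV h" "\<forall>x. GDERIV q x :> h x"
  then show "\<exists>g. continuous_on UNIV g \<and> (\<forall>x. GDERIV (\<lambda>x. p x + q x) x :> g x)"
    by (intro exI[of _ "\<lambda>x. g x + h x"]) (auto intro: continuous_intros GDERIV_add)
qed

lemma C1_function_mult:
  assumes "C1_function p" "C1_function q" shows "C1_function (\<lambda>x. p x * q x)"
proof -
  obtain g h where "continuous_on UNIV g" "\<forall>x. GDERIV p x :> g x"
    "continuous_on UNIV h" "\<forall>x. GDERIV q x :> h x"
    using assms unfolding C1_function_def by blast
  then show ?thesis
    unfolding C1_function_def
    using C1_function_continuous[OF assms(1)] C1_function_continuous[OF assms(2)]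
    by (intro exI[of _ "\<lambda>x. p x *\<^sub>R h x + q x *\<^sub>R g x"]) (auto intro: continuous_intros GDERIV_mult)
qed

lemma C1_function_sum: "(\<And>i. i \<in> I \<Longrightarrow> C1_function (f i)) \<Longrightarrow> C1_function (\<lambda>x. \<Sum>i\<in>I. f i x)"
  by (induction I rule: infinite_finite_induct) (auto intro: C1_function_const C1_function_add)

lemma C1_function_prod: "(\<And>i. i \<in> I \<Longrightarrow> C1_function (f i)) \<Longrightarrow> C1_function (\<lambda>x. \<Prod>i\<in>I. f i x)"
  by (induction I rule: infinite_finite_induct) (auto intro: C1_function_const C1_function_mult)

lemma C1_function_power: "C1_function f \<Longrightarrow> C1_function (\<lambda>x. f x ^ m)"
  by (induction m) (auto intro: C1_function_const C1_function_mult)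

lemma C1_function_coordinate: "C1_function (\<lambda>x::real^'n. x $ i)"
  unfolding C1_function_def gderiv_def
  by (intro exI[of _ "\<lambda>_. axis i 1"])
    (auto simp: inner_axis intro!: bounded_linear_imp_has_derivative bounded_linear_vec_nth)

lemma C1_function_poly_affine:
  fixes F :: "real^'n::finite \<Rightarrow> real^'n"
  assumes q: "q \<in> poly_space c p" and F: "affine_iso F"
  shows "C1_function (\<lambda>x. q (F x))"
proof -
  obtain b where q: "q = (\<lambda>x. \<Sum>a\<in>exponents c p. b a * (\<Prod>i\<in>UNIV. (x $ i) ^ a i))"
    using q unfolding poly_space_def by blast
  obtain B d where F: "F = (\<lambda>x. B *v x + d)" using F unfolding affine_iso_def by blast
  show ?thesis
    unfolding q F matrix_vector_mult_def
    by (simp, intro C1_function_sum C1_function_mult C1_function_const C1_function_prod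
        C1_function_power C1_function_add C1_function_coordinate)
qed

context dg_hierarchy
begin

lemma cells_mesh: "k \<in> {1..levels s} \<Longrightarrow> cells \<Omega> (mesh s k)"
  using partition[of k] domain element_open[of k] element_bounded[of k]
  by (auto simp: cells_def partition_of_domain_def polyhedral_domain_def)

lemma dg_space_C1_extension:
  assumes k: "k \<in> {1..levels s}" and v: "v \<in> dg_space s k" and T: "T \<in> mesh s k"
  shows "\<exists>q. C1_function q \<and> (\<forall>x\<in>T. v x = q x)"
proof -
  obtain q where q: "q \<in> poly_space (kind s) (pdeg s k)"
      "\<And>x. x \<in> ref_elem (kind s) \<Longrightarrow> v (elem_map s k T x) = q x"
    using v T unfolding dg_space_def by blast
  have "v x = q (inv (elem_map s k T) x)" if "x \<in> T" for x
    using q(2)[OF inv_elem_map_mem[OF k T that]] unfolding inv_elem_map(2)[OF k T] .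
  moreover have "C1_function (\<lambda>x. q (inv (elem_map s k T) x))"
    by (rule C1_function_poly_affine[OF q(1) affine_iso_inv(1)[OF elem_map_affine[OF k T]]])
  ultimately show ?thesis by blast
qed

lemma dg_space_piecewise_continuous:
  assumes k: "k \<in> {1..levels s}" and v: "v \<in> dg_space s k"
  shows "piecewise_continuous (mesh s k) v"
  unfolding piecewise_continuous_def
  using dg_space_C1_extension[OF assms] C1_function_continuous v
  by (fastforce simp: dg_space_def)

section \<open>Coordinates in the discrete spaces\<close>

lemma poly_space_eq_combinations_ref_basis:
  assumes "k \<in> {1..levels s}"
  shows "poly_space (kind s) (pdeg s k)
    = combinations {..<length (ref_basis s k)} (\<lambda>j. ref_basis s k ! j)"
  using basis assms by (auto simp: orthonormal_ref_basis_def Let_def combinations_def)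

lemma ref_basis_orthonormal:
  assumes "k \<in> {1..levels s}" "i < length (ref_basis s k)" "j < length (ref_basis s k)"
  shows "(\<integral>x. (ref_basis s k ! i) x * (ref_basis s k ! j) x \<partial>lebesgue_on (ref_elem (kind s)))
    = (if i = j then 1 else 0)"
  using basis assms by (auto simp: orthonormal_ref_basis_def Let_def)

text \<open>
  The expansion coefficients are recovered by integrating against the orthonormal basis functions.
\<close>

lemma ref_basis_independent:
  assumes k: "k \<in> {1..levels s}"
    and zero: "\<And>x. x \<in> ref_elem (kind s) \<Longrightarrow> (\<Sum>j<length (ref_basis s k). c j * (ref_basis s k ! j) x) = 0"
    and i: "i < length (ref_basis s k)"
  shows "c i = 0"
proof -
  let ?B = "ref_basis s k" and ?R = "ref_elem (kind s) :: (real^'n) set"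
  have int: "integrable (lebesgue_on ?R) (\<lambda>x. (?B ! i) x * (?B ! j) x)" if j: "j < length ?B" for j
  proof -
    have cont: "continuous_on UNIV (?B ! j)" if "j < length ?B" for j
    proof -
      have "affine_iso (\<lambda>x::real^'n. mat 1 *v x + 0)"
        unfolding affine_iso_def invertible_def
        by (intro exI[of _ "mat 1"] exI[of _ 0]) auto
      moreover have "?B ! j \<in> poly_space (kind s) (pdeg s k)"
        unfolding poly_space_eq_combinations_ref_basis[OF k]
        by (rule generator_in_combinations) (use that in auto)
      ultimately show ?thesis
        using C1_function_continuous[OF C1_function_poly_affine] by fastforce
    qed
    have "integrable (lebesgue_on ?R) (\<lambda>x. indicator ?R x *\<^sub>R ((?B ! i) x * (?B ! j) x))"
      by (rule piecewise_continuous_integrable[of _ "{?R}"])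
        (use ref_elem_properties[where 'n = 'n] cont[OF i] cont[OF j] in
          \<open>auto simp: cells_def piecewise_continuous_def intro!: continuous_intros
            exI[of _ "\<lambda>x. (?B ! i) x * (?B ! j) x"]\<close>)
    moreover have "integrable (lebesgue_on ?R) (\<lambda>x. indicator ?R x *\<^sub>R ((?B ! i) x * (?B ! j) x))
        \<longleftrightarrow> integrable (lebesgue_on ?R) (\<lambda>x. (?B ! i) x * (?B ! j) x)"
      by (rule Bochner_Integration.integrable_cong[OF refl]) (simp add: space_restrict_space)
    ultimately show ?thesis by blast
  qed
  have "0 = (\<integral>x. (\<Sum>j<length ?B. c j * (?B ! j) x) * (?B ! i) x \<partial>lebesgue_on ?R)"
    using zero by (intro integral_eq_zero_AE[symmetric] AE_I2) (simp add: space_restrict_space)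
  also have "\<dots> = (\<integral>x. (\<Sum>j<length ?B. c j * ((?B ! i) x * (?B ! j) x)) \<partial>lebesgue_on ?R)"
    by (simp add: sum_distrib_left sum_distrib_right mult_ac)
  also have "\<dots> = (\<Sum>j<length ?B. \<integral>x. c j * ((?B ! i) x * (?B ! j) x) \<partial>lebesgue_on ?R)"
    using int by (intro Bochner_Integration.integral_sum) auto
  also have "\<dots> = (\<Sum>j<length ?B. c j * (if i = j then 1 else 0))"
    by (intro sum.cong) (auto simp: ref_basis_orthonormal[OF k i])
  also have "\<dots> = c i" using i by (simp add: if_distrib[of "\<lambda>r. _ * r"] cong: if_cong)
  finally show ?thesis by simp
qed

lemma finite_basis_index: "k \<in> {1..levels s} \<Longrightarrow> finite (basis_index s k)"
  by (simp add: basis_index_def finite_mesh)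

lemma combination_on_element:
  assumes k: "k \<in> {1..levels s}" and T: "T \<in> mesh s k" and x: "x \<in> T"
  shows "(\<Sum>i\<in>basis_index s k. c i *\<^sub>R basis_fun s k i x)
    = (\<Sum>j<length (ref_basis s k). c (T, j) * (ref_basis s k ! j) (inv (elem_map s k T) x))"
proof -
  have notin: "x \<notin> U" if "U \<in> mesh s k" "U \<noteq> T" for U
    using element_unique[OF k T that(1) x] that(2) by blast
  have "(\<Sum>i\<in>basis_index s k. c i *\<^sub>R basis_fun s k i x)
    = (\<Sum>U\<in>mesh s k. \<Sum>j<length (ref_basis s k). c (U, j) *\<^sub>R basis_fun s k (U, j) x)"
    by (simp add: basis_index_def sum.cartesian_product split_def)
  also have "\<dots> = (\<Sum>U\<in>mesh s k. if U = T then
      (\<Sum>j<length (ref_basis s k). c (T, j) * (ref_basis s k ! j) (inv (elem_map s k T) x)) else 0)"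
    using notin x by (intro sum.cong) (auto simp: basis_fun_def)
  finally show ?thesis using T finite_mesh[OF k] by simp
qed

lemma basis_fun_mem:
  assumes k: "k \<in> {1..levels s}" and i: "i \<in> basis_index s k"
  shows "basis_fun s k i \<in> dg_space s k"
proof -
  interpret P: function_space "poly_space (kind s) (pdeg s k)" by (rule function_space_poly_space)
  obtain T j where Tj: "i = (T, j)" "T \<in> mesh s k" "j < length (ref_basis s k)"
    using i by (auto simp: basis_index_def)
  have "\<exists>q\<in>poly_space (kind s) (pdeg s k). \<forall>x\<in>ref_elem (kind s). basis_fun s k i (elem_map s k U x) = q x"
    if U: "U \<in> mesh s k" for U
  proof (cases "U = T")
    case True
    have "ref_basis s k ! j \<in> poly_space (kind s) (pdeg s k)"
      unfolding poly_space_eq_combinations_ref_basis[OF k]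
      by (rule generator_in_combinations) (use Tj in auto)
    then show ?thesis
      using Tj True elem_map_mem[OF k U] inv_elem_map(1)[OF k U]
      by (intro bexI[of _ "ref_basis s k ! j"]) (auto simp: basis_fun_def)
  next
    case False
    have "elem_map s k U x \<notin> T" if "x \<in> ref_elem (kind s)" for x
      using element_unique[OF k U Tj(2) elem_map_mem[OF k U that]] False by blast
    then show ?thesis using P.zero Tj by (intro bexI[of _ "\<lambda>x. 0"]) (auto simp: basis_fun_def)
  qed
  then show ?thesis using Tj by (auto simp: dg_space_def basis_fun_def)
qed

lemma dg_space_eq_combinations:
  assumes k: "k \<in> {1..levels s}"
  shows "dg_space s k = combinations (basis_index s k) (basis_fun s k)"
proof
  show "combinations (basis_index s k) (basis_fun s k) \<subseteq> dg_space s k"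
    by (rule combinations_subset[OF function_space_dg_space basis_fun_mem[OF k]])
next
  show "dg_space s k \<subseteq> combinations (basis_index s k) (basis_fun s k)"
  proof
    fix v assume v: "v \<in> dg_space s k"
    let ?n = "length (ref_basis s k)"
    have "\<exists>c. \<forall>x\<in>T. v x = (\<Sum>j<?n. c j * (ref_basis s k ! j) (inv (elem_map s k T) x))"
      if T: "T \<in> mesh s k" for T
    proof -
      obtain q where q: "q \<in> poly_space (kind s) (pdeg s k)"
        "\<And>x. x \<in> ref_elem (kind s) \<Longrightarrow> v (elem_map s k T x) = q x"
        using v T unfolding dg_space_def by blast
      obtain c where "q = (\<lambda>x. \<Sum>j<?n. c j *\<^sub>R (ref_basis s k ! j) x)"
        using q(1) unfolding poly_space_eq_combinations_ref_basis[OF k] combinations_def by blast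
      moreover have "v x = q (inv (elem_map s k T) x)" if "x \<in> T" for x
        using q(2)[OF inv_elem_map_mem[OF k T that]] unfolding inv_elem_map(2)[OF k T] .
      ultimately show ?thesis by (intro exI[of _ c]) simp
    qed
    then obtain c where c: "\<And>T x. T \<in> mesh s k \<Longrightarrow> x \<in> T \<Longrightarrow>
        v x = (\<Sum>j<?n. c T j * (ref_basis s k ! j) (inv (elem_map s k T) x))" by metis
    have "v x = (\<Sum>i\<in>basis_index s k. (case i of (T, j) \<Rightarrow> c T j) *\<^sub>R basis_fun s k i x)" for x
    proof (cases "x \<in> \<Union>(mesh s k)")
      case True
      then obtain T where T: "T \<in> mesh s k" "x \<in> T" by blast
      then show ?thesis using c[OF T] by (simp only: combination_on_element[OF k T] prod.case)
    next
      case False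
      then have "basis_fun s k i x = 0" if "i \<in> basis_index s k" for i
        using that by (auto simp: basis_index_def basis_fun_def)
      then show ?thesis using False v by (simp add: dg_space_def)
    qed
    then show "v \<in> combinations (basis_index s k) (basis_fun s k)"
      unfolding combinations_def mem_Collect_eq by (intro exI[of _ "\<lambda>(T, j). c T j"] ext)
  qed
qed

lemma basis_fun_independent:
  assumes k: "k \<in> {1..levels s}" and zero: "\<And>x. (\<Sum>i\<in>basis_index s k. c i *\<^sub>R basis_fun s k i x) = 0"
    and i: "i \<in> basis_index s k"
  shows "c i = 0"
proof -
  obtain T j where Tj: "i = (T, j)" "T \<in> mesh s k" "j < length (ref_basis s k)"
    using i by (auto simp: basis_index_def)
  have "(\<Sum>j<length (ref_basis s k). c (T, j) * (ref_basis s k ! j) x) = 0" if "x \<in> ref_elem (kind s)" for x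
    using combination_on_element[OF k Tj(2) elem_map_mem[OF k Tj(2) that], of c] zero
      inv_elem_map(1)[OF k Tj(2)] by simp
  from ref_basis_independent[OF k this Tj(3)] show ?thesis using Tj(1) by simp
qed

lemma coeffs_eqI:
  assumes k: "k \<in> {1..levels s}" and c0: "\<And>i. i \<notin> basis_index s k \<Longrightarrow> c i = 0"
    and v: "v = (\<lambda>x. \<Sum>i\<in>basis_index s k. c i *\<^sub>R basis_fun s k i x)"
  shows "coeffs s k v = c"
  unfolding coeffs_def
proof (rule the_equality)
  show "(\<forall>i. i \<notin> basis_index s k \<longrightarrow> c i = 0) \<and> v = (\<lambda>x. \<Sum>i\<in>basis_index s k. c i * basis_fun s k i x)"
    using c0 v by simp
next
  fix d assume d: "(\<forall>i. i \<notin> basis_index s k \<longrightarrow> d i = 0) \<and>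
    v = (\<lambda>x. \<Sum>i\<in>basis_index s k. d i * basis_fun s k i x)"
  have "(\<Sum>i\<in>basis_index s k. (d i - c i) *\<^sub>R basis_fun s k i x) = 0" for x
  proof -
    have "(\<Sum>i\<in>basis_index s k. d i * basis_fun s k i x) = (\<Sum>i\<in>basis_index s k. c i * basis_fun s k i x)"
      using d v by (simp add: fun_eq_iff)
    then show ?thesis by (simp add: left_diff_distrib sum_subtractf)
  qed
  from basis_fun_independent[OF k this] have "d i = c i" for i
    using c0[of i] conjunct1[OF d, rule_format, of i]
    by (cases "i \<in> basis_index s k") auto
  then show "d = c" ..
qed

lemma coeffs_expansion:
  assumes k: "k \<in> {1..levels s}" and v: "v \<in> dg_space s k"
  shows "i \<notin> basis_index s k \<Longrightarrow> coeffs s k v i = 0"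
    and "v = (\<lambda>x. \<Sum>i\<in>basis_index s k. coeffs s k v i *\<^sub>R basis_fun s k i x)"
proof -
  obtain c where c: "v = (\<lambda>x. \<Sum>i\<in>basis_index s k. c i *\<^sub>R basis_fun s k i x)"
    using v unfolding dg_space_eq_combinations[OF k] combinations_def by blast
  let ?c = "\<lambda>i. if i \<in> basis_index s k then c i else 0"
  have c': "v = (\<lambda>x. \<Sum>i\<in>basis_index s k. ?c i *\<^sub>R basis_fun s k i x)" using c by simp
  have eq: "coeffs s k v = ?c" by (rule coeffs_eqI[OF k _ c']) simp
  show "i \<notin> basis_index s k \<Longrightarrow> coeffs s k v i = 0" by (simp add: eq)
  show "v = (\<lambda>x. \<Sum>i\<in>basis_index s k. coeffs s k v i *\<^sub>R basis_fun s k i x)"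
    unfolding eq by (rule c')
qed

lemma coeffs_add:
  assumes k: "k \<in> {1..levels s}" and u: "u \<in> dg_space s k" and v: "v \<in> dg_space s k"
  shows "coeffs s k (\<lambda>x. u x + v x) = (\<lambda>i. coeffs s k u i + coeffs s k v i)"
proof (rule coeffs_eqI[OF k])
  show "(\<lambda>x. u x + v x)
      = (\<lambda>x. \<Sum>i\<in>basis_index s k. (coeffs s k u i + coeffs s k v i) *\<^sub>R basis_fun s k i x)"
    by (subst coeffs_expansion(2)[OF k u], subst coeffs_expansion(2)[OF k v]) (simp add: distrib_right sum.distrib)
qed (simp add: coeffs_expansion(1)[OF k u] coeffs_expansion(1)[OF k v])

lemma coeffs_scale:
  assumes k: "k \<in> {1..levels s}" and v: "v \<in> dg_space s k"
  shows "coeffs s k (\<lambda>x. a *\<^sub>R v x) = (\<lambda>i. a * coeffs s k v i)"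
proof (rule coeffs_eqI[OF k])
  show "(\<lambda>x. a *\<^sub>R v x) = (\<lambda>x. \<Sum>i\<in>basis_index s k. (a * coeffs s k v i) *\<^sub>R basis_fun s k i x)"
    by (subst coeffs_expansion(2)[OF k v]) (simp add: sum_distrib_left mult.assoc)
qed (simp add: coeffs_expansion(1)[OF k v])

lemma mesh_size_pos: "0 < mesh_size s k"
proof -
  have 1: "1 \<in> {1..levels s}" using levels_ge_1 by simp
  obtain T where T: "T \<in> mesh s 1" using mesh_nonempty[OF 1] by blast
  obtain x r where xr: "0 < r" "ball x r \<subseteq> T" using hierarchy T unfolding mesh_hierarchy_def by meson
  have "2 * r = diameter (ball x r)" using xr(1) by simp
  also have "\<dots> \<le> diameter T" by (rule diameter_subset[OF xr(2) element_bounded[OF 1 T]])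
  also have "\<dots> \<le> Max (diameter ` mesh s 1)" using finite_mesh[OF 1] T by simp
  finally show ?thesis using xr(1) by (simp add: mesh_size_def)
qed

lemma level_inner_psd:
  assumes k: "k \<in> {1..levels s}" shows "psd_form (dg_space s k) (level_inner s k)"
proof -
  interpret V: function_space "dg_space s k" by (rule function_space_dg_space)
  show ?thesis
  proof
    show "level_inner s k u v = level_inner s k v u" for u v
      by (simp add: level_inner_def mult.commute)
    show "level_inner s k (\<lambda>x. u x + v x) w = level_inner s k u w + level_inner s k v w"
      if "u \<in> dg_space s k" "v \<in> dg_space s k" for u v w
      by (simp add: level_inner_def coeffs_add[OF k that] distrib_right distrib_left sum.distrib)
    show "level_inner s k (\<lambda>x. c *\<^sub>R u x) w = c * level_inner s k u w"
      if "u \<in> dg_space s k" for u w c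
      by (simp add: level_inner_def coeffs_scale[OF k that, unfolded real_scaleR_def] sum_distrib_left mult_ac)
    show "0 \<le> level_inner s k v v" for v
      using mesh_size_pos[of k] unfolding level_inner_def 
      by (simp add: sum_nonneg)
  qed
qed

lemma level_inner_definite:
  assumes k: "k \<in> {1..levels s}" and v: "v \<in> dg_space s k" and 0: "level_inner s k v v = 0"
  shows "v = (\<lambda>x. 0)"
proof -
  have "(\<Sum>i\<in>basis_index s k. coeffs s k v i * coeffs s k v i) = 0"
    using 0 mesh_size_pos[of k] by (simp add: level_inner_def)
  then have "\<forall>i\<in>basis_index s k. coeffs s k v i = 0"
    by (subst (asm) sum_nonneg_eq_0_iff[OF finite_basis_index[OF k]]) auto
  then show ?thesis by (subst coeffs_expansion(2)[OF k v]) simp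
qed

end

section \<open>Face integrals and traces\<close>

lemma piecewise_continuous_extension:
  assumes "piecewise_continuous M f" "T \<in> M"
  obtains g where "continuous_on UNIV g" "\<And>x. x \<in> T \<Longrightarrow> f x = g x"
proof -
  have "\<exists>g. continuous_on UNIV g \<and> (\<forall>x\<in>T. f x = g x)"
    using assms unfolding piecewise_continuous_def by (elim conjE) (rule bspec)
  then show thesis using that by (elim exE conjE) simp
qed

text \<open>
  A hyperplane separating the element from the convex set \<open>G\<close> contains \<open>G\<close>, because \<open>G\<close> lies in
  the closure of the element.  As \<open>F\<close> spans this hyperplane, the normal is unique up to its sign,
  which the element determines.  For an interior face, \<open>G\<close> is the intersection of the two closures; for
  a boundary face it is the facet that contains \<open>F\<close>.
\<close>

lemma outer_normal_properties:
  fixes T G F :: "(real^'n::finite) set"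
  assumes T: "open T" "convex T" "T \<noteq> {}"
    and G: "convex G" "G \<subseteq> closure T" "G \<inter> T = {}"
    and F: "F \<subseteq> G" "aff_dim F = int CARD('n) - 1"
  shows "norm (outer_normal T F) = 1 \<and> (\<exists>c. \<forall>y\<in>F. outer_normal T F \<bullet> y = c)"
proof -
  let ?P = "\<lambda>n. norm n = 1 \<and> (\<exists>c. (\<forall>y\<in>F. n \<bullet> y = c) \<and> (\<forall>x\<in>T. n \<bullet> x < c))"
  have "F \<noteq> {}"
  proof
    assume "F = {}"
    then have "int CARD('n) = 0" using F(2) by simp
    then show False by simp
  qed
  then obtain y0 where y0: "y0 \<in> F" by blast
  have "G \<noteq> {}" using y0 F(1) by blast
  obtain a b where ab: "a \<noteq> 0" "\<forall>x\<in>T. a \<bullet> x \<le> b" "\<forall>x\<in>G. b \<le> a \<bullet> x"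
    using separating_hyperplane_sets[OF T(2) G(1) T(3) \<open>G \<noteq> {}\<close>] G(3) by blast
  have "closure T \<subseteq> {x. a \<bullet> x \<le> b}"
    using ab(2) by (intro closure_minimal closed_halfspace_le) auto
  then have eq: "a \<bullet> y = b" if "y \<in> F" for y using that F(1) G(2) ab(3) by force
  have "T \<subseteq> interior {x. a \<bullet> x \<le> b}" using ab(2) T(1) by (intro interior_maximal) auto
  then have lt: "a \<bullet> x < b" if "x \<in> T" for x using that ab(1) by auto
  have ex: "?P (a /\<^sub>R norm a)"
    using ab(1) eq lt
    by (intro conjI exI[of _ "b / norm a"]) (auto simp: field_simps)
  have unique: "n2 = n1" if n1: "?P n1" and n2: "?P n2" for n1 n2
  proof -
    obtain c1 where c1: "\<And>y. y \<in> F \<Longrightarrow> n1 \<bullet> y = c1" "\<And>x. x \<in> T \<Longrightarrow> n1 \<bullet> x < c1" using n1 by blast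
    obtain c2 where c2: "\<And>y. y \<in> F \<Longrightarrow> n2 \<bullet> y = c2" "\<And>x. x \<in> T \<Longrightarrow> n2 \<bullet> x < c2" using n2 by blast
    have hull: "affine hull F = {x. n \<bullet> x = c}"
      if "norm n = 1" "\<And>y. y \<in> F \<Longrightarrow> n \<bullet> y = c" for n :: "real^'n" and c
    proof -
      have "F \<subseteq> {x. n \<bullet> x = c}" "n \<noteq> 0" using that by auto
      then have "affine hull F = affine hull {x. n \<bullet> x = c}"
        using aff_dim_eq_full_gen[of F "{x. n \<bullet> x = c}"] F(2) by simp
      then show ?thesis by (simp add: affine_hyperplane affine_hull_eq)
    qed
    have same: "{x. n1 \<bullet> x = c1} = {x. n2 \<bullet> x = c2}"
      using hull[of n1 c1] hull[of n2 c2] n1 n2 c1(1) c2(1) by auto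
    define w where "w = n2 - (n1 \<bullet> n2) *\<^sub>R n1"
    have nn: "n1 \<bullet> n1 = 1" "n2 \<bullet> n2 = 1" using n1 n2 by (simp_all add: norm_eq_1)
    have w1: "n1 \<bullet> w = 0" by (simp add: w_def inner_diff_right nn)
    then have "n1 \<bullet> (y0 + w) = c1" using c1(1)[OF y0] by (simp add: inner_add_right)
    then have "n2 \<bullet> (y0 + w) = c2" using same by blast
    then have w2: "n2 \<bullet> w = 0" using c2(1)[OF y0] by (simp add: inner_add_right)
    have "w \<bullet> w = n2 \<bullet> w - (n1 \<bullet> n2) * (n1 \<bullet> w)" by (subst (1) w_def) (simp add: inner_diff_left)
    then have "w = 0" using w1 w2 by simp
    then have n2_eq: "n2 = (n1 \<bullet> n2) *\<^sub>R n1" by (simp add: w_def)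
    then have "(n1 \<bullet> n2) * (n1 \<bullet> n2) = 1" using nn(2) by (metis inner_scaleR_left)
    then consider "n1 \<bullet> n2 = 1" | "n1 \<bullet> n2 = -1" by (auto simp: square_eq_1_iff)
    then show ?thesis
    proof cases
      case 1 then show ?thesis using n2_eq by simp
    next
      case 2
      then have "n2 = - n1" using n2_eq by simp
      moreover obtain x where "x \<in> T" using T(3) by blast
      ultimately show ?thesis using c1(1)[OF y0] c2(1)[OF y0] c1(2)[of x] c2(2)[of x] by simp
    qed
  qed
  have "?P (outer_normal T F)"
    unfolding outer_normal_def by (rule theI[of ?P, OF ex unique[OF ex]])
  then show ?thesis by blast
qed

definition planar_face :: "(real^'n::finite) set face \<Rightarrow> bool" where
  "planar_face f \<longleftrightarrow> compact (face_set f) \<and> face_set f \<noteq> {} \<and> norm (face_normal f) = 1 \<and>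
     (\<exists>c. \<forall>y\<in>face_set f. face_normal f \<bullet> y = c)"

definition prism :: "(real^'n::finite) set face \<Rightarrow> (real^'n) set" where
  "prism f = {y + t *\<^sub>R face_normal f |y t. y \<in> face_set f \<and> t \<in> {0..1}}"

definition face_proj :: "(real^'n::finite) set face \<Rightarrow> real^'n \<Rightarrow> real^'n" where
  "face_proj f x = x - (face_normal f \<bullet> (x - (SOME a. a \<in> face_set f))) *\<^sub>R face_normal f"

lemma face_integral_eq: "face_integral f g = (\<integral>x. g (face_proj f x) \<partial>lebesgue_on (prism f))"
  by (simp add: face_integral_def prism_def face_proj_def Let_def)

text \<open>
  The projection along the normal evaluates face functions only at points of the face.  This holds
  because the normal has length 1 and a constant inner product with the points of the face; at points
  outside the closure of an element its traces would be arbitrary values.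
\<close>

lemma face_proj_mem:
  assumes f: "planar_face f" and x: "x \<in> prism f"
  shows "face_proj f x \<in> face_set f"
proof -
  let ?n = "face_normal f" and ?a = "SOME a. a \<in> face_set f"
  obtain y t where y: "y \<in> face_set f" "x = y + t *\<^sub>R ?n" using x unfolding prism_def by blast
  have "?a \<in> face_set f" using y(1) by (rule someI)
  then have "?n \<bullet> ?a = ?n \<bullet> y" using f y(1) unfolding planar_face_def by auto
  moreover have "?n \<bullet> ?n = 1" using f by (simp add: planar_face_def norm_eq_1)
  ultimately have "face_proj f x = y" by (simp add: face_proj_def y(2) inner_diff_right inner_add_right)
  then show ?thesis using y(1) by simp
qed

lemma face_integrable:
  fixes g :: "real^'n::finite \<Rightarrow> real"
  assumes f: "planar_face f" and g: "continuous_on (face_set f) g"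
  shows "integrable (lebesgue_on (prism f)) (\<lambda>x. g (face_proj f x))"
proof (rule integrable_on_compact)
  have "prism f = (\<lambda>(y, t). y + t *\<^sub>R face_normal f) ` (face_set f \<times> {0..1})"
  proof (intro set_eqI iffI)
    fix x assume "x \<in> (\<lambda>(y, t). y + t *\<^sub>R face_normal f) ` (face_set f \<times> {0..1})"
    then obtain y t where "y \<in> face_set f" "t \<in> {0..1}" "x = y + t *\<^sub>R face_normal f" by auto
    then show "x \<in> prism f" unfolding prism_def mem_Collect_eq by (intro exI[of _ y] exI[of _ t]) simp
  qed (auto simp: prism_def)
  moreover have "compact ((\<lambda>(y, t). y + t *\<^sub>R face_normal f) ` (face_set f \<times> {0..1}))"
    using f by (intro compact_continuous_image compact_Times)
      (auto simp: planar_face_def split_def intro!: continuous_intros)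
  ultimately show "compact (prism f)" by simp
  show "continuous_on (prism f) (\<lambda>x. g (face_proj f x))"
  proof (rule continuous_on_compose2[OF g])
    show "continuous_on (prism f) (face_proj f)"
      unfolding face_proj_def by (intro continuous_intros)
  qed (use face_proj_mem[OF f] in blast)
qed

lemma face_integral_cong:
  assumes "planar_face f" "\<And>y. y \<in> face_set f \<Longrightarrow> g y = h y"
  shows "face_integral f g = face_integral f h"
  unfolding face_integral_eq using face_proj_mem[OF assms(1)] assms(2)
  by (intro Bochner_Integration.integral_cong) (auto simp: space_restrict_space)

lemma face_integral_add:
  assumes "planar_face f" "continuous_on (face_set f) g" "continuous_on (face_set f) h"
  shows "face_integral f (\<lambda>y. g y + h y) = face_integral f g + face_integral f h"
  unfolding face_integral_eq using assms by (intro Bochner_Integration.integral_add face_integrable)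

lemma face_integral_scale: "face_integral f (\<lambda>y. c * g y) = c * face_integral f g"
  unfolding face_integral_eq by simp

lemma face_integral_nonneg:
  assumes "planar_face f" "\<And>y. y \<in> face_set f \<Longrightarrow> 0 \<le> g y"
  shows "0 \<le> face_integral f g"
  unfolding face_integral_eq using face_proj_mem[OF assms(1)] assms(2)
  by (intro Bochner_Integration.integral_nonneg) (auto simp: space_restrict_space)

lemma trace_eq:
  fixes T :: "(real^'n::finite) set" and v q :: "real^'n \<Rightarrow> 'b::t2_space"
  assumes T: "open T" and y: "y \<in> closure T" and q: "continuous_on UNIV q"
    and eq: "\<And>x. x \<in> T \<Longrightarrow> v x = q x"
  shows "trace T v y = q y"
  unfolding trace_def
proof (rule tendsto_Lim)
  have "y islimpt T"
    using y T interior_limit_point[of y T] by (auto simp: closure_def interior_open)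
  then show "\<not> trivial_limit (at y within T)" by (simp add: trivial_limit_within)
  have "(q \<longlongrightarrow> q y) (at y within T)"
  proof (rule tendsto_within_subset[OF _ subset_UNIV])
    show "(q \<longlongrightarrow> q y) (at y)"
      using q continuous_on_eq_continuous_at[OF open_UNIV, of q] by (simp add: isCont_def)
  qed
  then show "(v \<longlongrightarrow> q y) (at y within T)"
    by (rule Lim_transform_eventually) (auto simp: eventually_at_filter eq)
qed

lemma trace_piecewise:
  fixes u v :: "real^'n::finite \<Rightarrow> 'b::real_normed_vector"
  assumes M: "cells S M" and T: "T \<in> M" and u: "piecewise_continuous M u"
  shows "continuous_on (closure T) (trace T u)"
    and "y \<in> closure T \<Longrightarrow> trace T (\<lambda>x. c *\<^sub>R u x) y = c *\<^sub>R trace T u y"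
    and "piecewise_continuous M v \<Longrightarrow> y \<in> closure T \<Longrightarrow>
           trace T (\<lambda>x. u x + v x) y = trace T u y + trace T v y"
proof -
  have op: "open T" using M T by (simp add: cells_def)
  obtain q where q: "continuous_on UNIV q" "\<And>x. x \<in> T \<Longrightarrow> u x = q x"
    by (rule piecewise_continuous_extension[OF u T]) (rule that)
  have tu: "trace T u y = q y" if "y \<in> closure T" for y
    by (rule trace_eq[OF op that q])
  show "continuous_on (closure T) (trace T u)"
    using continuous_on_subset[OF q(1)] tu by (subst continuous_on_cong[OF refl]) auto
  show "trace T (\<lambda>x. c *\<^sub>R u x) y = c *\<^sub>R trace T u y" if "y \<in> closure T"
    unfolding tu[OF that]
    by (rule trace_eq[OF op that]) (auto simp: q(2) intro!: continuous_intros q(1))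
  show "trace T (\<lambda>x. u x + v x) y = trace T u y + trace T v y"
    if pv: "piecewise_continuous M v" and y: "y \<in> closure T"
  proof -
    obtain r where r: "continuous_on UNIV r" "\<And>x. x \<in> T \<Longrightarrow> v x = r x"
      by (rule piecewise_continuous_extension[OF pv T]) (rule that)
    have tv: "trace T v y = r y" by (rule trace_eq[OF op y r])
    show ?thesis
      unfolding tu[OF y] tv
      by (rule trace_eq[OF op y]) (auto simp: q(2) r(2) intro!: continuous_intros q(1) r(1))
  qed
qed

context dg_hierarchy
begin

lemma faces_cases:
  assumes "f \<in> faces s k"
  obtains (interior) T T' where "f = Interior T T'" "T \<in> mesh s k" "T' \<in> mesh s k" "T \<noteq> T'"
      "aff_dim (closure T \<inter> closure T') = int CARD('n) - 1"
  | (boundary) T G where "f = Boundary T (G \<inter> frontier (dom s))" "T \<in> mesh s k"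
      "G facet_of closure T" "aff_dim (G \<inter> frontier (dom s)) = int CARD('n) - 1"
  using assms by (auto simp: faces_def interior_faces_def boundary_faces_def simp del: Int_iff)

lemma planar_face:
  assumes k: "k \<in> {1..levels s}" and f: "f \<in> faces s k"
  shows "planar_face f"
  using f
proof (cases rule: faces_cases)
  case (interior T T')
  have disj: "closure T' \<inter> T = {}"
  proof -
    have "T \<inter> T' = {}" using element_unique[OF k interior(2,3)] interior(4) by fast
    then show ?thesis using open_Int_closure_eq_empty[OF element_open[OF k interior(2)], of T'] by blast
  qed
  have nonempty: "closure T \<inter> closure T' \<noteq> {}"
  proof
    assume "closure T \<inter> closure T' = {}"
    then have "int CARD('n) = 0" using interior(5) by simp
    then show False by simp
  qed
  have "norm (outer_normal T (closure T \<inter> closure T')) = 1 \<and>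
      (\<exists>c. \<forall>y\<in>closure T \<inter> closure T'. outer_normal T (closure T \<inter> closure T') \<bullet> y = c)"
    using disj interior(5)
    by (intro outer_normal_properties[of T "closure T \<inter> closure T'"])
      (auto simp: element_open[OF k interior(2)] element_convex[OF k interior(2)]
        element_convex[OF k interior(3)] element_nonempty[OF k interior(2)] intro!: convex_Int convex_closure)
  moreover have "compact (closure T \<inter> closure T')"
    using element_bounded[OF k interior(2)] by (intro compact_Int) (auto simp: compact_closure element_bounded[OF k interior(3)])
  ultimately show ?thesis using nonempty by (simp add: planar_face_def interior(1))
next
  case (boundary T G)
  define F where F: "F = G \<inter> frontier (dom s)"
  note T = element_open[OF k boundary(2)] element_convex[OF k boundary(2)] element_nonempty[OF k boundary(2)]
  have G: "G face_of closure T" "aff_dim G = aff_dim (closure T) - 1" using boundary(3) by (auto simp: facet_of_def)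
  have "G \<noteq> closure T" using G(2) by auto
  then have "G \<inter> interior (closure T) = {}" using face_of_disjoint_interior[OF G(1)] by blast
  moreover have "T \<subseteq> interior (closure T)" using T(1) by (intro interior_maximal closure_subset)
  ultimately have disj: "G \<inter> T = {}" by blast
  have compact: "compact (closure T)" using element_bounded[OF k boundary(2)] by (simp add: compact_closure)
  have "compact G"
    by (rule face_of_imp_compact[OF convex_closure[OF T(2)] compact G(1)])
  then have "compact F" unfolding F by (intro compact_Int_closed) auto
  moreover have "F \<noteq> {}"
  proof
    assume "F = {}"
    then have "int CARD('n) = 0" using boundary(4) F by simp
    then show False by simp
  qed
  moreover have "norm (outer_normal T F) = 1 \<and> (\<exists>c. \<forall>y\<in>F. outer_normal T F \<bullet> y = c)"
    by (rule outer_normal_properties[OF T face_of_imp_convex[OF G(1)] face_of_imp_subset[OF G(1)] disj])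
      (use boundary F in auto)
  ultimately show ?thesis by (simp add: planar_face_def boundary(1) F)
qed

lemma jump_Interior:
    "jump (Interior T T') v = (\<lambda>y. trace T v y *\<^sub>R outer_normal T (closure T \<inter> closure T') +
       trace T' v y *\<^sub>R outer_normal T' (closure T \<inter> closure T'))"
  and jump_Boundary: "jump (Boundary T F) v = (\<lambda>y. trace T v y *\<^sub>R outer_normal T F)"
  by (simp_all add: fun_eq_iff)

lemma
  fixes u v :: "real^'n \<Rightarrow> real"
  assumes k: "k \<in> {1..levels s}" and f: "f \<in> faces s k" and u: "piecewise_continuous (mesh s k) u"
  shows jump_continuous: "continuous_on (face_set f) (jump f u)"
    and jump_scale: "y \<in> face_set f \<Longrightarrow> jump f (\<lambda>x. c *\<^sub>R u x) y = c *\<^sub>R jump f u y"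
    and jump_add: "piecewise_continuous (mesh s k) v \<Longrightarrow> y \<in> face_set f \<Longrightarrow>
      jump f (\<lambda>x. u x + v x) y = jump f u y + jump f v y"
  using f
proof -
  note tr = trace_piecewise[OF cells_mesh[OF k] _ u, unfolded real_scaleR_def]
  have "continuous_on (face_set f) (jump f u) \<and>
    (\<forall>y\<in>face_set f. \<forall>c. jump f (\<lambda>x. c *\<^sub>R u x) y = c *\<^sub>R jump f u y) \<and>
    (\<forall>y\<in>face_set f. \<forall>v. piecewise_continuous (mesh s k) v \<longrightarrow>
      jump f (\<lambda>x. u x + v x) y = jump f u y + jump f v y)"
    using f
  proof (cases rule: faces_cases)
    case (interior T T')
    have "continuous_on (closure T \<inter> closure T') (jump f u)"
      unfolding interior(1) jump_Interior
      by (intro continuous_intros continuous_on_subset[OF tr(1)[OF interior(2)]]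
          continuous_on_subset[OF tr(1)[OF interior(3)]]) auto
    then show ?thesis
      by (auto simp: interior(1) tr(2,3)[OF interior(2)] tr(2,3)[OF interior(3)] scaleR_add_left scaleR_add_right)
  next
    case (boundary T G)
    define F where F: "F = G \<inter> frontier (dom s)"
    have "F \<subseteq> closure T" using boundary(3) by (auto simp: F facet_of_def dest: face_of_imp_subset)
    moreover have "continuous_on F (jump f u)"
      unfolding boundary(1) F[symmetric] jump_Boundary
      by (intro continuous_intros continuous_on_subset[OF tr(1)[OF boundary(2)] \<open>F \<subseteq> closure T\<close>])
    ultimately show ?thesis
      by (auto simp: boundary(1) F[symmetric] tr(2,3)[OF boundary(2)] subset_iff scaleR_add_left scaleR_add_right)
  qed
  then show "continuous_on (face_set f) (jump f u)"
    and "y \<in> face_set f \<Longrightarrow> jump f (\<lambda>x. c *\<^sub>R u x) y = c *\<^sub>R jump f u y"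
    and "piecewise_continuous (mesh s k) v \<Longrightarrow> y \<in> face_set f \<Longrightarrow>
      jump f (\<lambda>x. u x + v x) y = jump f u y + jump f v y"
    by blast+
qed

section \<open>Liftings\<close>

lemma average_Interior: "average (Interior T T') \<tau> = (\<lambda>y. (1/2) *\<^sub>R (trace T \<tau> y + trace T' \<tau> y))"
  and average_Boundary: "average (Boundary T F) \<tau> = trace T \<tau>"
  and jump_vec_Interior: "jump_vec (Interior T T') \<tau> =
    (\<lambda>y. trace T \<tau> y \<bullet> outer_normal T (closure T \<inter> closure T') +
         trace T' \<tau> y \<bullet> outer_normal T' (closure T \<inter> closure T'))"
  by (simp_all add: fun_eq_iff)

lemma average_piecewise:
  fixes u v :: "real^'n \<Rightarrow> real^'n"
  assumes k: "k \<in> {1..levels s}" and f: "f \<in> faces s k" and u: "piecewise_continuous (mesh s k) u"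
  shows average_continuous: "continuous_on (face_set f) (average f u)"
    and "y \<in> face_set f \<Longrightarrow> average f (\<lambda>x. c *\<^sub>R u x) y = c *\<^sub>R average f u y"
    and "piecewise_continuous (mesh s k) v \<Longrightarrow> y \<in> face_set f \<Longrightarrow>
      average f (\<lambda>x. u x + v x) y = average f u y + average f v y"
proof -
  note tr = trace_piecewise[OF cells_mesh[OF k] _ u]
  have "continuous_on (face_set f) (average f u) \<and>
    (\<forall>y\<in>face_set f. \<forall>c. average f (\<lambda>x. c *\<^sub>R u x) y = c *\<^sub>R average f u y) \<and>
    (\<forall>y\<in>face_set f. \<forall>v. piecewise_continuous (mesh s k) v \<longrightarrow>
      average f (\<lambda>x. u x + v x) y = average f u y + average f v y)"
    using f
  proof (cases rule: faces_cases)
    case (interior T T')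
    have "continuous_on (closure T \<inter> closure T') (average f u)"
      unfolding interior(1) average_Interior
      by (intro continuous_intros continuous_on_subset[OF tr(1)[OF interior(2)]]
          continuous_on_subset[OF tr(1)[OF interior(3)]]) auto
    then show ?thesis
      by (auto simp: interior(1) tr(2,3)[OF interior(2)] tr(2,3)[OF interior(3)] scaleR_add_right mult.commute)
  next
    case (boundary T G)
    define F where F: "F = G \<inter> frontier (dom s)"
    have "F \<subseteq> closure T" using boundary(3) by (auto simp: F facet_of_def dest: face_of_imp_subset)
    moreover have "continuous_on F (average f u)"
      unfolding boundary(1) F[symmetric] average_Boundary
      by (rule continuous_on_subset[OF tr(1)[OF boundary(2)] \<open>F \<subseteq> closure T\<close>])
    ultimately show ?thesis
      by (auto simp: boundary(1) F[symmetric] tr(2,3)[OF boundary(2)] subset_iff)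
  qed
  then show "continuous_on (face_set f) (average f u)"
    and "y \<in> face_set f \<Longrightarrow> average f (\<lambda>x. c *\<^sub>R u x) y = c *\<^sub>R average f u y"
    and "piecewise_continuous (mesh s k) v \<Longrightarrow> y \<in> face_set f \<Longrightarrow>
      average f (\<lambda>x. u x + v x) y = average f u y + average f v y"
    by blast+
qed

lemma jump_vec_piecewise:
  fixes u v :: "real^'n \<Rightarrow> real^'n"
  assumes k: "k \<in> {1..levels s}" and f: "f \<in> interior_faces s k" and u: "piecewise_continuous (mesh s k) u"
  shows jump_vec_continuous: "continuous_on (face_set f) (jump_vec f u)"
    and "y \<in> face_set f \<Longrightarrow> jump_vec f (\<lambda>x. c *\<^sub>R u x) y = c * jump_vec f u y"
    and "piecewise_continuous (mesh s k) v \<Longrightarrow> y \<in> face_set f \<Longrightarrow>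
      jump_vec f (\<lambda>x. u x + v x) y = jump_vec f u y + jump_vec f v y"
proof -
  note tr = trace_piecewise[OF cells_mesh[OF k] _ u]
  obtain T T' where T: "f = Interior T T'" "T \<in> mesh s k" "T' \<in> mesh s k"
    using f by (auto simp: interior_faces_def)
  have "continuous_on (closure T \<inter> closure T') (jump_vec f u)"
    unfolding T(1) jump_vec_Interior
    by (intro continuous_intros continuous_on_subset[OF tr(1)[OF T(2)]]
        continuous_on_subset[OF tr(1)[OF T(3)]]) auto
  then show "continuous_on (face_set f) (jump_vec f u)" by (simp add: T)
  show "jump_vec f (\<lambda>x. c *\<^sub>R u x) y = c * jump_vec f u y" if "y \<in> face_set f"
    using that by (simp add: T(1) tr(2)[OF T(2)] tr(2)[OF T(3)] distrib_left)
  show "jump_vec f (\<lambda>x. u x + v x) y = jump_vec f u y + jump_vec f v y"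
    if "piecewise_continuous (mesh s k) v" "y \<in> face_set f"
    using that by (simp add: T(1) tr(3)[OF T(2)] tr(3)[OF T(3)] inner_add_left)
qed

lemma function_space_dg_space_vec: "function_space (dg_space_vec s k)"
proof -
  interpret V: function_space "dg_space s k" by (rule function_space_dg_space)
  show ?thesis
    by unfold_locales (use V.zero V.add V.scale[unfolded real_scaleR_def] in \<open>auto simp: dg_space_vec_def\<close>)
qed

lemma dg_space_vec_piecewise_continuous:
  assumes k: "k \<in> {1..levels s}" and w: "w \<in> dg_space_vec s k"
  shows "piecewise_continuous (mesh s k) w"
  unfolding piecewise_continuous_def
proof (intro conjI ballI allI impI)
  have comp: "piecewise_continuous (mesh s k) (\<lambda>x. w x $ i)" for i
    using w by (intro dg_space_piecewise_continuous[OF k]) (simp add: dg_space_vec_def)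
  show "w x = 0" if "x \<notin> \<Union>(mesh s k)" for x
    using comp that by (simp add: piecewise_continuous_def vec_eq_iff)
  fix T assume T: "T \<in> mesh s k"
  have "\<exists>g. continuous_on UNIV g \<and> (\<forall>x\<in>T. w x $ i = g x)" for i
    using comp[of i] T unfolding piecewise_continuous_def by (elim conjE) (rule bspec)
  then obtain g where g: "\<And>i. continuous_on UNIV (g i)" "\<And>i x. x \<in> T \<Longrightarrow> w x $ i = g i x" by metis
  show "\<exists>h. continuous_on UNIV h \<and> (\<forall>x\<in>T. w x = h x)"
    using g by (intro exI[of _ "\<lambda>x. \<chi> i. g i x"]) (auto simp: vec_eq_iff intro!: continuous_on_vec_lambda)
qed

definition L2_inner :: "(real^'n \<Rightarrow> real^'n) \<Rightarrow> (real^'n \<Rightarrow> real^'n) \<Rightarrow> real" where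
  "L2_inner u v = (\<integral>x. u x \<bullet> v x \<partial>lebesgue_on (dom s))"

lemma inner_integrable:
  fixes u v :: "real^'n \<Rightarrow> real^'n"
  assumes "k \<in> {1..levels s}" "piecewise_continuous (mesh s k) u" "piecewise_continuous (mesh s k) v"
  shows "integrable (lebesgue_on (dom s)) (\<lambda>x. u x \<bullet> v x)"
  unfolding dom_eq
  by (rule piecewise_continuous_integrable[OF cells_mesh[OF assms(1)] piecewise_continuous_inner[OF assms(2,3)]])

lemma L2_inner_psd:
  assumes k: "k \<in> {1..levels s}"
  shows "psd_form (dg_space_vec s k) L2_inner"
proof -
  note pc = dg_space_vec_piecewise_continuous[OF k]
  interpret W: function_space "dg_space_vec s k" by (rule function_space_dg_space_vec)
  show ?thesis
  proof
    show "L2_inner u v = L2_inner v u" for u v by (simp add: L2_inner_def inner_commute)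
    show "L2_inner (\<lambda>x. u x + v x) w = L2_inner u w + L2_inner v w"
      if "u \<in> dg_space_vec s k" "v \<in> dg_space_vec s k" "w \<in> dg_space_vec s k" for u v w
      using that by (simp add: L2_inner_def inner_add_left inner_integrable[OF k pc pc])
    show "L2_inner (\<lambda>x. c *\<^sub>R u x) w = c * L2_inner u w" for u w c by (simp add: L2_inner_def)
    show "0 \<le> L2_inner v v" for v by (simp add: L2_inner_def)
  qed
qed

lemma L2_inner_definite:
  assumes k: "k \<in> {1..levels s}" and v: "v \<in> dg_space_vec s k" and 0: "L2_inner v v = 0"
  shows "v = (\<lambda>x. 0)"
proof
  fix x
  note pc = dg_space_vec_piecewise_continuous[OF k v]
  have "v x \<bullet> v x = 0"
    by (rule piecewise_continuous_integral_eq_0[OF cells_mesh[OF k] piecewise_continuous_inner[OF pc pc]])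
      (use 0 in \<open>auto simp: L2_inner_def dom_eq\<close>)
  then show "v x = 0" by simp
qed

lemma dg_space_vec_eq_combinations:
  assumes k: "k \<in> {1..levels s}"
  shows "dg_space_vec s k
    = combinations (basis_index s k \<times> UNIV) (\<lambda>(i, j) x. basis_fun s k i x *\<^sub>R axis j 1)"
    (is "_ = combinations ?J ?e")
proof
  interpret V: function_space "dg_space s k" by (rule function_space_dg_space)
  show "combinations ?J ?e \<subseteq> dg_space_vec s k"
  proof (rule combinations_subset[OF function_space_dg_space_vec])
    fix p assume "p \<in> ?J"
    then obtain i j where p: "p = (i, j)" "i \<in> basis_index s k" by auto
    have "(\<lambda>x. (basis_fun s k i x *\<^sub>R axis j (1::real)) $ l) \<in> dg_space s k" for l
      using V.zero basis_fun_mem[OF k p(2)] by (cases "l = j") (simp_all add: axis_def)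
    then show "?e p \<in> dg_space_vec s k" by (simp add: p(1) dg_space_vec_def)
  qed
  show "dg_space_vec s k \<subseteq> combinations ?J ?e"
  proof
    fix w assume "w \<in> dg_space_vec s k"
    then have "(\<lambda>x. w x $ j) \<in> dg_space s k" for j by (simp add: dg_space_vec_def)
    then have "\<exists>c. (\<lambda>x. w x $ j) = (\<lambda>x. \<Sum>i\<in>basis_index s k. c i *\<^sub>R basis_fun s k i x)" for j
      unfolding dg_space_eq_combinations[OF k] combinations_def by blast
    then obtain c where c: "\<And>j. (\<lambda>x. w x $ j) = (\<lambda>x. \<Sum>i\<in>basis_index s k. c j i *\<^sub>R basis_fun s k i x)"
      by metis
    have "w x = (\<Sum>p\<in>?J. (case p of (i, j) \<Rightarrow> c j i) *\<^sub>R ?e p x)" for x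
    proof -
      have "w x $ l = (\<Sum>i\<in>basis_index s k. c l i *\<^sub>R basis_fun s k i x)" for l
        using fun_cong[OF c[of l], of x] .
      then have "w x = (\<Sum>j\<in>UNIV. (\<Sum>i\<in>basis_index s k. c j i *\<^sub>R basis_fun s k i x) *\<^sub>R axis j 1)"
        by (simp add: vec_eq_iff axis_def if_distrib[of "\<lambda>r. _ * r"] cong: if_cong)
      also have "\<dots> = (\<Sum>i\<in>basis_index s k. \<Sum>j\<in>UNIV. c j i *\<^sub>R (basis_fun s k i x *\<^sub>R axis j 1))"
        by (subst sum.swap) (simp add: scaleR_sum_left)
      also have "\<dots> = (\<Sum>p\<in>?J. (case p of (i, j) \<Rightarrow> c j i) *\<^sub>R ?e p x)"
        by (simp add: sum.cartesian_product split_def)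
      finally show ?thesis .
    qed
    then show "w \<in> combinations ?J ?e" unfolding combinations_def mem_Collect_eq
      by (intro exI[of _ "\<lambda>(i, j). c j i"] ext)
  qed
qed

text \<open>
  Both liftings are instances of this representative, whose linearity in the functional follows from
  uniqueness.
\<close>

definition Riesz_vec :: "nat \<Rightarrow> ((real^'n \<Rightarrow> real^'n) \<Rightarrow> real) \<Rightarrow> real^'n \<Rightarrow> real^'n" where
  "Riesz_vec k L = (THE r. r \<in> dg_space_vec s k \<and> (\<forall>\<eta>\<in>dg_space_vec s k. L2_inner r \<eta> = L \<eta>))"

lemma Riesz_vec_unique:
  assumes k: "k \<in> {1..levels s}"
    and r: "r \<in> dg_space_vec s k" "\<And>\<eta>. \<eta> \<in> dg_space_vec s k \<Longrightarrow> L2_inner r \<eta> = L \<eta>"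
  shows "Riesz_vec k L = r"
  unfolding Riesz_vec_def
proof (rule the_equality)
  interpret W: psd_form "dg_space_vec s k" L2_inner by (rule L2_inner_psd[OF k])
  fix q assume q: "q \<in> dg_space_vec s k \<and> (\<forall>\<eta>\<in>dg_space_vec s k. L2_inner q \<eta> = L \<eta>)"
  have d: "(\<lambda>x. q x - r x) \<in> dg_space_vec s k" using W.diff q r(1) by blast
  have "L2_inner (\<lambda>x. q x - r x) (\<lambda>x. q x - r x) = 0"
    using W.diff_left[of q r "\<lambda>x. q x - r x"] q r d by simp
  then have "(\<lambda>x. q x - r x) = (\<lambda>x. 0)" by (rule L2_inner_definite[OF k d])
  then show "q = r" by (simp add: fun_eq_iff)
qed (use r in blast)

lemma Riesz_vec:
  assumes k: "k \<in> {1..levels s}" and L: "linear_functional (dg_space_vec s k) L"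
  shows "Riesz_vec k L \<in> dg_space_vec s k"
    and "\<eta> \<in> dg_space_vec s k \<Longrightarrow> L2_inner (Riesz_vec k L) \<eta> = L \<eta>"
proof -
  interpret W: psd_form "dg_space_vec s k" L2_inner by (rule L2_inner_psd[OF k])
  let ?J = "basis_index s k \<times> (UNIV :: 'n set)" and ?e = "\<lambda>(i, j) x. basis_fun s k i x *\<^sub>R axis j (1::real)"
  have L0: "L (\<lambda>x. 0) = 0"
    using L W.zero unfolding linear_functional_def by (elim conjE allE[of _ 0]) auto
  have fin: "finite ?J" using finite_basis_index[OF k] by simp
  have "\<exists>z\<in>combinations ?J ?e. \<forall>v\<in>combinations ?J ?e. L2_inner z v = L v"
  proof (rule W.Riesz[OF fin _ L])
    show "?e p \<in> dg_space_vec s k" if "p \<in> ?J" for p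
      unfolding dg_space_vec_eq_combinations[OF k] by (rule generator_in_combinations[OF fin that])
    show "L v = 0" if "v \<in> dg_space_vec s k" "L2_inner v v = 0" for v
      using L2_inner_definite[OF k that] L0 by simp
  qed
  then obtain r where r: "r \<in> dg_space_vec s k" "\<And>v. v \<in> dg_space_vec s k \<Longrightarrow> L2_inner r v = L v"
    unfolding dg_space_vec_eq_combinations[OF k, symmetric] by blast
  have "Riesz_vec k L = r" by (rule Riesz_vec_unique[OF k r])
  then show "Riesz_vec k L \<in> dg_space_vec s k"
    and "\<eta> \<in> dg_space_vec s k \<Longrightarrow> L2_inner (Riesz_vec k L) \<eta> = L \<eta>" using r by auto
qed

lemma Riesz_vec_linear:
  assumes k: "k \<in> {1..levels s}"
    and L1: "linear_functional (dg_space_vec s k) L1" and L2: "linear_functional (dg_space_vec s k) L2"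
    and L: "\<And>\<eta>. \<eta> \<in> dg_space_vec s k \<Longrightarrow> L \<eta> = L1 \<eta> + c * L2 \<eta>"
  shows "Riesz_vec k L = (\<lambda>x. Riesz_vec k L1 x + c *\<^sub>R Riesz_vec k L2 x)"
proof (rule Riesz_vec_unique[OF k])
  interpret W: psd_form "dg_space_vec s k" L2_inner by (rule L2_inner_psd[OF k])
  note R1 = Riesz_vec[OF k L1] and R2 = Riesz_vec[OF k L2]
  show "(\<lambda>x. Riesz_vec k L1 x + c *\<^sub>R Riesz_vec k L2 x) \<in> dg_space_vec s k"
    by (rule W.add[OF R1(1) W.scale[OF R2(1)]])
  show "L2_inner (\<lambda>x. Riesz_vec k L1 x + c *\<^sub>R Riesz_vec k L2 x) \<eta> = L \<eta>" if "\<eta> \<in> dg_space_vec s k" for \<eta>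
    using that W.add_left[OF R1(1) W.scale[OF R2(1)] that] W.scale_left[OF R2(1) that] R1(2) R2(2) L by simp
qed

lemma lift_r_eq: "lift_r s k f \<tau> = Riesz_vec k (\<lambda>\<eta>. - face_integral f (\<lambda>y. \<tau> y \<bullet> average f \<eta> y))"
  by (simp add: lift_r_def Riesz_vec_def L2_inner_def)

lemma lift_l_eq: "lift_l s k f v = Riesz_vec k (\<lambda>\<eta>. - face_integral f (\<lambda>y. v y * jump_vec f \<eta> y))"
  by (simp add: lift_l_def Riesz_vec_def L2_inner_def)

lemma lift_r_functional:
  assumes k: "k \<in> {1..levels s}" and f: "f \<in> faces s k" and \<tau>: "continuous_on (face_set f) \<tau>"
  shows "linear_functional (dg_space_vec s k) (\<lambda>\<eta>. - face_integral f (\<lambda>y. \<tau> y \<bullet> average f \<eta> y))"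
  unfolding linear_functional_def
proof (intro conjI ballI allI)
  note pf = planar_face[OF k f] and pc = dg_space_vec_piecewise_continuous[OF k]
  note av = average_piecewise[OF k f pc]
  fix \<eta> assume \<eta>: "\<eta> \<in> dg_space_vec s k"
  show "- face_integral f (\<lambda>y. \<tau> y \<bullet> average f (\<lambda>x. \<eta> x + \<zeta> x) y)
      = - face_integral f (\<lambda>y. \<tau> y \<bullet> average f \<eta> y) + - face_integral f (\<lambda>y. \<tau> y \<bullet> average f \<zeta> y)"
    if \<zeta>: "\<zeta> \<in> dg_space_vec s k" for \<zeta>
  proof -
    have "face_integral f (\<lambda>y. \<tau> y \<bullet> average f (\<lambda>x. \<eta> x + \<zeta> x) y)
        = face_integral f (\<lambda>y. \<tau> y \<bullet> average f \<eta> y + \<tau> y \<bullet> average f \<zeta> y)"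
      by (rule face_integral_cong[OF pf]) (simp add: av(3)[OF \<eta> pc[OF \<zeta>]] inner_add_right)
    also have "\<dots> = face_integral f (\<lambda>y. \<tau> y \<bullet> average f \<eta> y) + face_integral f (\<lambda>y. \<tau> y \<bullet> average f \<zeta> y)"
      by (intro face_integral_add[OF pf] continuous_on_inner \<tau> av(1) \<eta> \<zeta>)
    finally show ?thesis by simp
  qed
  show "- face_integral f (\<lambda>y. \<tau> y \<bullet> average f (\<lambda>x. c *\<^sub>R \<eta> x) y)
      = c * - face_integral f (\<lambda>y. \<tau> y \<bullet> average f \<eta> y)" for c
  proof -
    have "face_integral f (\<lambda>y. \<tau> y \<bullet> average f (\<lambda>x. c *\<^sub>R \<eta> x) y)
        = face_integral f (\<lambda>y. c * (\<tau> y \<bullet> average f \<eta> y))"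
      by (rule face_integral_cong[OF pf]) (simp add: av(2)[OF \<eta>])
    then show ?thesis by (simp add: face_integral_scale)
  qed
qed

lemma lift_l_functional:
  assumes k: "k \<in> {1..levels s}" and f: "f \<in> interior_faces s k" and v: "continuous_on (face_set f) v"
  shows "linear_functional (dg_space_vec s k) (\<lambda>\<eta>. - face_integral f (\<lambda>y. v y * jump_vec f \<eta> y))"
  unfolding linear_functional_def
proof (intro conjI ballI allI)
  have "f \<in> faces s k" using f by (simp add: faces_def)
  note pf = planar_face[OF k this] and pc = dg_space_vec_piecewise_continuous[OF k]
  note jv = jump_vec_piecewise[OF k f pc]
  fix \<eta> assume \<eta>: "\<eta> \<in> dg_space_vec s k"
  show "- face_integral f (\<lambda>y. v y * jump_vec f (\<lambda>x. \<eta> x + \<zeta> x) y)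
      = - face_integral f (\<lambda>y. v y * jump_vec f \<eta> y) + - face_integral f (\<lambda>y. v y * jump_vec f \<zeta> y)"
    if \<zeta>: "\<zeta> \<in> dg_space_vec s k" for \<zeta>
  proof -
    have "face_integral f (\<lambda>y. v y * jump_vec f (\<lambda>x. \<eta> x + \<zeta> x) y)
        = face_integral f (\<lambda>y. v y * jump_vec f \<eta> y + v y * jump_vec f \<zeta> y)"
      by (rule face_integral_cong[OF pf]) (simp add: jv(3)[OF \<eta> pc[OF \<zeta>]] distrib_left)
    also have "\<dots> = face_integral f (\<lambda>y. v y * jump_vec f \<eta> y) + face_integral f (\<lambda>y. v y * jump_vec f \<zeta> y)"
      by (intro face_integral_add[OF pf] continuous_on_mult v jv(1) \<eta> \<zeta>)
    finally show ?thesis by simp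
  qed
  show "- face_integral f (\<lambda>y. v y * jump_vec f (\<lambda>x. c *\<^sub>R \<eta> x) y)
      = c * - face_integral f (\<lambda>y. v y * jump_vec f \<eta> y)" for c
  proof -
    have "face_integral f (\<lambda>y. v y * jump_vec f (\<lambda>x. c *\<^sub>R \<eta> x) y)
        = face_integral f (\<lambda>y. c * (v y * jump_vec f \<eta> y))"
      by (rule face_integral_cong[OF pf]) (simp add: jv(2)[OF \<eta>] mult.left_commute)
    then show ?thesis by (simp add: face_integral_scale)
  qed
qed

lemma lift_r_linear:
  assumes k: "k \<in> {1..levels s}" and f: "f \<in> faces s k"
    and c1: "continuous_on (face_set f) \<tau>1" and c2: "continuous_on (face_set f) \<tau>2"
    and eq: "\<And>y. y \<in> face_set f \<Longrightarrow> \<tau> y = \<tau>1 y + c *\<^sub>R \<tau>2 y"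
  shows "lift_r s k f \<tau> = (\<lambda>x. lift_r s k f \<tau>1 x + c *\<^sub>R lift_r s k f \<tau>2 x)"
  unfolding lift_r_eq
proof (rule Riesz_vec_linear[OF k lift_r_functional[OF k f c1] lift_r_functional[OF k f c2]])
  note pf = planar_face[OF k f]
  fix \<eta> assume \<eta>: "\<eta> \<in> dg_space_vec s k"
  note av = average_continuous[OF k f dg_space_vec_piecewise_continuous[OF k \<eta>]]
  have "face_integral f (\<lambda>y. \<tau> y \<bullet> average f \<eta> y)
      = face_integral f (\<lambda>y. \<tau>1 y \<bullet> average f \<eta> y + c * (\<tau>2 y \<bullet> average f \<eta> y))"
    by (rule face_integral_cong[OF pf]) (simp add: eq inner_add_left)
  also have "\<dots> = face_integral f (\<lambda>y. \<tau>1 y \<bullet> average f \<eta> y) + c * face_integral f (\<lambda>y. \<tau>2 y \<bullet> average f \<eta> y)"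
    unfolding face_integral_scale[symmetric]
    by (intro face_integral_add[OF pf] continuous_on_inner continuous_on_mult continuous_on_const av c1 c2)
  finally show "- face_integral f (\<lambda>y. \<tau> y \<bullet> average f \<eta> y)
      = - face_integral f (\<lambda>y. \<tau>1 y \<bullet> average f \<eta> y) + c * - face_integral f (\<lambda>y. \<tau>2 y \<bullet> average f \<eta> y)"
    by simp
qed

lemma lift_l_linear:
  assumes k: "k \<in> {1..levels s}" and f: "f \<in> interior_faces s k"
    and c1: "continuous_on (face_set f) v1" and c2: "continuous_on (face_set f) v2"
    and eq: "\<And>y. y \<in> face_set f \<Longrightarrow> v y = v1 y + c * v2 y"
  shows "lift_l s k f v = (\<lambda>x. lift_l s k f v1 x + c *\<^sub>R lift_l s k f v2 x)"
  unfolding lift_l_eq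
proof (rule Riesz_vec_linear[OF k lift_l_functional[OF k f c1] lift_l_functional[OF k f c2]])
  have "f \<in> faces s k" using f by (simp add: faces_def)
  note pf = planar_face[OF k this]
  fix \<eta> assume \<eta>: "\<eta> \<in> dg_space_vec s k"
  note jv = jump_vec_continuous[OF k f dg_space_vec_piecewise_continuous[OF k \<eta>]]
  have "face_integral f (\<lambda>y. v y * jump_vec f \<eta> y)
      = face_integral f (\<lambda>y. v1 y * jump_vec f \<eta> y + c * (v2 y * jump_vec f \<eta> y))"
    by (rule face_integral_cong[OF pf]) (simp add: eq distrib_right mult.assoc)
  also have "\<dots> = face_integral f (\<lambda>y. v1 y * jump_vec f \<eta> y) + c * face_integral f (\<lambda>y. v2 y * jump_vec f \<eta> y)"
    unfolding face_integral_scale[symmetric]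
    by (intro face_integral_add[OF pf] continuous_on_mult continuous_on_const jv c1 c2)
  finally show "- face_integral f (\<lambda>y. v y * jump_vec f \<eta> y)
      = - face_integral f (\<lambda>y. v1 y * jump_vec f \<eta> y) + c * - face_integral f (\<lambda>y. v2 y * jump_vec f \<eta> y)"
    by simp
qed

end

context dg_hierarchy
begin

section \<open>The discontinuous Galerkin forms are symmetric and positive semidefinite\<close>

lemma elementwise_grad_eq:
  assumes k: "k \<in> {1..levels s}" and T: "T \<in> mesh s k" and x: "x \<in> T"
    and q: "GDERIV q x :> g" "\<And>y. y \<in> T \<Longrightarrow> v y = q y"
  shows "elementwise_grad s k v x = g"
proof -
  have "(v has_derivative (\<lambda>h. h \<bullet> g)) (at x)"
    by (rule has_derivative_transform_within_open[OF q(1)[unfolded gderiv_def] element_open[OF k T] x])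
      (simp add: q(2))
  note frechet_derivative_at[OF this, symmetric]
  then have "partial_deriv i v x = g $ i" for i
    by (simp add: partial_deriv_def inner_axis')
  then show ?thesis using T x by (auto simp: elementwise_grad_def vec_eq_iff)
qed

lemma elementwise_grad_piecewise_continuous:
  assumes k: "k \<in> {1..levels s}" and v: "v \<in> dg_space s k"
  shows "piecewise_continuous (mesh s k) (elementwise_grad s k v)"
  unfolding piecewise_continuous_def
proof (intro conjI ballI allI impI)
  fix T assume T: "T \<in> mesh s k"
  obtain q where q: "C1_function q" "\<And>x. x \<in> T \<Longrightarrow> v x = q x"
    using dg_space_C1_extension[OF k v T] by blast
  obtain g where g: "continuous_on UNIV g" "\<And>x. GDERIV q x :> g x"
    using q(1) unfolding C1_function_def by blast
  show "\<exists>g. continuous_on UNIV g \<and> (\<forall>x\<in>T. elementwise_grad s k v x = g x)"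
    using g(1) elementwise_grad_eq[OF k T _ g(2) q(2)] by blast
qed (simp add: elementwise_grad_def)

lemma elementwise_grad_linear:
  assumes k: "k \<in> {1..levels s}" and u: "u \<in> dg_space s k" and v: "v \<in> dg_space s k"
  shows "elementwise_grad s k (\<lambda>x. u x + c *\<^sub>R v x) x = elementwise_grad s k u x + c *\<^sub>R elementwise_grad s k v x"
proof (cases "x \<in> \<Union>(mesh s k)")
  case True
  then obtain T where T: "T \<in> mesh s k" "x \<in> T" by blast
  obtain p where p: "C1_function p" "\<And>x. x \<in> T \<Longrightarrow> u x = p x"
    using dg_space_C1_extension[OF k u T(1)] by blast
  obtain q where q: "C1_function q" "\<And>x. x \<in> T \<Longrightarrow> v x = q x"
    using dg_space_C1_extension[OF k v T(1)] by blast
  obtain g h where gh: "GDERIV p x :> g" "GDERIV q x :> h"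
    using p(1) q(1) unfolding C1_function_def by blast
  have "GDERIV (\<lambda>x. p x + c * q x) x :> g + c *\<^sub>R h"
    using GDERIV_add[OF gh(1) GDERIV_mult[OF GDERIV_const[of c] gh(2)]] by simp
  then show ?thesis
    using elementwise_grad_eq[OF k T gh(1) p(2)] elementwise_grad_eq[OF k T gh(2) q(2)]
      elementwise_grad_eq[OF k T, of "\<lambda>x. p x + c * q x" "g + c *\<^sub>R h" "\<lambda>x. u x + c *\<^sub>R v x"]
    by (simp add: p(2) q(2))
qed (auto simp: elementwise_grad_def)

lemma jump_linear:
  assumes k: "k \<in> {1..levels s}" and f: "f \<in> faces s k"
    and u: "u \<in> dg_space s k" and v: "v \<in> dg_space s k" and y: "y \<in> face_set f"
  shows "jump f (\<lambda>x. u x + c *\<^sub>R v x) y = jump f u y + c *\<^sub>R jump f v y"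
proof -
  interpret V: function_space "dg_space s k" by (rule function_space_dg_space)
  note pc = dg_space_piecewise_continuous[OF k]
  show ?thesis
    using jump_add[OF k f pc[OF u] pc[OF V.scale[OF v, of c]] y] jump_scale[OF k f pc[OF v] y, of c] by simp
qed

lemma lift_G_mem:
  assumes k: "k \<in> {1..levels s}" and v: "v \<in> dg_space s k"
  shows "lift_G s k v \<in> dg_space_vec s k"
proof -
  interpret W: function_space "dg_space_vec s k" by (rule function_space_dg_space_vec)
  note jc = jump_continuous[OF k _ dg_space_piecewise_continuous[OF k v]]
  have "lift_r s k f (jump f v) \<in> dg_space_vec s k" if "f \<in> faces s k" for f
    unfolding lift_r_eq by (rule Riesz_vec(1)[OF k lift_r_functional[OF k that jc[OF that]]])
  moreover have "lift_l s k f (\<lambda>y. dg_beta s k f \<bullet> jump f v y) \<in> dg_space_vec s k"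
    if "f \<in> interior_faces s k" for f
    unfolding lift_l_eq
    by (rule Riesz_vec(1)[OF k lift_l_functional[OF k that]])
      (use that jc[of f] in \<open>auto simp: faces_def intro!: continuous_intros\<close>)
  ultimately show ?thesis
    unfolding lift_G_def[abs_def] by (intro W.add W.sum)
qed

lemma lift_G_linear:
  assumes k: "k \<in> {1..levels s}" and u: "u \<in> dg_space s k" and v: "v \<in> dg_space s k"
  shows "lift_G s k (\<lambda>x. u x + c *\<^sub>R v x) x = lift_G s k u x + c *\<^sub>R lift_G s k v x"
proof -
  note jc = jump_continuous[OF k _ dg_space_piecewise_continuous[OF k u]]
    jump_continuous[OF k _ dg_space_piecewise_continuous[OF k v]]
  have "lift_r s k f (jump f (\<lambda>x. u x + c *\<^sub>R v x))
      = (\<lambda>x. lift_r s k f (jump f u) x + c *\<^sub>R lift_r s k f (jump f v) x)" if f: "f \<in> faces s k" for f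
    by (rule lift_r_linear[OF k f jc(1)[OF f] jc(2)[OF f] jump_linear[OF k f u v]])
  moreover have "lift_l s k f (\<lambda>y. dg_beta s k f \<bullet> jump f (\<lambda>x. u x + c *\<^sub>R v x) y)
      = (\<lambda>x. lift_l s k f (\<lambda>y. dg_beta s k f \<bullet> jump f u y) x + c *\<^sub>R lift_l s k f (\<lambda>y. dg_beta s k f \<bullet> jump f v y) x)"
    if f: "f \<in> interior_faces s k" for f
  proof -
    have f': "f \<in> faces s k" using f by (simp add: faces_def)
    show ?thesis
      by (rule lift_l_linear[OF k f])
        (auto simp: jump_linear[OF k f' u v, unfolded real_scaleR_def] inner_add_right jc(1)[OF f'] jc(2)[OF f'] intro!: continuous_intros)
  qed
  ultimately show ?thesis
    by (simp add: lift_G_def sum.distrib scaleR_sum_right scaleR_add_right del: real_scaleR_def)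
qed

definition bulk_integrand :: "nat \<Rightarrow> (real^'n \<Rightarrow> real) \<Rightarrow> (real^'n \<Rightarrow> real) \<Rightarrow> real^'n \<Rightarrow> real" where
  "bulk_integrand k w v x =
     elementwise_grad s k w x \<bullet> elementwise_grad s k v x
     + elementwise_grad s k w x \<bullet> lift_G s k v x
     + lift_G s k w x \<bullet> elementwise_grad s k v x
     + dg_theta s * (lift_G s k w x \<bullet> lift_G s k v x)"

lemma dg_form_eq:
  "dg_form s k w v = (\<integral>x. bulk_integrand k w v x \<partial>lebesgue_on (dom s))
     + (\<Sum>f\<in>faces s k. face_integral f (\<lambda>y. penalty s k f * (jump f w y \<bullet> jump f v y)))"
  by (simp add: dg_form_def bulk_integrand_def)

lemma bulk_integrable:
  assumes k: "k \<in> {1..levels s}" and w: "w \<in> dg_space s k" and v: "v \<in> dg_space s k"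
  shows "integrable (lebesgue_on (dom s)) (bulk_integrand k w v)"
proof -
  note D = elementwise_grad_piecewise_continuous[OF k]
    and G = dg_space_vec_piecewise_continuous[OF k lift_G_mem[OF k]]
  show ?thesis
    unfolding bulk_integrand_def[abs_def]
    by (intro Bochner_Integration.integrable_add integrable_mult_right inner_integrable[OF k] D G w v)
qed

lemma dg_form_linear_left:
  assumes k: "k \<in> {1..levels s}" and u: "u \<in> dg_space s k" and v: "v \<in> dg_space s k" and w: "w \<in> dg_space s k"
  shows "dg_form s k (\<lambda>x. u x + c *\<^sub>R v x) w = dg_form s k u w + c * dg_form s k v w"
proof -
  have "bulk_integrand k (\<lambda>x. u x + c *\<^sub>R v x) w x = bulk_integrand k u w x + c * bulk_integrand k v w x" for x
    unfolding bulk_integrand_def elementwise_grad_linear[OF k u v] lift_G_linear[OF k u v]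
    by (simp add: inner_add_left algebra_simps)
  then have bulk: "(\<integral>x. bulk_integrand k (\<lambda>x. u x + c *\<^sub>R v x) w x \<partial>lebesgue_on (dom s))
      = (\<integral>x. bulk_integrand k u w x \<partial>lebesgue_on (dom s)) + c * (\<integral>x. bulk_integrand k v w x \<partial>lebesgue_on (dom s))"
    by (simp add: bulk_integrable[OF k u w] bulk_integrable[OF k v w] del: real_scaleR_def)
  have "face_integral f (\<lambda>y. penalty s k f * (jump f (\<lambda>x. u x + c *\<^sub>R v x) y \<bullet> jump f w y))
      = face_integral f (\<lambda>y. penalty s k f * (jump f u y \<bullet> jump f w y))
        + c * face_integral f (\<lambda>y. penalty s k f * (jump f v y \<bullet> jump f w y))" if f: "f \<in> faces s k" for f
  proof -
    note pf = planar_face[OF k f] and jc = jump_continuous[OF k f dg_space_piecewise_continuous[OF k]]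
    have "face_integral f (\<lambda>y. penalty s k f * (jump f (\<lambda>x. u x + c *\<^sub>R v x) y \<bullet> jump f w y))
        = face_integral f (\<lambda>y. penalty s k f * (jump f u y \<bullet> jump f w y)
            + c * (penalty s k f * (jump f v y \<bullet> jump f w y)))"
      by (rule face_integral_cong[OF pf], subst jump_linear[OF k f u v])
        (simp_all add: inner_add_left algebra_simps)
    also have "\<dots> = face_integral f (\<lambda>y. penalty s k f * (jump f u y \<bullet> jump f w y))
        + c * face_integral f (\<lambda>y. penalty s k f * (jump f v y \<bullet> jump f w y))"
      unfolding face_integral_scale[of f c, symmetric]
      by (intro face_integral_add[OF pf] continuous_on_mult continuous_on_inner continuous_on_const jc u v w)
    finally show ?thesis .
  qed
  then have "(\<Sum>f\<in>faces s k. face_integral f (\<lambda>y. penalty s k f * (jump f (\<lambda>x. u x + c *\<^sub>R v x) y \<bullet> jump f w y)))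
      = (\<Sum>f\<in>faces s k. face_integral f (\<lambda>y. penalty s k f * (jump f u y \<bullet> jump f w y)))
        + c * (\<Sum>f\<in>faces s k. face_integral f (\<lambda>y. penalty s k f * (jump f v y \<bullet> jump f w y)))"
    by (simp add: sum.distrib sum_distrib_left cong: sum.cong)
  with bulk show ?thesis unfolding dg_form_eq by (simp only: distrib_left)
qed

lemma dg_form_sym: "dg_form s k u v = dg_form s k v u"
  unfolding dg_form_def by (simp add: inner_commute add_ac)

end

locale dg_method_hierarchy = dg_hierarchy s \<Omega> csr cqu Cp
  for s :: "(real^'n::finite) mg_setting" and \<Omega> csr cqu Cp +
  fixes \<alpha>lo \<alpha>hi \<beta>max ccoer :: real
  assumes params: "dg_parameters \<alpha>lo \<alpha>hi \<beta>max ccoer s" and \<alpha>lo: "0 < \<alpha>lo" and ccoer: "0 < ccoer"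
begin

lemma penalty_nonneg:
  assumes k: "k \<in> {1..levels s}" and f: "f \<in> faces s k"
  shows "0 \<le> penalty s k f"
proof -
  have "0 \<le> alpha s k" using params k \<alpha>lo by (auto simp: dg_parameters_def intro: order_trans less_imp_le)
  with f show ?thesis
    by (cases rule: faces_cases)
      (auto simp: intro!: divide_nonneg_nonneg diameter_ge_0 element_bounded[OF k])
qed

text \<open>
  For LDG the volume term is the integral of the square of \<open>grad v + G v\<close>; for the interior penalty
  methods positivity is part of the coercivity assumption.
\<close>

lemma dg_form_nonneg:
  assumes k: "k \<in> {1..levels s}" and v: "v \<in> dg_space s k"
  shows "0 \<le> dg_form s k v v"
proof (cases "dgm s = LDG")
  case True
  have "bulk_integrand k v v x = norm (elementwise_grad s k v x + lift_G s k v x) ^ 2" for x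
    using True
    by (simp add: bulk_integrand_def dg_theta_def power2_norm_eq_inner inner_add_left inner_add_right inner_commute)
  then have "0 \<le> (\<integral>x. bulk_integrand k v v x \<partial>lebesgue_on (dom s))" by simp
  moreover have "0 \<le> (\<Sum>f\<in>faces s k. face_integral f (\<lambda>y. penalty s k f * (jump f v y \<bullet> jump f v y)))"
    by (intro sum_nonneg face_integral_nonneg planar_face[OF k] mult_nonneg_nonneg penalty_nonneg[OF k]) auto
  ultimately show ?thesis unfolding dg_form_eq by simp
next
  case False
  then have "ccoer * (dg_nrm s k v (elementwise_grad s k v))\<^sup>2 \<le> dg_form s k v v"
    using params k v by (simp add: dg_parameters_def)
  moreover have "0 \<le> ccoer * (dg_nrm s k v (elementwise_grad s k v))\<^sup>2" using ccoer by simp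
  ultimately show ?thesis by linarith
qed

lemma inherited_form_psd:
  assumes k: "k \<in> {1..levels s}"
  shows "psd_form (dg_space s k) (inherited_form s k)"
proof -
  interpret V: function_space "dg_space s k" by (rule function_space_dg_space)
  have K: "levels s \<in> {1..levels s}" using levels_ge_1 by simp
  note mem = prolong_to_top_mem[OF k]
  have lin: "inherited_form s k (\<lambda>x. u x + c *\<^sub>R v x) w = inherited_form s k u w + c * inherited_form s k v w"
    if "u \<in> dg_space s k" "v \<in> dg_space s k" "w \<in> dg_space s k" for u v w c
    unfolding inherited_form_def prolong_to_top_linear
    by (rule dg_form_linear_left[OF K mem mem mem]) (fact that)+
  have zero: "inherited_form s k (\<lambda>x. 0) w = 0" if "w \<in> dg_space s k" for w
    using lin[OF V.zero V.zero that, of 1] by simp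
  show ?thesis
  proof
    show "inherited_form s k u v = inherited_form s k v u" for u v
      unfolding inherited_form_def by (rule dg_form_sym)
    show "inherited_form s k (\<lambda>x. u x + v x) w = inherited_form s k u w + inherited_form s k v w"
      if "u \<in> dg_space s k" "v \<in> dg_space s k" "w \<in> dg_space s k" for u v w
      using lin[OF that, of 1] by simp
    show "inherited_form s k (\<lambda>x. c *\<^sub>R u x) w = c * inherited_form s k u w"
      if "u \<in> dg_space s k" "w \<in> dg_space s k" for u w c
      using lin[OF V.zero that, of c] zero[OF that(2)] by simp
    show "0 \<le> inherited_form s k v v" if "v \<in> dg_space s k" for v
      unfolding inherited_form_def by (rule dg_form_nonneg[OF K mem[OF that]])
  qed
qed

end

section \<open>The multigrid operators\<close>

locale multigrid = dg_method_hierarchy s \<Omega> csr cqu Cp \<alpha>lo \<alpha>hi \<beta>max ccoer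
  for s :: "(real^'n::finite) mg_setting" and \<Omega> csr cqu Cp \<alpha>lo \<alpha>hi \<beta>max ccoer +
  fixes C\<Lambda> :: real
  assumes smoothing: "smoothing_parameters C\<Lambda> s"
begin

lemma
  assumes k: "k \<in> {1..levels s}" and u: "u \<in> dg_space s k"
  shows level_op_mem: "level_op s k u \<in> dg_space s k"
    and level_op_form: "v \<in> dg_space s k \<Longrightarrow> level_inner s k (level_op s k u) v = inherited_form s k u v"
proof -
  let ?V = "dg_space s k"
  interpret a: psd_form ?V "inherited_form s k" by (rule inherited_form_psd[OF k])
  interpret ip: psd_form ?V "level_inner s k" by (rule level_inner_psd[OF k])
  have "\<exists>z\<in>combinations (basis_index s k) (basis_fun s k).
      \<forall>v\<in>combinations (basis_index s k) (basis_fun s k). level_inner s k z v = inherited_form s k u v"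
  proof (rule ip.Riesz[OF finite_basis_index[OF k] basis_fun_mem[OF k] a.linear_functional_right[OF u]])
    show "inherited_form s k u v = 0" if "v \<in> ?V" "level_inner s k v v = 0" for v
      using level_inner_definite[OF k that] a.zero_left[OF u] a.sym[OF u a.zero] by simp
  qed
  then obtain z where z: "z \<in> ?V" "\<And>v. v \<in> ?V \<Longrightarrow> level_inner s k z v = inherited_form s k u v"
    unfolding dg_space_eq_combinations[OF k, symmetric] by blast
  have "level_op s k u = z"
    unfolding level_op_def
  proof (rule the_equality)
    fix y assume y: "y \<in> ?V \<and> (\<forall>v\<in>?V. level_inner s k y v = inherited_form s k u v)"
    have d: "(\<lambda>x. y x - z x) \<in> ?V" using a.diff y z(1) by blast
    have "level_inner s k (\<lambda>x. y x - z x) (\<lambda>x. y x - z x) = 0"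
      using ip.diff_left[of y z "\<lambda>x. y x - z x"] y z d by simp
    then have "(\<lambda>x. y x - z x) = (\<lambda>x. 0)" by (rule level_inner_definite[OF k d])
    then show "y = z" by (simp add: fun_eq_iff)
  qed (use z in blast)
  then show "level_op s k u \<in> ?V"
    and "v \<in> ?V \<Longrightarrow> level_inner s k (level_op s k u) v = inherited_form s k u v"
    using z by auto
qed

lemma level_op_operator_of_form:
  assumes k: "k \<in> {1..levels s}"
  shows "operator_of_form (dg_space s k) (inherited_form s k) (level_inner s k) (level_op s k)
    (basis_index s k) (basis_fun s k)"
proof -
  interpret a: psd_form "dg_space s k" "inherited_form s k" by (rule inherited_form_psd[OF k])
  interpret ip: psd_form "dg_space s k" "level_inner s k" by (rule level_inner_psd[OF k])
  show ?thesis
    by unfold_locales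
      (fact level_inner_definite[OF k] level_op_mem[OF k] level_op_form[OF k] finite_basis_index[OF k]
        dg_space_eq_combinations[OF k])+
qed

lemma energy_nrm_eq:
  assumes "k \<in> {1..levels s}" "v \<in> dg_space s k"
  shows "energy_nrm s k v = sqrt (inherited_form s k v v)"
  using level_op_form[OF assms assms(2)] by (simp add: energy_nrm_def)

lemma energy_nrm_nonneg:
  assumes k: "k \<in> {1..levels s}" and v: "v \<in> dg_space s k"
  shows "0 \<le> energy_nrm s k v"
  using psd_form.nonneg[OF inherited_form_psd[OF k] v] by (simp add: energy_nrm_eq[OF k v])

lemma energy_nrm_triangle:
  assumes k: "k \<in> {1..levels s}" and u: "u \<in> dg_space s k" and v: "v \<in> dg_space s k"
  shows "energy_nrm s k (\<lambda>x. u x + v x) \<le> energy_nrm s k u + energy_nrm s k v"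
  using psd_form.triangle[OF inherited_form_psd[OF k] u v]
    function_space.add[OF function_space_dg_space u v]
  by (simp add: energy_nrm_eq[OF k] u v)

lemma
  assumes k: "k \<in> {2..levels s}" and v: "v \<in> dg_space s k"
  shows smoother_mem: "smoother s k v \<in> dg_space s k"
    and smoother_energy_le: "energy_nrm s k (smoother s k v) \<le> energy_nrm s k v"
    and smoother_add: "u \<in> dg_space s k \<Longrightarrow>
      smoother s k (\<lambda>x. u x + v x) = (\<lambda>x. smoother s k u x + smoother s k v x)"
proof -
  have k': "k \<in> {1..levels s}" using k by auto
  interpret op: operator_of_form "dg_space s k" "inherited_form s k" "level_inner s k" "level_op s k"
    "basis_index s k" "basis_fun s k" by (rule level_op_operator_of_form[OF k'])
  show mem: "smoother s k v \<in> dg_space s k"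
    using op.a.diff[OF v op.a.scale[OF op.A_mem[OF v], of "inverse (Lam s k)"]]
    by (simp add: smoother_def)
  have Lam: "lambda_max s k \<le> Lam s k" using smoothing k by (simp add: smoothing_parameters_def)
  have "inherited_form s k w w \<le> Lam s k * level_inner s k w w" if w: "w \<in> dg_space s k" for w
    using op.Rayleigh_le_largest_eigenvalue[OF w] mult_right_mono[OF Lam op.ip.nonneg[OF w]]
    unfolding lambda_max_def by linarith
  from op.Richardson_energy_le[OF this v]
  have "inherited_form s k (smoother s k v) (smoother s k v) \<le> inherited_form s k v v"
    by (simp add: smoother_def)
  then show "energy_nrm s k (smoother s k v) \<le> energy_nrm s k v"
    by (simp add: energy_nrm_eq[OF k'] v mem)
  show "smoother s k (\<lambda>x. u x + v x) = (\<lambda>x. smoother s k u x + smoother s k v x)"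
    if "u \<in> dg_space s k"
    by (simp add: smoother_def op.A_add[OF that v] algebra_simps)
qed

lemma
  assumes k: "k \<in> {2..levels s}" and v: "v \<in> dg_space s k"
  shows smoother_power_mem: "(smoother s k ^^ m) v \<in> dg_space s k"
    and smoother_power_energy_le: "energy_nrm s k ((smoother s k ^^ m) v) \<le> energy_nrm s k v"
    and smoother_power_add: "u \<in> dg_space s k \<Longrightarrow>
      (smoother s k ^^ m) (\<lambda>x. u x + v x) = (\<lambda>x. (smoother s k ^^ m) u x + (smoother s k ^^ m) v x)"
proof -
  have mem: "(smoother s k ^^ m) w \<in> dg_space s k" if "w \<in> dg_space s k" for w m
    by (induction m) (simp_all add: that smoother_mem[OF k])
  show "(smoother s k ^^ m) v \<in> dg_space s k" by (rule mem[OF v])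
  show "energy_nrm s k ((smoother s k ^^ m) v) \<le> energy_nrm s k v"
  proof (induction m)
    case (Suc m)
    then show ?case using smoother_energy_le[OF k mem[OF v], of m] by simp
  qed simp
  show "(smoother s k ^^ m) (\<lambda>x. u x + v x) = (\<lambda>x. (smoother s k ^^ m) u x + (smoother s k ^^ m) v x)"
    if u: "u \<in> dg_space s k"
  proof (induction m)
    case (Suc m)
    then show ?case using smoother_add[OF k mem[OF v] mem[OF u], of m m] by simp
  qed simp
qed

lemma inherited_form_injection:
  assumes "k \<in> {2..levels s}"
  shows "inherited_form s k (injection s k u) (injection s k v) = inherited_form s (k - 1) u v"
  unfolding inherited_form_def prolong_to_top_injection[OF assms] by (rule refl)

lemma energy_nrm_injection:
  assumes k: "k \<in> {2..levels s}" and v: "v \<in> dg_space s (k - 1)"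
  shows "energy_nrm s k (injection s k v) = energy_nrm s (k - 1) v"
proof -
  have "k \<in> {1..levels s}" "k - 1 \<in> {1..levels s}" using k by auto
  then show ?thesis
    by (simp add: energy_nrm_eq injection_mem[OF k v] v inherited_form_injection[OF k] del: One_nat_def)
qed

text \<open>
  The projection exists since the functional \<open>w \<mapsto> a(v, R w)\<close> vanishes on vectors of zero coarse energy,
  which the injection maps to vectors of zero fine energy.  The bound is the Cauchy-Schwarz inequality for
  $a_{k-1}(Pv, Pv) = a_k(v, R P v)$.
\<close>

lemma
  assumes k: "k \<in> {2..levels s}" and v: "v \<in> dg_space s k"
  shows coarse_proj_mem: "coarse_proj s k v \<in> dg_space s (k - 1)"
    and coarse_proj_energy_le: "energy_nrm s (k - 1) (coarse_proj s k v) \<le> energy_nrm s k v"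
proof -
  have k': "k \<in> {1..levels s}" "k - 1 \<in> {1..levels s}" using k by auto
  let ?W = "dg_space s (k - 1)" and ?z = "coarse_proj s k v"
  interpret f: psd_form "dg_space s k" "inherited_form s k" by (rule inherited_form_psd[OF k'(1)])
  interpret c: psd_form ?W "inherited_form s (k - 1)" by (rule inherited_form_psd[OF k'(2)])
  have "\<exists>z\<in>combinations (basis_index s (k - 1)) (basis_fun s (k - 1)).
      \<forall>w\<in>combinations (basis_index s (k - 1)) (basis_fun s (k - 1)).
        inherited_form s (k - 1) z w = inherited_form s k v (injection s k w)"
  proof (rule c.Riesz[OF finite_basis_index[OF k'(2)] basis_fun_mem[OF k'(2)]])
    show "linear_functional ?W (\<lambda>w. inherited_form s k v (injection s k w))"
      unfolding linear_functional_def injection_add injection_scale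
      using f.add_right[OF injection_mem[OF k] injection_mem[OF k] v]
        f.scale_right[OF injection_mem[OF k] v] by blast
    show "inherited_form s k v (injection s k w) = 0"
      if "w \<in> ?W" "inherited_form s (k - 1) w w = 0" for w
      by (rule f.null_imp_zero[OF v injection_mem[OF k that(1)]])
        (simp add: inherited_form_injection[OF k] that(2) del: One_nat_def)
  qed
  then have "\<exists>z. z \<in> ?W \<and> (\<forall>w\<in>?W. inherited_form s (k - 1) z w = inherited_form s k v (injection s k w))"
    unfolding dg_space_eq_combinations[OF k'(2), symmetric] by blast
  then have z: "?z \<in> ?W \<and> (\<forall>w\<in>?W. inherited_form s (k - 1) ?z w = inherited_form s k v (injection s k w))"
    unfolding coarse_proj_def by (rule someI_ex)
  then show mem: "?z \<in> ?W" by blast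
  let ?a = "inherited_form s (k - 1) ?z ?z" and ?b = "inherited_form s k v v"
  have "?a = inherited_form s k v (injection s k ?z)" using z by blast
  then have "?a * ?a \<le> ?b * ?a"
    using f.Cauchy_Schwarz[OF v injection_mem[OF k mem]]
    by (simp add: inherited_form_injection[OF k] power2_eq_square del: One_nat_def)
  then have "?a \<le> ?b"
    using c.nonneg[OF mem] f.nonneg[OF v] by (cases "?a = 0") (simp_all del: One_nat_def)
  then show "energy_nrm s (k - 1) ?z \<le> energy_nrm s k v"
    unfolding energy_nrm_eq[OF k'(2) mem] energy_nrm_eq[OF k'(1) v] by (rule real_sqrt_le_mono)
qed

lemma w_cycle_mem:
  assumes "k \<in> {1..levels s}" "v \<in> dg_space s k"
  shows "w_cycle s m1 m2 k v \<in> dg_space s k"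
  using assms
proof (induction k arbitrary: v rule: less_induct)
  case (less k)
  show ?case
  proof (cases "k = 1")
    case True
    then show ?thesis using function_space.zero[OF function_space_dg_space] by simp
  next
    case False
    then obtain j where j: "k = Suc (Suc j)" using less.prems(1) by (cases k; cases "k - 1") auto
    have k: "k \<in> {2..levels s}" "k - 1 \<in> {1..levels s}" using less.prems(1) j by auto
    interpret V: function_space "dg_space s k" by (rule function_space_dg_space)
    interpret W: function_space "dg_space s (k - 1)" by (rule function_space_dg_space)
    define w where "w = (smoother s k ^^ m1) v"
    define z where "z = coarse_proj s k w"
    define e where "e = w_cycle s m1 m2 (k - 1) (w_cycle s m1 m2 (k - 1) z)"
    have w: "w \<in> dg_space s k" unfolding w_def by (rule smoother_power_mem[OF k(1) less.prems(2)])
    have z: "z \<in> dg_space s (k - 1)" unfolding z_def by (rule coarse_proj_mem[OF k(1) w])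
    have e: "e \<in> dg_space s (k - 1)"
      unfolding e_def by (intro less.IH k z) (use j in simp_all)
    have "w_cycle s m1 m2 k v = (smoother s k ^^ m2) (\<lambda>x. w x - injection s k (\<lambda>y. z y - e y) x)"
      by (simp add: j w_def z_def e_def Let_def)
    then show ?thesis
      using smoother_power_mem[OF k(1) V.diff[OF w injection_mem[OF k(1) W.diff[OF z e]]]] by simp
  qed
qed

text \<open>
  Since the smoother is linear, replacing the exact coarse solve by two recursive calls adds one
  correction to the two-level operator.
\<close>

lemma w_cycle_eq_two_level_plus:
  fixes m1 m2 :: nat
  assumes k: "k \<in> {2..levels s}" and v: "v \<in> dg_space s k"
  defines "z \<equiv> coarse_proj s k ((smoother s k ^^ m1) v)"
  shows "w_cycle s m1 m2 k v = (\<lambda>x. two_level s m1 m2 k v x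
    + (smoother s k ^^ m2) (injection s k (w_cycle s m1 m2 (k - 1) (w_cycle s m1 m2 (k - 1) z))) x)"
proof -
  obtain j where j: "k = Suc (Suc j)" using k by (cases k; cases "k - 1") auto
  have k': "k - 1 \<in> {1..levels s}" using k by auto
  interpret V: function_space "dg_space s k" by (rule function_space_dg_space)
  define w where "w = (smoother s k ^^ m1) v"
  define e where "e = w_cycle s m1 m2 (k - 1) (w_cycle s m1 m2 (k - 1) z)"
  have w: "w \<in> dg_space s k" unfolding w_def by (rule smoother_power_mem[OF k v])
  have z: "z \<in> dg_space s (k - 1)" unfolding z_def w_def[symmetric] by (rule coarse_proj_mem[OF k w])
  have e: "e \<in> dg_space s (k - 1)" unfolding e_def by (intro w_cycle_mem k' z)
  have "w_cycle s m1 m2 k v = (smoother s k ^^ m2) (\<lambda>x. w x - injection s k (\<lambda>y. z y - e y) x)"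
    by (simp add: j w_def z_def e_def Let_def)
  also have "(\<lambda>x. w x - injection s k (\<lambda>y. z y - e y) x)
      = (\<lambda>x. (w x - injection s k z x) + injection s k e x)"
    by (simp add: injection_diff algebra_simps)
  also have "(smoother s k ^^ m2) \<dots> = (\<lambda>x. (smoother s k ^^ m2) (\<lambda>x. w x - injection s k z x) x
      + (smoother s k ^^ m2) (injection s k e) x)"
    by (rule smoother_power_add[OF k injection_mem[OF k e] V.diff[OF w injection_mem[OF k z]]])
  also have "(smoother s k ^^ m2) (\<lambda>x. w x - injection s k z x) = two_level s m1 m2 k v"
    by (simp add: two_level_def w_def z_def)
  finally show ?thesis unfolding e_def .
qed

lemma two_level_mem:
  assumes k: "k \<in> {2..levels s}" and v: "v \<in> dg_space s k"
  shows "two_level s m1 m2 k v \<in> dg_space s k"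
proof -
  note w = smoother_power_mem[OF k v, of m1]
  show ?thesis
    unfolding two_level_def
    by (rule smoother_power_mem[OF k function_space.diff[OF function_space_dg_space w
            injection_mem[OF k coarse_proj_mem[OF k w]]]])
qed

lemma w_cycle_energy_recursion:
  assumes k: "k \<in> {2..levels s}" and v: "v \<in> dg_space s k"
  obtains z where "z \<in> dg_space s (k - 1)" "energy_nrm s (k - 1) z \<le> energy_nrm s k v"
    "energy_nrm s k (w_cycle s m1 m2 k v) \<le> energy_nrm s k (two_level s m1 m2 k v)
       + energy_nrm s (k - 1) (w_cycle s m1 m2 (k - 1) (w_cycle s m1 m2 (k - 1) z))"
proof
  have k': "k \<in> {1..levels s}" "k - 1 \<in> {1..levels s}" using k by auto
  let ?w = "(smoother s k ^^ m1) v"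
  let ?z = "coarse_proj s k ?w"
  let ?e = "w_cycle s m1 m2 (k - 1) (w_cycle s m1 m2 (k - 1) ?z)"
  have w: "?w \<in> dg_space s k" by (rule smoother_power_mem[OF k v])
  show z: "?z \<in> dg_space s (k - 1)" by (rule coarse_proj_mem[OF k w])
  show "energy_nrm s (k - 1) ?z \<le> energy_nrm s k v"
    using coarse_proj_energy_le[OF k w] smoother_power_energy_le[OF k v, of m1] by linarith
  have e: "?e \<in> dg_space s (k - 1)" by (intro w_cycle_mem k' z)
  note i = injection_mem[OF k e]
  have "energy_nrm s k (w_cycle s m1 m2 k v) \<le> energy_nrm s k (two_level s m1 m2 k v)
      + energy_nrm s k ((smoother s k ^^ m2) (injection s k ?e))"
    unfolding w_cycle_eq_two_level_plus[OF k v, of m1 m2]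
    by (rule energy_nrm_triangle[OF k'(1) two_level_mem[OF k v] smoother_power_mem[OF k i]])
  also have "energy_nrm s k ((smoother s k ^^ m2) (injection s k ?e)) \<le> energy_nrm s (k - 1) ?e"
    using smoother_power_energy_le[OF k i, of m2] energy_nrm_injection[OF k e] by simp
  finally show "energy_nrm s k (w_cycle s m1 m2 k v) \<le> energy_nrm s k (two_level s m1 m2 k v)
      + energy_nrm s (k - 1) ?e" by simp
qed

section \<open>Convergence of the W-cycle\<close>

lemma Sigma_R_nonneg: "0 \<le> Sigma_R s \<mu> m1 m2 k"
  by (simp add: Sigma_R_def)

text \<open>
  Here the number of smoothing steps enters.  With $q^2 = (1+m_1)(1+m_2)$, the claim reduces to
  $q \ge 4 \cdot 2^{K-k} p_K^2 p_{k-1}^\mu C^2/(C-C_2)$, and $q^2 \ge m_1 + m_2$.  The spare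
  factor $2^k/4$ in the assumption makes it independent of the level except through the degree.
\<close>

lemma Sigma_R_square_le:
  assumes k: "k \<in> {3..levels s}" and C: "0 < C2" "C2 < C"
    and m: "(2 ^ levels s * real (pdeg s (levels s)) ^ 2 * real (pdeg s (k - 1)) ^ \<mu> * (C\<^sup>2 / (C - C2)))\<^sup>2
      \<le> real (m1 + m2)"
  shows "(C * Sigma_R s \<mu> m1 m2 (k - 1))\<^sup>2 \<le> (C - C2) * Sigma_R s \<mu> m1 m2 k"
proof -
  define P r t a q where "P = real (pdeg s (levels s)) ^ 2" and "r = real (pdeg s (k - 1)) ^ \<mu>"
    and "t = real (pdeg s k) ^ \<mu>" and "a = (2::real) ^ (levels s - k)"
    and "q = sqrt (1 + real m1) * sqrt (1 + real m2)"
  have nonneg: "0 \<le> P" "0 \<le> r" "0 < a" by (simp_all add: P_def r_def a_def)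
  have rt: "r \<le> t" unfolding r_def t_def
    using degrees k by (intro power_mono) (auto simp: admissible_degrees_def)
  have q: "0 < q" unfolding q_def by (intro mult_pos_pos) auto
  have q2: "q\<^sup>2 = (1 + real m1) * (1 + real m2)" by (simp add: q_def power_mult_distrib)
  have "4 * a \<le> 2 ^ levels s"
  proof -
    have "4 * a = 2 ^ (levels s - k + 2)" by (simp add: a_def)
    also have "\<dots> \<le> 2 ^ levels s" using k by (intro power_increasing) auto
    finally show ?thesis .
  qed
  then have "4 * a * P * r * (C\<^sup>2 / (C - C2)) \<le> 2 ^ levels s * P * r * (C\<^sup>2 / (C - C2))"
    using nonneg C by (intro mult_right_mono) auto
  also have "\<dots> \<le> q"
  proof (rule power2_le_imp_le)
    have "real (m1 + m2) \<le> q\<^sup>2" unfolding q2 by (simp add: algebra_simps)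
    then show "(2 ^ levels s * P * r * (C\<^sup>2 / (C - C2)))\<^sup>2 \<le> q\<^sup>2" using m by (simp add: P_def r_def)
  qed (use q in simp)
  finally have "4 * a * P * r * C\<^sup>2 \<le> (C - C2) * q" using C by (simp add: field_simps)
  then have "4 * a * P * r * C\<^sup>2 * r \<le> (C - C2) * q * t"
    using rt nonneg q C by (intro mult_mono[of _ _ r t]) auto
  then have "a * P * (4 * a * P * r * C\<^sup>2 * r) \<le> a * P * ((C - C2) * q * t)"
    using nonneg by (intro mult_left_mono) auto
  then have "(C * (2 * a * (P * r / q)))\<^sup>2 \<le> (C - C2) * (a * (P * t / q))"
    using q by (simp add: field_simps power2_eq_square)
  moreover have "Sigma_R s \<mu> m1 m2 (k - 1) = 2 * a * (P * r / q)"
  proof -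
    have "levels s - (k - 1) = Suc (levels s - k)" using k by auto
    then show ?thesis by (simp add: Sigma_R_def P_def r_def q_def a_def)
  qed
  moreover have "Sigma_R s \<mu> m1 m2 k = a * (P * t / q)" by (simp add: Sigma_R_def P_def t_def q_def a_def)
  ultimately show ?thesis by simp
qed

lemma w_cycle_estimate:
  assumes two_level: "\<And>k m1 m2 v. k \<in> {2..levels s} \<Longrightarrow> v \<in> dg_space s k \<Longrightarrow>
      energy_nrm s k (two_level s m1 m2 k v) \<le> C2 * Sigma_R s \<mu> m1 m2 k * energy_nrm s k v"
    and C: "0 < C2" "C2 < C"
    and k: "2 \<le> k" "k \<le> levels s"
    and m: "(2 ^ levels s * real (pdeg s (levels s)) ^ 2 * real (pdeg s (k - 1)) ^ \<mu> * (C\<^sup>2 / (C - C2)))\<^sup>2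
      \<le> real (m1 + m2)"
    and v: "v \<in> dg_space s k"
  shows "energy_nrm s k (w_cycle s m1 m2 k v) \<le> C * Sigma_R s \<mu> m1 m2 k * energy_nrm s k v"
  using k m v
proof (induction k arbitrary: v rule: nat_induct_at_least)
  case base
  then have k: "2 \<in> {2..levels s}" by simp
  obtain z where "energy_nrm s 2 (w_cycle s m1 m2 2 v) \<le> energy_nrm s 2 (two_level s m1 m2 2 v)
       + energy_nrm s (2 - 1) (w_cycle s m1 m2 (2 - 1) (w_cycle s m1 m2 (2 - 1) z))"
    using w_cycle_energy_recursion[OF k base(3), of m1 m2] by blast
  moreover have "energy_nrm s (2 - 1) (w_cycle s m1 m2 (2 - 1) (w_cycle s m1 m2 (2 - 1) z)) = 0"
  proof -
    have 1: "1 \<in> {1..levels s}" using k by auto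
    interpret psd_form "dg_space s 1" "inherited_form s 1" by (rule inherited_form_psd[OF 1])
    show ?thesis using energy_nrm_eq[OF 1 zero] zero_left[OF zero] by simp
  qed
  moreover note two_level[OF k base(3), of m1 m2]
  moreover have "C2 * Sigma_R s \<mu> m1 m2 2 * energy_nrm s 2 v \<le> C * Sigma_R s \<mu> m1 m2 2 * energy_nrm s 2 v"
    using C Sigma_R_nonneg[of \<mu> m1 m2 2] energy_nrm_nonneg[of 2 v] k base(3) by (intro mult_right_mono) auto
  ultimately show ?case by linarith
next
  case (Suc j)
  let ?k = "Suc j" and ?\<Sigma> = "Sigma_R s \<mu> m1 m2"
  have k: "?k \<in> {2..levels s}" "?k \<in> {3..levels s}" "?k \<in> {1..levels s}" "j \<in> {1..levels s}"
    using Suc.hyps Suc.prems(1) by auto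
  have IH: "energy_nrm s j (w_cycle s m1 m2 j u) \<le> C * ?\<Sigma> j * energy_nrm s j u" if "u \<in> dg_space s j" for u
  proof (rule Suc.IH[OF _ _ that])
    show "j \<le> levels s" using Suc.prems(1) by simp
    have "pdeg s (j - 1) \<le> pdeg s j" using degrees Suc.hyps Suc.prems(1) by (auto simp: admissible_degrees_def)
    then have "2 ^ levels s * real (pdeg s (levels s)) ^ 2 * real (pdeg s (j - 1)) ^ \<mu> * (C\<^sup>2 / (C - C2))
      \<le> 2 ^ levels s * real (pdeg s (levels s)) ^ 2 * real (pdeg s (?k - 1)) ^ \<mu> * (C\<^sup>2 / (C - C2))"
      using C by (intro mult_right_mono mult_left_mono power_mono) auto
    then have "(2 ^ levels s * real (pdeg s (levels s)) ^ 2 * real (pdeg s (j - 1)) ^ \<mu> * (C\<^sup>2 / (C - C2)))\<^sup>2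
      \<le> (2 ^ levels s * real (pdeg s (levels s)) ^ 2 * real (pdeg s (?k - 1)) ^ \<mu> * (C\<^sup>2 / (C - C2)))\<^sup>2"
      using C by (intro power_mono) auto
    then show "(2 ^ levels s * real (pdeg s (levels s)) ^ 2 * real (pdeg s (j - 1)) ^ \<mu> * (C\<^sup>2 / (C - C2)))\<^sup>2
      \<le> real (m1 + m2)" using Suc.prems(2) by linarith
  qed
  obtain z where z: "z \<in> dg_space s j" "energy_nrm s j z \<le> energy_nrm s ?k v"
    "energy_nrm s ?k (w_cycle s m1 m2 ?k v) \<le> energy_nrm s ?k (two_level s m1 m2 ?k v)
       + energy_nrm s j (w_cycle s m1 m2 j (w_cycle s m1 m2 j z))"
    using w_cycle_energy_recursion[OF k(1) Suc.prems(3), of m1 m2] by auto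
  have C\<Sigma>: "0 \<le> C * ?\<Sigma> j" using C Sigma_R_nonneg[of \<mu> m1 m2 j] by simp
  have "energy_nrm s j (w_cycle s m1 m2 j (w_cycle s m1 m2 j z))
      \<le> C * ?\<Sigma> j * energy_nrm s j (w_cycle s m1 m2 j z)"
    by (rule IH[OF w_cycle_mem[OF k(4) z(1)]])
  also have "\<dots> \<le> C * ?\<Sigma> j * (C * ?\<Sigma> j * energy_nrm s j z)"
    by (rule mult_left_mono[OF IH[OF z(1)] C\<Sigma>])
  also have "\<dots> = (C * ?\<Sigma> j)\<^sup>2 * energy_nrm s j z" by (simp add: power2_eq_square)
  also have "\<dots> \<le> ((C - C2) * ?\<Sigma> ?k) * energy_nrm s ?k v"
    using Sigma_R_square_le[OF k(2) C Suc.prems(2)] z(2) C Sigma_R_nonneg[of \<mu> m1 m2 ?k] energy_nrm_nonneg[OF k(4) z(1)]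
    by (intro mult_mono) auto
  finally show ?case
    using z(3) two_level[OF k(1) Suc.prems(3), of m1 m2] by (simp add: algebra_simps)
qed

end

theorem theorem6p3:
  fixes \<Omega> :: "(real^'n::finite) set"
    and S :: "(real^'n) mg_setting set"
    and csr cqu Cp \<alpha>lo \<alpha>hi \<beta>max ccoer Cell C\<Lambda> C2lvl :: real
    and Cerr :: "real \<Rightarrow> real"
    and \<mu> :: nat
  assumes "CARD('n) \<in> {2, 3}"
    and "polyhedral_domain \<Omega>"
    and "elliptic_regularity \<Omega> Cell"
    and "\<mu> \<in> {0, 1}" and "0 < \<alpha>lo" and "0 < ccoer"
    and "\<And>s. s \<in> S \<Longrightarrow> mesh_hierarchy \<Omega> csr cqu s"
    and "\<And>s. s \<in> S \<Longrightarrow> admissible_degrees Cp s"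
    and "\<And>s. s \<in> S \<Longrightarrow> orthonormal_ref_basis s"
    and "\<And>s. s \<in> S \<Longrightarrow> dg_parameters \<alpha>lo \<alpha>hi \<beta>max ccoer s"
    and "\<And>s. s \<in> S \<Longrightarrow> dg_error_estimates \<mu> Cerr s"
    and "\<And>s. s \<in> S \<Longrightarrow> smoothing_parameters C\<Lambda> s"
    and "0 < C2lvl"
    and "\<And>s k m1 m2 v. s \<in> S \<Longrightarrow> k \<in> {2..levels s} \<Longrightarrow> v \<in> dg_space s k \<Longrightarrow>
           energy_nrm s k (two_level s m1 m2 k v)
             \<le> C2lvl * Sigma_R s \<mu> m1 m2 k * energy_nrm s k v"
  shows "\<exists>CR > C2lvl. \<exists>mR :: nat list \<Rightarrow> nat \<Rightarrow> nat.
           \<forall>s\<in>S. \<forall>k\<in>{2..levels s}.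
             sqrt (real (mR (degree_list s) k))
               \<ge> 2 ^ (levels s - k + 2) * real (pdeg s (levels s)) ^ 2 * real (pdeg s (k - 1)) ^ \<mu>
                   * (CR\<^sup>2 / (CR - C2lvl)) \<and>
             (\<forall>m1 m2. m1 + m2 \<ge> mR (degree_list s) k \<longrightarrow>
                (\<forall>v\<in>dg_space s k.
                   energy_nrm s k (w_cycle s m1 m2 k v)
                     \<le> CR * Sigma_R s \<mu> m1 m2 k * energy_nrm s k v))"
proof (rule exI[of _ "2 * C2lvl"], intro conjI)
  \<comment> \<open>Every constant above the two-level constant is admissible; the threshold adapts to it.\<close>
  let ?C = "2 * C2lvl"
  \<comment> \<open>In terms of the degree list, \<open>K = length ds\<close>, \<open>p_K = last ds\<close>, and \<open>ds ! (k - 2)\<close> is \<open>p_{k-1}\<close>.\<close>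
  define b where "b = (\<lambda>ds k. 2 ^ length ds * real (last ds) ^ 2 * real (ds ! (k - 2)) ^ \<mu> * (?C\<^sup>2 / (?C - C2lvl)))"
  define mR where "mR = (\<lambda>ds k. nat \<lceil>(b ds k)\<^sup>2\<rceil>)"
  have C: "C2lvl < ?C" using assms(13) by simp
  then show "?C > C2lvl" .
  show "\<exists>mR :: nat list \<Rightarrow> nat \<Rightarrow> nat.
           \<forall>s\<in>S. \<forall>k\<in>{2..levels s}.
             sqrt (real (mR (degree_list s) k))
               \<ge> 2 ^ (levels s - k + 2) * real (pdeg s (levels s)) ^ 2 * real (pdeg s (k - 1)) ^ \<mu>
                   * (?C\<^sup>2 / (?C - C2lvl)) \<and>
             (\<forall>m1 m2. m1 + m2 \<ge> mR (degree_list s) k \<longrightarrow>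
                (\<forall>v\<in>dg_space s k.
                   energy_nrm s k (w_cycle s m1 m2 k v)
                     \<le> ?C * Sigma_R s \<mu> m1 m2 k * energy_nrm s k v))"
  proof (rule exI[of _ mR], intro ballI conjI allI impI)
    fix s k assume s: "s \<in> S" and k: "k \<in> {2..levels s}"
    interpret multigrid s \<Omega> csr cqu Cp \<alpha>lo \<alpha>hi \<beta>max ccoer C\<Lambda>
      by unfold_locales (fact assms(2,5,6) assms(7-10)[OF s] assms(12)[OF s])+
    have len: "length (degree_list s) = levels s" by (simp add: degree_list_def)
    moreover have "last (degree_list s) = pdeg s (levels s)" using k by (simp add: degree_list_def)
    moreover have "degree_list s ! (k - 2) = pdeg s (k - 1)"
    proof -
      have "Suc (k - 2) = k - 1" using k by auto
      then show ?thesis using k by (auto simp: degree_list_def simp del: upt_Suc)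
    qed
    ultimately have b: "b (degree_list s) k
        = 2 ^ levels s * real (pdeg s (levels s)) ^ 2 * real (pdeg s (k - 1)) ^ \<mu> * (?C\<^sup>2 / (?C - C2lvl))"
      by (simp add: b_def)
    have mR: "(b (degree_list s) k)\<^sup>2 \<le> real (mR (degree_list s) k)"
      unfolding mR_def by (rule real_nat_ceiling_ge)
    have "2 ^ (levels s - k + 2) * real (pdeg s (levels s)) ^ 2 * real (pdeg s (k - 1)) ^ \<mu>
        * (?C\<^sup>2 / (?C - C2lvl)) \<le> b (degree_list s) k"
      unfolding b using k C by (intro mult_right_mono power_increasing) auto
    also have "\<dots> \<le> sqrt (real (mR (degree_list s) k))" by (rule real_le_rsqrt[OF mR])
    finally show "2 ^ (levels s - k + 2) * real (pdeg s (levels s)) ^ 2 * real (pdeg s (k - 1)) ^ \<mu>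
        * (?C\<^sup>2 / (?C - C2lvl)) \<le> sqrt (real (mR (degree_list s) k))" .
    fix m1 m2 v assume m: "mR (degree_list s) k \<le> m1 + m2" and v: "v \<in> dg_space s k"
    have "(b (degree_list s) k)\<^sup>2 \<le> real (m1 + m2)" using mR m by linarith
    then show "energy_nrm s k (w_cycle s m1 m2 k v) \<le> ?C * Sigma_R s \<mu> m1 m2 k * energy_nrm s k v"
      unfolding b using k by (intro w_cycle_estimate[OF assms(14)[OF s] assms(13) C _ _ _ v]) auto
  qed
qed

end
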